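(* Let $\Lambda$ be an admissible sequence whose associated expansion has exactly one negative exponent, i.e. $\Theta(t)\sim\sum_{i\ge0}A_{k_i}t^{k_i}$ as $t\to0^+$ with $k_0<0$ and $k_i\ge0$ for all $i>0$, and put $\mu=-k_0$. Then, as $n\to\infty$, $$t_\Lambda^0(n)=(2\pi(\mu+1))^{-\frac12}\bigl(\mu\,\zeta_R(\mu+1)A_{-\mu}\bigr)^{\frac{1-2A_0}{2(\mu+1)}}\,n^{\frac{2A_0-2-\mu}{2(\mu+1)}}\exp\left[\left(\frac n\mu\right)^{\frac{\mu}{\mu+1}}(\mu+1)\bigl(\zeta_R(\mu+1)A_{-\mu}\bigr)^{\frac1{\mu+1}}+\zeta_\Lambda'(0)\right][1+o(1)].$$
   Context: A sequence $\Lambda$ is called admissible if it is a nondecreasing sequence of positive integers (the same integer may occur finitely many times; all sums and products over $\lambda\in\Lambda$ count multiplicity) such that: (i) $1\in\Lambda$; (ii) $\Theta(t)=\sum_{\lambda\in\Lambda}e^{-\lambda t}$ converges for all $t>0$; (iii) as $t\to0^+$, $\Theta$ admits a full asymptotic expansion $\Theta(t)\sim\sum_{i\ge0}A_{k_i}t^{k_i}$ with real exponents $k_0<k_1<k_2<\cdots$, $k_i\to\infty$, $k_0<0$ and $A_{k_0}\neq0$. Thus $A_x$ is the coefficient of $t^x$ in the expansion, with $A_x=0$ if $t^x$ does not occur; in particular $A_0$ is the coefficient of $t^0$. Let $\zeta_\Lambda(s)=\sum_{\lambda\in\Lambda}\lambda^{-s}$ for $\Re s>-k_0$, also denoting its meromorphic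 continuation to $\mathbb{C}$ (regular at $s=0$). $\zeta_R$ is the Riemann zeta-function. Let $p_\Lambda(n,m)$ be the number of partitions of $n$ into $m$ summands from $\Lambda$, where repetition of summands is allowed and equal integers occupying different positions of $\Lambda$ are regarded as different; that is, $\prod_{\lambda\in\Lambda}(1-zx^\lambda)^{-1}=\sum_{n,m\ge0}p_\Lambda(n,m)x^nz^m$. For $n\ge1$ set $t_\Lambda^0(n)=\sum_{m\ge0}p_\Lambda(n,m)$. *)

theory Defs
  imports
    "HOL-Complex_Analysis.Complex_Analysis"
    "HOL-Library.Landau_Symbols"
    "HOL-Library.Multiset"
begin

text \<open>
  A sequence \<open>\<Lambda>\<close> of positive integers is a function from positions to values. It is total because
  a finite sequence has bounded \<open>\<Theta>\<close>, which contradicts a leading exponent \<open>k\<^sub>0 < 0\<close>.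
\<close>

definition seq_theta :: "(nat \<Rightarrow> nat) \<Rightarrow> real \<Rightarrow> real" where
  "seq_theta \<Lambda> t = (\<Sum>i. exp (- real (\<Lambda> i) * t))"

text \<open>
  The coefficients are indexed by the exponents themselves: \<open>A x\<close> is the coefficient of \<open>t\<^sup>x\<close>, and it
  vanishes if \<open>t\<^sup>x\<close> does not occur. Apart from the leading one, coefficients of occurring exponents
  may be zero, so that expansions with finitely many terms are covered as well.
\<close>

definition theta_expansion :: "(nat \<Rightarrow> nat) \<Rightarrow> (nat \<Rightarrow> real) \<Rightarrow> (real \<Rightarrow> real) \<Rightarrow> bool" where
  "theta_expansion \<Lambda> k A \<longleftrightarrow>
     strict_mono k \<and> filterlim k at_top sequentially \<and> k 0 < 0 \<and> A (k 0) \<noteq> 0 \<and>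
     (\<forall>x. x \<notin> range k \<longrightarrow> A x = 0) \<and>
     (\<forall>N. (\<lambda>t. seq_theta \<Lambda> t - (\<Sum>i\<le>N. A (k i) * t powr k i))
            \<in> o[at_right 0](\<lambda>t. t powr k N))"

definition admissible_seq :: "(nat \<Rightarrow> nat) \<Rightarrow> bool" where
  "admissible_seq \<Lambda> \<longleftrightarrow>
     mono \<Lambda> \<and> (\<forall>i. \<Lambda> i > 0) \<and> (\<forall>a. finite {i. \<Lambda> i = a}) \<and>
     1 \<in> range \<Lambda> \<and>
     (\<forall>t>0. summable (\<lambda>i. exp (- real (\<Lambda> i) * t))) \<and>
     (\<exists>k A. theta_expansion \<Lambda> k A)"

text \<open>
  The meromorphic continuation to the whole plane of \<open>\<Sum>\<^sub>i \<Lambda>\<^sub>i\<^sup>-\<^sup>s\<close>, given on the half-plane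
  \<open>Re s > \<sigma>\<close>. Requiring it to be nicely meromorphic removes the removable singularities and fixes
  the value at the poles, so that at most one function satisfies the description.
\<close>

definition seq_zeta :: "(nat \<Rightarrow> nat) \<Rightarrow> real \<Rightarrow> complex \<Rightarrow> complex" where
  "seq_zeta \<Lambda> \<sigma> =
     (THE Z. Z nicely_meromorphic_on UNIV \<and>
             (\<forall>s. Re s > \<sigma> \<longrightarrow> Z s = (\<Sum>i. of_nat (\<Lambda> i) powr (- s))))"

text \<open>The Riemann zeta-function at real arguments \<open>s > 1\<close>, the only ones for which it is used.\<close>

definition riemann_zeta :: "real \<Rightarrow> real" where
  "riemann_zeta s = (\<Sum>n. real (Suc n) powr (- s))"

text \<open>
  A partition is a multiset of positions rather than of values, so that equal integers at different
  positions count as different summands.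
\<close>

definition seq_partitions :: "(nat \<Rightarrow> nat) \<Rightarrow> nat \<Rightarrow> nat \<Rightarrow> nat" where
  "seq_partitions \<Lambda> n m = card {M :: nat multiset. size M = m \<and> (\<Sum>i\<in>#M. \<Lambda> i) = n}"

definition total_partitions :: "(nat \<Rightarrow> nat) \<Rightarrow> nat \<Rightarrow> nat" where
  "total_partitions \<Lambda> n = (\<Sum>m. seq_partitions \<Lambda> n m)"

end

theory Submission
  imports Defs "HOL-Probability.Characteristic_Functions" "HOL-Real_Asymp.Real_Asymp"
begin

text \<open>
  Let \<open>a\<^sub>m = (\<Sum>\<lambda> | m. \<lambda>) / m\<close>. The generating function of the partition numbers is \<open>exp P\<close> with
  \<open>P z = (\<Sum>m. a\<^sub>m z\<^sup>m)\<close>, and \<open>F y = P (exp (- y)) = (\<Sum>n\<ge>1. \<Theta> (n y) / n)\<close>. After the singular part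
  of \<open>\<Theta>\<close> has been removed, this series is a Riemann sum, so that
  \<open>F y = A \<zeta>(\<mu> + 1) y\<^sup>-\<^sup>\<mu> - A\<^sub>0 ln y + D + o(1)\<close> as \<open>y\<close> decreases to \<open>0\<close>. The Mellin transform of the
  same function continues \<open>\<zeta>\<^sub>\<Lambda>\<close> and identifies \<open>D\<close> with \<open>\<zeta>\<^sub>\<Lambda>'(0)\<close>. As the derivatives of \<open>F\<close> are
  monotone, their leading asymptotics follow from that of \<open>F\<close>.

  The saddle point method is applied to Cauchy's integral over the circle of radius \<open>exp (- y)\<close>,
  where \<open>- F' y = n\<close>. Contributions away from the saddle are negligible because \<open>\<bar>exp P\<bar>\<close> is a product of
  explicit factors: near any angle \<open>\<theta>\<^sub>0\<close>, either many factors are small, or all but finitely many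
  behave as they do near \<open>0\<close> while the factor of the element \<open>1\<close> still gains a power of \<open>y\<close>. By
  convexity of \<open>F y + n y\<close>, its minimum may be compared with the value at the explicit minimiser of
  \<open>A \<zeta>(\<mu> + 1) y\<^sup>-\<^sup>\<mu> + n y\<close>.
\<close>

section \<open>The generating function\<close>

text \<open>The expansion of \<Theta> is known for real \<open>t\<close> only. The classical
  argument also uses \<Theta> at complex arguments, or the growth of the zeta function on vertical
  lines, and inverts a Mellin transform; here the logarithm is studied on the real axis alone and
  the decay on the circle is read off from the factors themselves. The price is an error
  \<open>o(1)\<close> without a rate. It locates the saddle point \<open>Y\<close> only up to a
  factor tending to 1, while the exponent has size \<open>n * Y\<close>, which tends to infinity. So
  values of the exponent cannot be compared by inserting one approximate point into it; minimality
  at each of the two points gives a two-sided squeeze instead. The central peak has width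
  \<open>y powr (1 + \<mu> / 2)\<close>, and everything else must be of smaller order. If almost all
  elements are multiples of some \<open>q > 1\<close>, peaks of the same width stand at the angles
  \<open>2 * pi * j / q\<close>. Only finitely many factors help there, and a single factor
  \<open>y\<close> is already enough.\<close>

locale theta_seq =
  fixes L :: "nat \<Rightarrow> nat"
  assumes L_pos: "L i > 0"
    and L_summable: "t > 0 \<Longrightarrow> summable (\<lambda>i. exp (- real (L i) * t))"
begin

lemma finite_L_le: "finite {i. L i \<le> a}"
proof -
  have "(\<lambda>i. exp (- real (L i) * 1)) \<longlonglongrightarrow> 0"
    using L_summable[of 1] summable_LIMSEQ_zero by fastforce
  then have "eventually (\<lambda>i. exp (- real (L i) * 1) < exp (- real a)) sequentially"
    by (rule order_tendstoD) simp
  then obtain N where N: "\<And>i. i \<ge> N \<Longrightarrow> exp (- real (L i) * 1) < exp (- real a)"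
    unfolding eventually_sequentially by blast
  have "{i. L i \<le> a} \<subseteq> {..<N}"
  proof
    fix i assume "i \<in> {i. L i \<le> a}"
    then have "\<not> exp (- real (L i) * 1) < exp (- real a)" by simp
    then show "i \<in> {..<N}" using N[of i] by (metis lessThan_iff not_le)
  qed
  then show ?thesis using finite_subset by blast
qed

lemma finite_L_dvd: "m > 0 \<Longrightarrow> finite {i. L i dvd m}"
  by (rule finite_subset[OF _ finite_L_le[of m]]) (auto dest: dvd_imp_le)

section \<open>Partitions as multisets of positions\<close>

definition parts :: "nat \<Rightarrow> nat multiset set" where
  "parts n = {M. (\<Sum>i\<in>#M. L i) = n}"

lemma size_le_weight: "size M \<le> (\<Sum>i\<in>#M. L i)"
proof (induction M)
  case (add x M)
  then show ?case using L_pos[of x] by simp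
qed simp

lemma mem_le_weight: "i \<in># M \<Longrightarrow> L i \<le> (\<Sum>i\<in>#M. L i)"
  by (metis insert_DiffM le_add1 msed_map_invR sum_mset.insert image_mset_add_mset)

lemma finite_parts: "finite (parts n)"
proof -
  have "parts n \<subseteq> (\<Union>m\<le>n. {M. set_mset M \<subseteq> {i. L i \<le> n} \<and> size M = m})"
  proof
    fix M assume M: "M \<in> parts n"
    then have "size M \<le> n" using size_le_weight[of M] by (simp add: parts_def)
    moreover have "set_mset M \<subseteq> {i. L i \<le> n}"
      using M mem_le_weight[of _ M] by (auto simp: parts_def)
    ultimately show "M \<in> (\<Union>m\<le>n. {M. set_mset M \<subseteq> {i. L i \<le> n} \<and> size M = m})" by blast
  qed
  moreover have "finite (\<Union>m\<le>n. {M. set_mset M \<subseteq> {i. L i \<le> n} \<and> size M = m})"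
    using finite_multisets_of_size[OF finite_L_le[of n]] by (intro finite_UN_I) (auto simp: multisets_of_size_def)
  ultimately show ?thesis by (rule finite_subset)
qed

text \<open>Summands are positive, so a partition of \<open>n\<close> has at most \<open>n\<close>
  of them and the series over \<open>m\<close> is a finite sum of cardinalities of disjoint
  sets.\<close>

lemma total_partitions_eq: "total_partitions L n = card (parts n)"
proof -
  have fin: "finite {M. size M = m \<and> (\<Sum>i\<in>#M. L i) = n}" for m
    by (rule finite_subset[OF _ finite_parts[of n]]) (auto simp: parts_def)
  have "seq_partitions L n m = 0" if "m \<notin> {..n}" for m
  proof -
    have "{M. size M = m \<and> (\<Sum>i\<in>#M. L i) = n} = {}"
      using size_le_weight that by fastforce
    then show ?thesis by (simp only: seq_partitions_def card.empty)
  qed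
  then have "total_partitions L n = (\<Sum>m\<le>n. seq_partitions L n m)"
    unfolding total_partitions_def by (intro suminf_finite) auto
  also have "\<dots> = card (\<Union>m\<le>n. {M. size M = m \<and> (\<Sum>i\<in>#M. L i) = n})"
    unfolding seq_partitions_def by (intro card_UN_disjoint [symmetric]) (auto simp: fin)
  also have "(\<Union>m\<le>n. {M. size M = m \<and> (\<Sum>i\<in>#M. L i) = n}) = parts n"
    using size_le_weight by (auto simp: parts_def)
  finally show ?thesis .
qed

text \<open>These are the coefficients of \<open>z * deriv P z\<close>: the logarithm of the factor
  of position \<open>i\<close> contributes \<open>L i\<close> at every positive multiple of
  \<open>L i\<close>. At \<open>m = 0\<close> infinitely many positions qualify, and the sum is 0 by
  convention.\<close>

definition lsum :: "nat \<Rightarrow> nat" where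
  "lsum m = (\<Sum>i | L i dvd m. L i)"

lemma card_parts_ge_count:
  assumes "k * L i \<le> n"
  shows "card {M \<in> parts n. k \<le> count M i} = card (parts (n - k * L i))"
proof (rule bij_betw_same_card[symmetric])
  have w: "(\<Sum>j\<in>#replicate_mset k i. L j) = k * L i"
    by (simp add: image_replicate_mset)
  show "bij_betw (\<lambda>M. M + replicate_mset k i) (parts (n - k * L i)) {M \<in> parts n. k \<le> count M i}"
  proof (rule bij_betw_byWitness[where f' = "\<lambda>M. M - replicate_mset k i"])
    show "\<forall>M\<in>{M \<in> parts n. k \<le> count M i}. M - replicate_mset k i + replicate_mset k i = M"
      by (auto simp: count_le_replicate_mset_subset_eq subset_mset.diff_add)
    show "(\<lambda>M. M + replicate_mset k i) ` parts (n - k * L i) \<subseteq> {M \<in> parts n. k \<le> count M i}"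
      using assms w by (auto simp: parts_def)
    show "(\<lambda>M. M - replicate_mset k i) ` {M \<in> parts n. k \<le> count M i} \<subseteq> parts (n - k * L i)"
    proof safe
      fix M assume M: "M \<in> parts n" "k \<le> count M i"
      then have "M = (M - replicate_mset k i) + replicate_mset k i"
        by (simp add: count_le_replicate_mset_subset_eq subset_mset.diff_add)
      then have "(\<Sum>i\<in>#M. L i) = (\<Sum>i\<in>#M - replicate_mset k i. L i) + k * L i"
        using w by (metis image_mset_union sum_mset.union)
      then show "M - replicate_mset k i \<in> parts (n - k * L i)"
        using M by (simp add: parts_def)
    qed
  qed simp
qed

lemma weight_eq_sum:
  assumes "finite S" "set_mset M \<subseteq> S"
  shows "(\<Sum>i\<in>#M. L i) = (\<Sum>i\<in>S. count M i * L i)"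
  using assms(2)
proof (induction M)
  case (add x M)
  have "(\<Sum>i\<in>S. count (add_mset x M) i * L i) = (\<Sum>i\<in>S. count M i * L i + (if i = x then L i else 0))"
    by (intro sum.cong) auto
  also have "\<dots> = (\<Sum>i\<in>S. count M i * L i) + L x"
    using add.prems assms(1) by (simp add: sum.distrib)
  finally show ?case using add by simp
qed simp

text \<open>Double counting of the total weight of all partitions of \<open>n\<close>. Copies of a
  position are counted one at a time; at least \<open>k\<close> copies of \<open>i\<close> occur in
  exactly \<open>card (parts (n - k * L i))\<close> partitions, and collecting the pairs with
  \<open>m = k * L i\<close> leaves \<open>lsum m\<close>. This is the coefficient form of the
  differential equation satisfied by \<open>exp P\<close>.\<close>

lemma parts_recurrence:
  "n * card (parts n) = (\<Sum>m\<in>{1..n}. lsum m * card (parts (n - m)))"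
proof -
  let ?S = "{i. L i \<le> n}"
  have finS: "finite ?S" by (rule finite_L_le)
  \<comment> \<open>The multiplicity is written as a number of thresholds \<open>k\<close>, so that
    the sums over \<open>k\<close> and over partitions can be exchanged.\<close>
  have cnt: "count M i * L i = (\<Sum>k\<in>{k\<in>{1..n}. k \<le> count M i}. L i)" if "M \<in> parts n" for M i
  proof -
    have "count M i \<le> n" using that size_le_weight[of M] count_le_size[of M i] by (auto simp: parts_def)
    then have "{k\<in>{1..n}. k \<le> count M i} = {1..count M i}" by auto
    then show ?thesis by simp
  qed
  have "n * card (parts n) = (\<Sum>M\<in>parts n. (\<Sum>i\<in>#M. L i))"
    by (simp add: parts_def)
  also have "\<dots> = (\<Sum>M\<in>parts n. \<Sum>i\<in>?S. count M i * L i)"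
  proof (intro sum.cong refl weight_eq_sum finS)
    fix M assume "M \<in> parts n"
    then show "set_mset M \<subseteq> ?S" using mem_le_weight[of _ M] by (auto simp: parts_def)
  qed
  also have "\<dots> = (\<Sum>M\<in>parts n. \<Sum>i\<in>?S. \<Sum>k\<in>{1..n}. if k \<le> count M i then L i else 0)"
    by (intro sum.cong refl, subst cnt, assumption, subst sum.inter_filter) simp_all
  also have "\<dots> = (\<Sum>i\<in>?S. \<Sum>k\<in>{1..n}. \<Sum>M\<in>parts n. if k \<le> count M i then L i else 0)"
    by (subst sum.swap, intro sum.cong refl, subst sum.swap, rule refl)
  also have "\<dots> = (\<Sum>i\<in>?S. \<Sum>k\<in>{1..n}. L i * card {M\<in>parts n. k \<le> count M i})"
    by (intro sum.cong refl) (simp add: finite_parts flip: sum.inter_filter)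
  also have "\<dots> = (\<Sum>i\<in>?S. \<Sum>k\<in>{1..n}. if k * L i \<le> n then L i * card (parts (n - k * L i)) else 0)"
  proof (intro sum.cong refl)
    fix i k
    show "L i * card {M\<in>parts n. k \<le> count M i}
        = (if k * L i \<le> n then L i * card (parts (n - k * L i)) else 0)"
    proof (cases "k * L i \<le> n")
      case False
      have "{M\<in>parts n. k \<le> count M i} = {}"
      proof safe
        fix M assume M: "M \<in> parts n" "k \<le> count M i"
        have "k * L i \<le> count M i * L i" using M by simp
        also have "\<dots> \<le> (\<Sum>j\<in>insert i (set_mset M). count M j * L j)"
          by (intro member_le_sum) auto
        also have "\<dots> = n" using M weight_eq_sum[of "insert i (set_mset M)" M, OF _ subset_insertI]
          by (auto simp: parts_def)
        finally show "M \<in> {}" using False by simp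
      qed
      then show ?thesis using False by (simp only: card.empty) simp
    qed (simp add: card_parts_ge_count)
  qed
  also have "\<dots> = (\<Sum>i\<in>?S. \<Sum>m\<in>{1..n}. if L i dvd m then L i * card (parts (n - m)) else 0)"
  proof (rule sum.cong[OF refl])
    fix i
    have "(\<Sum>k\<in>{1..n}. if k * L i \<le> n then L i * card (parts (n - k * L i)) else 0)
        = (\<Sum>k\<in>{k\<in>{1..n}. k * L i \<le> n}. L i * card (parts (n - k * L i)))"
      by (simp flip: sum.inter_filter)
    also have "\<dots> = (\<Sum>m\<in>{m\<in>{1..n}. L i dvd m}. L i * card (parts (n - m)))"
    proof (rule sum.reindex_bij_witness[where i = "\<lambda>m. m div L i" and j = "\<lambda>k. k * L i"])
      fix m assume m: "m \<in> {m\<in>{1..n}. L i dvd m}"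
      then obtain k where k: "m = L i * k" by blast
      have "k * 1 \<le> k * L i" using L_pos[of i] by (intro mult_le_mono) auto
      then have "k \<le> m" "k > 0" using k m by (auto simp: mult.commute)
      then have "k \<le> n" using m by simp
      then show "m div L i \<in> {k\<in>{1..n}. k * L i \<le> n}" "m div L i * L i = m"
        using m k L_pos[of i] \<open>k > 0\<close> by (auto simp: mult.commute)
    next
      fix k assume "k \<in> {k\<in>{1..n}. k * L i \<le> n}"
      then have k: "0 < k" "k * L i \<le> n" by auto
      moreover have "k * 1 \<le> k * L i" using L_pos[of i] by (intro mult_le_mono) auto
      ultimately have "k \<le> n" by linarith
      with k show "k * L i div L i = k" "k * L i \<in> {m\<in>{1..n}. L i dvd m}"
        using L_pos[of i] by auto
    qed auto
    finally show "(\<Sum>k\<in>{1..n}. if k * L i \<le> n then L i * card (parts (n - k * L i)) else 0)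
        = (\<Sum>m\<in>{1..n}. if L i dvd m then L i * card (parts (n - m)) else 0)"
      by (simp flip: sum.inter_filter)
  qed
  also have "\<dots> = (\<Sum>m\<in>{1..n}. \<Sum>i\<in>?S. if L i dvd m then L i * card (parts (n - m)) else 0)"
    by (rule sum.swap)
  also have "\<dots> = (\<Sum>m\<in>{1..n}. lsum m * card (parts (n - m)))"
  proof (intro sum.cong refl)
    fix m assume m: "m \<in> {1..n}"
    have "{i \<in> ?S. L i dvd m} = {i. L i dvd m}"
      using m dvd_imp_le[of _ m] by (auto intro: order_trans)
    then show "(\<Sum>i\<in>?S. if L i dvd m then L i * card (parts (n - m)) else 0) = lsum m * card (parts (n - m))"
      using finS by (simp add: lsum_def sum_distrib_right flip: sum.inter_filter)
  qed
  finally show ?thesis .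
qed

end

section \<open>Coefficients as integrals over a circle\<close>

lemma integral_cis_int:
  fixes j :: int
  shows "(LBINT \<theta>:{-pi..pi}. cis (of_int j * \<theta>)) = (if j = 0 then 2 * pi else 0)"
proof (cases "j = 0")
  case False
  have "((\<lambda>\<theta>. cis (of_int j * \<theta>)) has_integral
      (cis (of_int j * pi) / (\<i> * of_int j) - cis (of_int j * (- pi)) / (\<i> * of_int j))) {-pi..pi}"
  proof (rule fundamental_theorem_of_calculus)
    fix x assume "x \<in> {-pi..pi}"
    show "((\<lambda>\<theta>. cis (of_int j * \<theta>) / (\<i> * of_int j)) has_vector_derivative cis (of_int j * x)) (at x within {-pi..pi})"
    proof -
      have "((\<lambda>z. exp (\<i> * of_int j * z) / (\<i> * of_int j)) has_field_derivative exp (\<i> * of_int j * of_real x)) (at (of_real x))"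
        using False by (auto intro!: derivative_eq_intros)
      then show ?thesis
        using has_vector_derivative_real_field by (fastforce simp: cis_conv_exp mult.assoc)
    qed
  qed simp
  moreover have "cis (of_int j * pi) = cis (of_int j * (- pi))"
  proof -
    have "cis (of_int j * pi) = cis (of_int j * (- pi)) * cis (2 * pi * of_int j)"
      by (simp add: cis_mult algebra_simps)
    also have "cis (2 * pi * of_int j) = 1" by (simp add: cis_multiple_2pi)
    finally show ?thesis by simp
  qed
  ultimately have "((\<lambda>\<theta>. cis (of_int j * \<theta>)) has_integral 0) {-pi..pi}" by simp
  moreover have "set_integrable lborel {-pi..pi} (\<lambda>\<theta>. cis (of_int j * \<theta>))"
    by (intro borel_integrable_atLeastAtMost' continuous_intros)
  ultimately show ?thesis
    using False by (simp add: set_borel_integral_eq_integral(2) integral_unique)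
qed (simp add: set_lebesgue_integral_def scaleR_conv_of_real flip: of_real_mult)

text \<open>The modulus of each term does not depend on the angle, so convergence at the radius
  \<open>r\<close> justifies termwise integration over the finite interval. Orthogonality leaves the
  term with \<open>k = n\<close>.\<close>

lemma cauchy_coeff:
  fixes p :: "nat \<Rightarrow> real"
  assumes r: "r \<ge> 0" and sm: "summable (\<lambda>n. p n * r ^ n)" and nn: "\<And>n. p n \<ge> 0"
    and g: "\<And>\<theta>. (\<lambda>n. of_real (p n) * (of_real r * cis \<theta>) ^ n) sums g \<theta>"
  shows "(LBINT \<theta>:{-pi..pi}. g \<theta> * cis (- (real n * \<theta>))) = of_real (2 * pi * (p n * r ^ n))"
proof -
  let ?M = "restrict_space lborel {-pi..pi}"
  define f where "f = (\<lambda>k \<theta>. complex_of_real (p k * r ^ k) * cis (of_int (int k - int n) * \<theta>))"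
  have feq: "f k \<theta> = of_real (p k) * (of_real r * cis \<theta>) ^ k * cis (- (real n * \<theta>))" for k \<theta>
  proof -
    have "cis (of_int (int k - int n) * \<theta>) = cis \<theta> ^ k * cis (- (real n * \<theta>))"
      by (simp add: Complex.DeMoivre cis_mult left_diff_distrib)
    then show ?thesis by (simp add: f_def power_mult_distrib)
  qed
  have nf: "norm (f k \<theta>) = p k * r ^ k" for k \<theta>
    using nn[of k] r by (simp add: f_def norm_mult norm_power)
  have int: "set_integrable lborel {-pi..pi} (f k)" for k
    unfolding f_def by (intro borel_integrable_atLeastAtMost' continuous_intros)
  have int': "integrable ?M (f k)" for k
    using int[of k] by (subst integrable_restrict_space) (auto simp: set_integrable_def)
  have val: "integral\<^sup>L ?M (f k) = (if k = n then complex_of_real (2 * pi * (p n * r ^ n)) else 0)" for k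
  proof -
    have "integral\<^sup>L ?M (f k) = (LBINT \<theta>:{-pi..pi}. f k \<theta>)"
      by (subst integral_restrict_space) (auto simp: set_lebesgue_integral_def)
    also have "\<dots> = complex_of_real (p k * r ^ k) * (LBINT \<theta>:{-pi..pi}. cis (of_int (int k - int n) * \<theta>))"
      unfolding f_def by (rule set_integral_mult_right)
    finally show ?thesis unfolding integral_cis_int by simp
  qed
  have em: "measure ?M (space ?M) = 2 * pi"
    by (simp add: measure_restrict_space space_restrict_space)
  have "(\<lambda>k. integral\<^sup>L ?M (f k)) sums (\<integral>\<theta>. (\<Sum>k. f k \<theta>) \<partial>?M)"
  proof (rule sums_integral[OF int'])
    show "AE x in ?M. summable (\<lambda>i. norm (f i x))"
      using sm by (simp add: nf)
    show "summable (\<lambda>i. \<integral>x. norm (f i x) \<partial>?M)"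
      using summable_mult[OF sm, of "2 * pi"] by (simp only: nf lebesgue_integral_const em real_scaleR_def)
  qed
  moreover have "(\<Sum>k. f k \<theta>) = g \<theta> * cis (- (real n * \<theta>))" for \<theta>
    unfolding feq using sums_mult2[OF g[of \<theta>], of "cis (- (real n * \<theta>))"]
    by (rule sums_unique[symmetric])
  moreover have "(\<lambda>k. integral\<^sup>L ?M (f k)) sums of_real (2 * pi * (p n * r ^ n))"
    unfolding val by (rule sums_single)
  ultimately have "(\<integral>\<theta>. g \<theta> * cis (- (real n * \<theta>)) \<partial>?M) = of_real (2 * pi * (p n * r ^ n))"
    by (metis (no_types, lifting) Bochner_Integration.integral_cong sums_unique2)
  then show ?thesis
    by (subst (asm) integral_restrict_space) (auto simp: set_lebesgue_integral_def)
qed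

section \<open>The logarithm of the generating function\<close>

context theta_seq
begin

text \<open>At \<open>m = 0\<close> division by zero gives the value 0, the right constant term for
  the logarithm of a series that starts with 1.\<close>

definition acoef :: "nat \<Rightarrow> real" where
  "acoef m = real (lsum m) / real m"

lemma acoef_nonneg: "acoef m \<ge> 0"
  by (simp add: acoef_def)

text \<open>Each counted term of \<Theta> is at least \<open>exp (- real m * t)\<close>. As
  \<open>t\<close> is arbitrary, the counting function grows more slowly than any exponential, so
  that \<open>P\<close> converges in the whole unit disc.\<close>

lemma card_L_le:
  assumes "t > 0"
  shows "real (card {i. L i \<le> m}) \<le> exp (real m * t) * seq_theta L t"
proof -
  have "real (card {i. L i \<le> m}) * exp (- real m * t) = (\<Sum>i\<in>{i. L i \<le> m}. exp (- real m * t))"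
    by simp
  also have "\<dots> \<le> (\<Sum>i\<in>{i. L i \<le> m}. exp (- real (L i) * t))"
    using assms by (intro sum_mono) simp
  also have "\<dots> \<le> seq_theta L t"
    unfolding seq_theta_def by (intro sum_le_suminf L_summable assms finite_L_le) auto
  finally show ?thesis by (simp add: exp_minus field_simps)
qed

lemma acoef_le_card: "acoef m \<le> real (card {i. L i \<le> m})"
proof (cases "m = 0")
  case False
  have "lsum m \<le> (\<Sum>i | L i dvd m. m)"
    unfolding lsum_def using False by (intro sum_mono) (auto dest: dvd_imp_le)
  also have "\<dots> \<le> (\<Sum>i | L i \<le> m. m)"
    using False finite_L_le[of m] by (intro sum_mono2) (auto dest: dvd_imp_le)
  finally have "lsum m \<le> card {i. L i \<le> m} * m" by simp
  then have "real (lsum m) \<le> real (card {i. L i \<le> m}) * real m"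
    by (metis of_nat_le_iff of_nat_mult)
  then show ?thesis using False by (simp add: acoef_def field_simps)
qed (simp add: acoef_def)

lemma acoef_summable_real:
  assumes "0 \<le> r" "r < 1"
  shows "summable (\<lambda>m. acoef m * r ^ m)"
proof (cases "r = 0")
  case False
  \<comment> \<open>With this choice \<open>exp t * r\<close> is the square root of
    \<open>r\<close>.\<close>
  define t where "t = - ln r / 2"
  have t: "t > 0" using assms False by (simp add: t_def)
  have e: "exp t * r < 1"
  proof -
    have "exp t * r = exp (t + ln r)" using False assms by (simp add: exp_add)
    also have "t + ln r < 0" using t by (simp add: t_def)
    finally show ?thesis using assms False by simp
  qed
  show ?thesis
  proof (rule summable_comparison_test')
    show "summable (\<lambda>m. seq_theta L t * (exp t * r) ^ m)"
      using e assms by (intro summable_mult summable_geometric) simp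
    fix m
    have "acoef m \<le> exp (real m * t) * seq_theta L t"
      using acoef_le_card card_L_le[OF t] order_trans by blast
    then have "acoef m * r ^ m \<le> exp (real m * t) * seq_theta L t * r ^ m"
      using assms by (intro mult_right_mono) auto
    also have "\<dots> = seq_theta L t * (exp t * r) ^ m"
      by (simp add: power_mult_distrib exp_of_nat_mult)
    finally show "norm (acoef m * r ^ m) \<le> seq_theta L t * (exp t * r) ^ m"
      using assms acoef_nonneg[of m] by simp
  qed
qed (use summable_finite[of "{0}" "\<lambda>m. acoef m * r ^ m"] in auto)

definition P :: "complex \<Rightarrow> complex" where
  "P z = (\<Sum>m. of_real (acoef m) * z ^ m)"

lemma acoef_summable_norm:
  assumes "norm z < 1"
  shows "summable (\<lambda>m. norm (complex_of_real (acoef m) * z ^ m))"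
  using acoef_summable_real[of "norm z"] assms acoef_nonneg
  by (simp add: norm_mult norm_power)

lemma P_sums: "norm z < 1 \<Longrightarrow> (\<lambda>m. of_real (acoef m) * z ^ m) sums P z"
  unfolding P_def by (rule summable_sums[OF summable_norm_cancel[OF acoef_summable_norm]])

text \<open>The function \<open>g = exp P\<close> satisfies the differential equation
  \<open>g' = P' * g\<close>. For its Taylor coefficients this is the recurrence
  \<open>parts_recurrence\<close>, and both sequences start with 1, since only the empty partition
  has weight 0.\<close>

lemma sums_exp_P:
  assumes z: "norm z < 1"
  shows "(\<lambda>n. of_nat (card (parts n)) * z ^ n) sums exp (P z)"
proof -
  define F :: "complex fps" where "F = Abs_fps (\<lambda>m. of_real (acoef m))"
  have evF: "eval_fps F = P"
    by (simp add: F_def eval_fps_def P_def fun_eq_iff)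
  have rad: "fps_conv_radius F \<ge> 1"
    unfolding fps_conv_radius_def F_def
  proof (rule conv_radius_geI_ex')
    fix r :: real assume "0 < r" "ereal r < 1"
    then show "summable (\<lambda>n. fps_nth (Abs_fps (\<lambda>m. complex_of_real (acoef m))) n * of_real r ^ n)"
      using P_sums[of "of_real r"] by (simp add: sums_iff)
  qed
  have "eval_fps F holomorphic_on eball 0 (fps_conv_radius F)"
    by (intro holomorphic_on_eval_fps) auto
  then have holP: "P holomorphic_on ball 0 1"
    unfolding evF using rad ball_eball_mono[of 1 "fps_conv_radius F" 0]
    by (auto intro: holomorphic_on_subset simp: one_ereal_def)
  define g where "g = (\<lambda>z. exp (P z))"
  have holg: "g holomorphic_on ball 0 1"
    unfolding g_def by (intro holomorphic_intros holP)
  define G where "G = fps_expansion g 0"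
  have gG: "g has_fps_expansion G"
    unfolding G_def by (rule has_fps_expansion_fps_expansion[OF _ _ holg]) auto
  have PF: "P has_fps_expansion F"
    unfolding evF[symmetric] using rad by (intro eval_fps_has_fps_expansion) (auto intro: less_le_trans[of _ 1])
  have "(\<lambda>z. deriv P z * g z) has_fps_expansion fps_deriv F * G"
    by (intro has_fps_expansion_mult has_fps_expansion_deriv PF gG)
  moreover have "eventually (\<lambda>z. deriv P z * g z = deriv g z) (nhds 0)"
  proof -
    have "eventually (\<lambda>z. z \<in> ball (0::complex) 1) (nhds 0)"
      by (intro eventually_nhds_in_open) auto
    then show ?thesis
    proof eventually_elim
      case (elim z)
      then have "P field_differentiable at z"
        using holP holomorphic_on_imp_differentiable_at by blast
      then have "(P has_field_derivative deriv P z) (at z)"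
        by (simp add: DERIV_deriv_iff_field_differentiable)
      then have "(g has_field_derivative (exp (P z) * deriv P z)) (at z)"
        unfolding g_def by (intro derivative_eq_intros) auto
      then show ?case by (simp add: DERIV_imp_deriv g_def)
    qed
  qed
  ultimately have "deriv g has_fps_expansion fps_deriv F * G"
    by (subst has_fps_expansion_cong[OF _ refl, symmetric])
  moreover have "deriv g has_fps_expansion fps_deriv G"
    by (intro has_fps_expansion_deriv gG)
  ultimately have dG: "fps_deriv G = fps_deriv F * G"
    using fps_expansion_unique_complex by blast
  have nth: "fps_nth G n = of_nat (card (parts n))" for n
  proof (induction n rule: less_induct)
    case (less n)
    show ?case
    proof (cases n)
      case 0
      have "P 0 = of_real (acoef 0)"
        unfolding P_def using suminf_finite[of "{0}" "\<lambda>m. complex_of_real (acoef m) * 0 ^ m"] by simp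
      then have "fps_nth G 0 = 1" by (simp add: G_def fps_expansion_def g_def acoef_def)
      moreover have "parts 0 = {{#}}"
      proof -
        have "M = {#}" if "M \<in> parts 0" for M
        proof -
          from that have "(\<Sum>i\<in>#M. L i) = 0" by (simp only: parts_def mem_Collect_eq)
          then have "size M = 0" using size_le_weight[of M] by linarith
          then show ?thesis by simp
        qed
        moreover have "{#} \<in> parts 0" by (simp add: parts_def)
        ultimately show ?thesis by blast
      qed
      ultimately show ?thesis using 0 by simp
    next
      case (Suc m)
      have *: "{1..n} = Suc ` {..m}"
        unfolding Suc by (simp add: atMost_atLeast0 image_Suc_atLeastAtMost)
      have "of_nat n * fps_nth G n = fps_nth (fps_deriv G) m"
        using Suc by simp
      also have "\<dots> = (\<Sum>i\<le>m. of_nat (Suc i) * of_real (acoef (Suc i)) * fps_nth G (m - i))"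
        unfolding dG fps_mult_nth by (simp add: F_def atLeast0AtMost)
      also have "\<dots> = (\<Sum>i\<le>m. of_nat (lsum (Suc i) * card (parts (n - Suc i))))"
        using less.IH Suc by (intro sum.cong refl) (simp add: acoef_def del: of_nat_Suc)
      also have "\<dots> = of_nat (\<Sum>i\<le>m. lsum (Suc i) * card (parts (n - Suc i)))"
        by simp
      also have "(\<Sum>i\<le>m. lsum (Suc i) * card (parts (n - Suc i))) = (\<Sum>i\<in>{1..n}. lsum i * card (parts (n - i)))"
        unfolding * by (subst sum.reindex) auto
      also have "\<dots> = n * card (parts n)" by (rule parts_recurrence[symmetric])
      finally have "of_nat n * fps_nth G n = of_nat n * of_nat (card (parts n))"
        by (simp only: of_nat_mult)
      moreover have "of_nat n \<noteq> (0 :: complex)" using Suc by (simp del: of_nat_Suc)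
      ultimately show ?thesis by simp
    qed
  qed
  have "(\<lambda>n. (deriv ^^ n) g 0 / fact n * (z - 0) ^ n) sums g z"
    by (rule holomorphic_power_series[OF holg]) (use z in simp)
  moreover have "(deriv ^^ n) g 0 / fact n = of_nat (card (parts n))" for n
    using nth[of n] by (simp add: G_def fps_expansion_def)
  ultimately show ?thesis by (simp only: g_def diff_zero)
qed

lemma total_partitions_integral:
  assumes y: "y > 0"
  shows "of_real (2 * pi * (real (total_partitions L n) * exp (- real n * y)))
    = (LBINT \<theta>:{-pi..pi}. exp (P (of_real (exp (- y)) * cis \<theta>)) * cis (- (real n * \<theta>)))"
proof -
  have A: "(\<lambda>n. complex_of_real (real (card (parts n))) * (of_real (exp (- y)) * cis \<theta>) ^ n)
      sums exp (P (of_real (exp (- y)) * cis \<theta>))" for \<theta>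
    using sums_exp_P[of "of_real (exp (- y)) * cis \<theta>"] y by (simp add: norm_mult)
  have B: "summable (\<lambda>n. real (card (parts n)) * exp (- y) ^ n)"
  proof -
    have "summable (\<lambda>n. complex_of_real (real (card (parts n)) * exp (- y) ^ n))"
      using sums_exp_P[of "of_real (exp (- y))"] y by (auto simp: sums_iff)
    then show ?thesis by (simp only: summable_of_real_iff)
  qed
  have "(LBINT \<theta>:{-pi..pi}. exp (P (of_real (exp (- y)) * cis \<theta>)) * cis (- (real n * \<theta>)))
      = of_real (2 * pi * (real (card (parts n)) * exp (- y) ^ n))"
    by (rule cauchy_coeff[OF _ B _ A]) auto
  also have "exp (- y) ^ n = exp (- real n * y)"
    by (simp flip: exp_of_nat_mult)
  finally show ?thesis by (simp only: total_partitions_eq)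
qed

end

section \<open>Continuation of the zeta function\<close>

lemma absolutely_integrable_continuous_bound:
  fixes f :: "real \<Rightarrow> 'a::euclidean_space"
  assumes "continuous_on S f" "S \<in> sets lebesgue" "g integrable_on S" "\<And>x. x \<in> S \<Longrightarrow> norm (f x) \<le> g x"
  shows "f absolutely_integrable_on S"
  using assms continuous_imp_measurable_on_sets_lebesgue
  by (intro measurable_bounded_by_integrable_imp_absolutely_integrable) auto

text \<open>The power \<open>t^(s - 1)\<close>, written with \<open>exp\<close> to be entire in
  \<open>s\<close> for every real \<open>t\<close>; differentiation under the integral sign then
  needs no case distinction.\<close>

definition mker :: "complex \<Rightarrow> real \<Rightarrow> complex" where
  "mker s t = exp ((s - 1) * of_real (ln t))"

lemma norm_mker: "t > 0 \<Longrightarrow> norm (mker s t) = t powr (Re s - 1)"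
  by (simp add: mker_def powr_def)

lemma continuous_on_mker: "S \<subseteq> {0<..} \<Longrightarrow> continuous_on S (mker s)"
  unfolding mker_def by (intro continuous_intros) auto

lemma mker_of_real: "t > 0 \<Longrightarrow> mker (of_real x) t = of_real (t powr (x - 1))"
  by (simp add: mker_def powr_def flip: exp_of_real)

lemma mker_eq_powr: "t > 0 \<Longrightarrow> mker s t = of_real t powr (s - 1)"
  by (simp add: mker_def powr_def Ln_of_real)

lemma mellin_integrable:
  assumes "continuous_on J h" "J \<in> sets lebesgue" "J \<subseteq> {0<..}"
    and "(\<lambda>t. h t * t powr (Re s - 1)) absolutely_integrable_on J"
  shows "(\<lambda>t. of_real (h t) * mker s t) absolutely_integrable_on J"
proof (rule absolutely_integrable_continuous_bound)
  show "continuous_on J (\<lambda>t. of_real (h t) * mker s t)"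
    by (intro continuous_intros continuous_on_mker assms)
  show "(\<lambda>t. norm (h t * t powr (Re s - 1))) integrable_on J"
    by (rule assms(4)[unfolded absolutely_integrable_on_def, THEN conjunct2])
  fix x assume "x \<in> J"
  then show "norm (of_real (h x) * mker s x) \<le> norm (h x * x powr (Re s - 1))"
    using assms(3) by (auto simp: norm_mult norm_mker)
qed fact

lemma powr_le_sum_powr:
  fixes t a b x :: real
  assumes "a \<le> x" "x \<le> b" "t > 0"
  shows "t powr x \<le> t powr a + t powr b"
proof (cases "t \<ge> 1")
  case True
  then have "t powr x \<le> t powr b" using assms by (intro powr_mono) auto
  then show ?thesis by (simp add: add_increasing)
next
  case False
  then have "t powr x \<le> t powr a" using assms by (intro powr_mono') auto
  then show ?thesis by (simp add: add_increasing2)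
qed

text \<open>On compact subintervals the Leibniz rule gives holomorphy. The integrals over them
  converge locally uniformly, because on a disc around \<open>s\<close> the kernel is dominated by
  the sum of its moduli at the leftmost and the rightmost point of the disc.\<close>

lemma mellin_holomorphic:
  fixes h :: "real \<Rightarrow> real" and a b :: "nat \<Rightarrow> real"
  assumes U: "open U" "convex U"
    and J: "J \<in> sets lebesgue" "J \<subseteq> {0<..}" "continuous_on J h"
    and ab: "\<And>n. {a n..b n} \<subseteq> J" "\<And>t. t \<in> J \<Longrightarrow> eventually (\<lambda>n. t \<in> {a n..b n}) sequentially"
    and int: "\<And>s. s \<in> U \<Longrightarrow> (\<lambda>t. h t * t powr (Re s - 1)) absolutely_integrable_on J"
  shows "(\<lambda>s. integral J (\<lambda>t. of_real (h t) * mker s t)) holomorphic_on U"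
proof -
  define F where "F = (\<lambda>n s. integral (cbox (a n) (b n)) (\<lambda>t. complex_of_real (h t) * mker s t))"
  have hol: "F n holomorphic_on U" for n
    unfolding F_def
  proof (rule leibniz_rule_holomorphic)
    have sub: "cbox (a n) (b n) \<subseteq> J" using ab(1)[of n] by simp
    show "((\<lambda>s. of_real (h t) * mker s t) has_field_derivative of_real (h t) * (mker s t * of_real (ln t))) (at s within U)" for s t
      unfolding mker_def by (auto intro!: derivative_eq_intros)
    show "(\<lambda>t. of_real (h t) * mker s t) integrable_on cbox (a n) (b n)" for s
      using sub J by (intro integrable_continuous continuous_intros continuous_on_mker) (auto intro: continuous_on_subset)
    have 1: "continuous_on (U \<times> cbox (a n) (b n)) (\<lambda>z. h (snd z))"
      by (rule continuous_on_compose2[OF J(3)]) (use sub in \<open>auto intro!: continuous_intros\<close>)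
    have 2: "continuous_on (U \<times> cbox (a n) (b n)) (\<lambda>z. ln (snd z))"
      by (intro continuous_intros) (use sub J in force)
    show "continuous_on (U \<times> cbox (a n) (b n)) (\<lambda>(s, t). of_real (h t) * (mker s t * of_real (ln t)))"
      unfolding mker_def split_beta by (intro continuous_intros 1 2)
  qed (fact U(2))
  show ?thesis
  proof (rule holomorphic_uniform_sequence[OF U(1) hol])
    fix s assume s: "s \<in> U"
    then obtain d where d: "d > 0" "cball s d \<subseteq> U"
      using U(1) open_contains_cball by blast
    define w where "w = (\<lambda>t. norm (h t * t powr (Re (s - of_real d) - 1)) + norm (h t * t powr (Re (s + of_real d) - 1)))"
    have "s - of_real d \<in> U" "s + of_real d \<in> U"
      using d by (auto simp: subset_eq dist_norm)
    from int[OF this(1)] int[OF this(2)] have w: "w integrable_on J"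
      unfolding w_def absolutely_integrable_on_def by (intro integrable_add) auto
    have w0: "w t \<ge> 0" for t by (simp add: w_def)
    \<comment> \<open>\<open>T n\<close> bounds the part of the integral outside
      \<open>{a n..b n}\<close> for all points of the disc at once.\<close>
    define T where "T = (\<lambda>n. integral J (\<lambda>t. if t \<in> {a n..b n} then 0 else w t))"
    have wi: "w integrable_on {a n..b n}" for n
      by (rule integrable_continuous_interval)
         (use ab(1)[of n] J in \<open>auto simp: w_def intro!: continuous_intros intro: continuous_on_subset\<close>)
    have wi': "(\<lambda>t. if t \<in> {a n..b n} then 0 else w t) integrable_on J" for n
    proof -
      have "(\<lambda>t. if t \<in> {a n..b n} then w t else 0) integrable_on J"
        using wi[of n] ab(1)[of n] by (simp only: integrable_restrict_Int Int_absorb2)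
      from integrable_diff[OF w this] show ?thesis by (rule integrable_eq) auto
    qed
    have T: "T \<longlonglongrightarrow> integral J (\<lambda>_. 0)"
      unfolding T_def
    proof (rule dominated_convergence(2)[where h = w])
      show "(\<lambda>n. if x \<in> {a n..b n} then 0 else w x) \<longlonglongrightarrow> 0" if "x \<in> J" for x
        by (intro tendsto_eventually eventually_mono[OF ab(2)[OF that]]) auto
    qed (use w w0 wi' in auto)
    have bd: "norm (F n z - integral J (\<lambda>t. of_real (h t) * mker z t)) \<le> T n" if z: "z \<in> cball s d" for n z
    proof -
      have zU: "z \<in> U" using z d by auto
      have i1: "(\<lambda>t. of_real (h t) * mker z t) integrable_on J"
        using mellin_integrable[OF J(3,1,2) int[OF zU]] set_lebesgue_integral_eq_integral(1) by blast
      have i2: "(\<lambda>t. of_real (h t) * mker z t) integrable_on {a n..b n}"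
        using ab(1)[of n] J by (intro integrable_continuous_interval continuous_intros continuous_on_mker) (auto intro: continuous_on_subset)
      have i3: "(\<lambda>t. if t \<in> {a n..b n} then of_real (h t) * mker z t else 0) integrable_on J"
        using i2 ab(1)[of n] by (simp only: integrable_restrict_Int Int_absorb2)
      have "F n z = integral J (\<lambda>t. if t \<in> {a n..b n} then of_real (h t) * mker z t else 0)"
        unfolding F_def using ab(1)[of n] by (simp only: integral_restrict_Int Int_absorb2 interval_cbox)
      then have "F n z - integral J (\<lambda>t. of_real (h t) * mker z t) =
          integral J (\<lambda>t. (if t \<in> {a n..b n} then of_real (h t) * mker z t else 0) - of_real (h t) * mker z t)"
        using i1 i3 by (simp add: integral_diff)
      also have "norm \<dots> \<le> T n"
        unfolding T_def
      proof (rule integral_norm_bound_integral[OF integrable_diff[OF i3 i1] wi'])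
        fix t assume t: "t \<in> J"
        then have t0: "t > 0" using J by auto
        have "\<bar>Re z - Re s\<bar> \<le> d" using z abs_Re_le_cmod[of "z - s"] by (simp add: dist_norm norm_minus_commute)
        then have "t powr (Re z - 1) \<le> t powr (Re s - d - 1) + t powr (Re s + d - 1)"
          using t0 by (intro powr_le_sum_powr) auto
        then have "norm (of_real (h t) * mker z t) \<le> w t"
          using t0 by (auto simp: norm_mult norm_mker w_def abs_mult simp flip: distrib_left intro!: mult_left_mono)
        then show "norm ((if t \<in> {a n..b n} then of_real (h t) * mker z t else 0) - of_real (h t) * mker z t)
            \<le> (if t \<in> {a n..b n} then 0 else w t)"
          by auto
      qed
      finally show ?thesis .
    qed
    have "uniform_limit (cball s d) F (\<lambda>s. integral J (\<lambda>t. of_real (h t) * mker s t)) sequentially"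
    proof (rule uniform_limitI)
      fix e :: real assume "e > 0"
      then have "eventually (\<lambda>n. T n < e) sequentially"
        using order_tendstoD(2)[OF T, of e] by simp
      then show "eventually (\<lambda>n. \<forall>x\<in>cball s d. dist (F n x) (integral J (\<lambda>t. of_real (h t) * mker x t)) < e) sequentially"
      proof (rule eventually_mono, intro ballI)
        fix n x assume "T n < e" "x \<in> cball s d"
        then show "dist (F n x) (integral J (\<lambda>t. of_real (h t) * mker x t)) < e"
          using bd[of x n] by (simp add: dist_norm)
      qed
    qed
    then show "\<exists>d>0. cball s d \<subseteq> U \<and> uniform_limit (cball s d) F (\<lambda>s. integral J (\<lambda>t. of_real (h t) * mker s t)) sequentially"
      using d by blast
  qed
qed

lemma has_integral_mker_unit:
  assumes "Re s > 0"
  shows "(mker s has_integral 1 / s) {0<..1}"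
proof -
  have s: "s \<noteq> 0" using assms by auto
  \<comment> \<open>The antiderivative \<open>t^s / s\<close>, continued by 0. As
    \<open>Re s > 0\<close>, it is continuous at 0, although the integrand may be unbounded
    there.\<close>
  define G where "G = (\<lambda>t::real. if t \<le> 0 then 0 else exp (s * of_real (ln t)) / s)"
  have "((\<lambda>t. if t = 0 then 0 else mker s t) has_integral (G 1 - G 0)) {0..1}"
  proof (rule fundamental_theorem_of_calculus_interior)
    show "continuous_on {0..1} G"
    proof (rule continuous_at_imp_continuous_on, intro ballI)
      fix x :: real assume x: "x \<in> {0..1}"
      show "isCont G x"
      proof (cases "x = 0")
        case True
        have "((\<lambda>t::real. \<bar>t\<bar>) \<longlongrightarrow> 0) (at 0)"
          using tendsto_rabs[OF tendsto_ident_at[of "0::real" UNIV]] by simp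
        then have "((\<lambda>t. \<bar>t\<bar> powr Re s) \<longlongrightarrow> 0) (at 0)"
          by (rule tendsto_zero_powrI[OF _ tendsto_const]) (use assms in auto)
        then have "((\<lambda>t. \<bar>t\<bar> powr Re s / norm s) \<longlongrightarrow> 0) (at 0)"
          by (rule tendsto_divide_zero)
        moreover have "eventually (\<lambda>t. norm (G t) \<le> \<bar>t\<bar> powr Re s / norm s) (at 0)"
        proof (intro always_eventually allI)
          fix t :: real
          show "norm (G t) \<le> \<bar>t\<bar> powr Re s / norm s"
          proof (cases "t \<le> 0")
            case False
            then have "norm (G t) = norm (exp (s * of_real (ln t))) / norm s"
              by (simp only: G_def if_False norm_divide)
            also have "norm (exp (s * of_real (ln t))) = exp (Re s * ln t)"
              by (simp only: norm_exp_eq_Re) simp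
            also have "\<dots> = \<bar>t\<bar> powr Re s"
              using False by (simp only: powr_def) simp
            finally show ?thesis by simp
          qed (simp add: G_def)
        qed
        ultimately have "(G \<longlongrightarrow> 0) (at 0)"
          by (rule Lim_null_comparison[rotated])
        then show ?thesis using True unfolding isCont_def by (simp add: G_def)
      next
        case False
        with x have "x > 0" by auto
        then have "isCont (\<lambda>t. exp (s * of_real (ln t)) / s) x"
          using s by (intro continuous_intros) auto
        moreover have E: "eventually (\<lambda>t. exp (s * of_real (ln t)) / s = G t) (nhds x)"
          by (rule eventually_mono[OF eventually_nhds_in_open[of "{0<..}" x]]) (use \<open>x > 0\<close> in \<open>auto simp: G_def\<close>)
        ultimately show ?thesis using isCont_cong[OF E] by simp
      qed
    qed
    fix x :: real assume x: "x \<in> {0<..<1}"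
    have "((\<lambda>t. exp (s * of_real (ln t)) / s) has_vector_derivative mker s x) (at x)"
    proof -
      have "((\<lambda>t. s * of_real (ln t)) has_vector_derivative s * of_real (1 / x)) (at x)"
        using x by (intro has_vector_derivative_mult_right has_vector_derivative_of_real)
           (auto simp: has_real_derivative_iff_has_vector_derivative[symmetric] intro!: derivative_eq_intros)
      from field_vector_diff_chain_at[OF this DERIV_exp]
      have "((\<lambda>t. exp (s * of_real (ln t))) has_vector_derivative (s * of_real (1 / x)) * exp (s * of_real (ln x))) (at x)"
        by (simp add: o_def)
      from has_vector_derivative_divide[OF this, of s]
      have "((\<lambda>t. exp (s * of_real (ln t)) / s) has_vector_derivative (s * of_real (1 / x)) * exp (s * of_real (ln x)) / s) (at x)" .
      moreover have "exp (s * of_real (ln x)) = mker s x * of_real x"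
      proof -
        have 1: "of_real x = exp (complex_of_real (ln x))" using x by (simp add: exp_of_real)
        show ?thesis unfolding mker_def 1 exp_add[symmetric] by (rule arg_cong[of _ _ exp]) (simp add: algebra_simps)
      qed
      ultimately show ?thesis using x s by simp
    qed
    then have "(G has_vector_derivative mker s x) (at x)"
      by (rule has_vector_derivative_transform_within_open[of _ _ _ "{0<..}"]) (use x in \<open>auto simp: G_def\<close>)
    then show "(G has_vector_derivative (if x = 0 then 0 else mker s x)) (at x)"
      using x by simp
  qed auto
  moreover have "G 1 - G 0 = 1 / s" by (simp add: G_def)
  ultimately have "((\<lambda>t. if t = 0 then 0 else mker s t) has_integral 1 / s) {0..1}"
    by (simp only:)
  then have "((\<lambda>t. if t \<in> {0<..1} then mker s t else 0) has_integral 1 / s) {0..1}"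
    by (rule has_integral_eq[rotated]) auto
  then show ?thesis by (subst (asm) has_integral_restrict) auto
qed

text \<open>Substitution \<open>u = l * t\<close> in Euler's integral. The Lebesgue-Borel form is
  the one in which the affine substitution and the termwise integration in
  \<open>mellin_theta_sums\<close> are carried out.\<close>

lemma has_bochner_integral_Gamma_scaled:
  assumes l: "(l::real) > 0" and s: "Re s > 0"
  shows "has_bochner_integral lborel (\<lambda>t. indicator {0<..} t *\<^sub>R (of_real (exp (- l * t)) * mker s t))
    (Gamma s * of_real l powr (- s))"
proof -
  define f where "f = (\<lambda>u::real. indicator {0<..} u *\<^sub>R (complex_of_real (exp (- u)) * mker s u))"
  have meas: "f \<in> borel_measurable lborel"
    unfolding f_def measurable_lborel2
    by (intro borel_measurable_continuous_on_indicator continuous_intros continuous_on_mker) auto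
  have eq: "complex_of_real t powr (s - 1) / of_real (exp t) = of_real (exp (- t)) * mker s t" if "t \<in> {0<..}" for t
    using that by (simp add: mker_eq_powr exp_minus divide_inverse mult.commute)
  have "(\<lambda>t. complex_of_real (exp (- t)) * mker s t) absolutely_integrable_on {0<..}"
    using absolutely_integrable_Gamma_integral'[OF s] by (rule set_integrable_cong[THEN iffD1, rotated -1]) (use eq in auto)
  note ai = this
  have "((\<lambda>t. complex_of_real (exp (- t)) * mker s t) has_integral Gamma s) {0<..}"
    using Gamma_integral_complex'[OF s] by (rule has_integral_eq[rotated]) (use eq in auto)
  then have "(LINT t:{0<..}|lebesgue. complex_of_real (exp (- t)) * mker s t) = Gamma s"
    using set_lebesgue_integral_eq_integral(2)[OF ai] by (simp add: integral_unique)
  then have "has_bochner_integral lebesgue f (Gamma s)"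
    using ai unfolding set_integrable_def set_lebesgue_integral_def f_def[symmetric]
    by (simp add: has_bochner_integral_iff)
  then have "has_bochner_integral lborel f (Gamma s)"
    using meas by (simp add: has_bochner_integral_iff integrable_completion integral_completion)
  then have 1: "has_bochner_integral lborel (\<lambda>x. f (0 + l * x)) (Gamma s /\<^sub>R \<bar>l\<bar>)"
    using l by (subst (asm) lborel_has_bochner_integral_real_affine_iff[of l _ _ 0]) auto
  have "f (0 + l * x) = mker s l * (indicator {0<..} x *\<^sub>R (of_real (exp (- l * x)) * mker s x))" for x
    using l by (auto simp: f_def indicator_def zero_less_mult_iff mker_def ln_mult algebra_simps exp_add exp_diff)
  with 1 have 1: "has_bochner_integral lborel (\<lambda>x. mker s l * (indicator {0<..} x *\<^sub>R (of_real (exp (- l * x)) * mker s x))) (Gamma s /\<^sub>R \<bar>l\<bar>)"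
    by simp
  have nz: "mker s l \<noteq> 0" by (simp add: mker_def)
  have "has_bochner_integral lborel (\<lambda>x. inverse (mker s l) * (mker s l * (indicator {0<..} x *\<^sub>R (of_real (exp (- l * x)) * mker s x)))) (inverse (mker s l) * (Gamma s /\<^sub>R \<bar>l\<bar>))"
    by (rule has_bochner_integral_mult_right) (use 1 in simp)
  moreover have "inverse (mker s l) * (Gamma s /\<^sub>R \<bar>l\<bar>) = Gamma s * of_real l powr (- s)"
  proof -
    have "of_real l powr (- s) = inverse (of_real l powr ((s - 1) + 1))"
      by (simp add: powr_minus)
    also have "of_real l powr ((s - 1) + 1) = mker s l * of_real l"
      using l by (subst powr_add) (simp add: mker_eq_powr)
    finally show ?thesis using l by (simp add: scaleR_conv_of_real)
  qed
  moreover have "inverse (mker s l) * (mker s l * z) = z" for z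
    using nz by simp
  ultimately show ?thesis by (simp only:)
qed

section \<open>The Mellin transform of \<Theta>\<close>

context theta_seq
begin

lemma theta_nonneg: "t > 0 \<Longrightarrow> seq_theta L t \<ge> 0"
  unfolding seq_theta_def by (intro suminf_nonneg L_summable) auto

lemma theta_sums: "t > 0 \<Longrightarrow> (\<lambda>i. exp (- real (L i) * t)) sums seq_theta L t"
  unfolding seq_theta_def by (intro summable_sums L_summable)

text \<open>As \<open>L i >= 1\<close>, every single term decays at least like
  \<open>exp (- t)\<close>.\<close>

lemma theta_le:
  assumes "t \<ge> a" "a > 0"
  shows "seq_theta L t \<le> exp (- (t - a)) * seq_theta L a"
proof -
  have "seq_theta L t \<le> (\<Sum>i. exp (- (t - a)) * exp (- real (L i) * a))"
    unfolding seq_theta_def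
  proof (intro suminf_le L_summable summable_mult)
    fix i
    have "1 * (t - a) \<le> real (L i) * (t - a)"
      using L_pos[of i] assms by (intro mult_right_mono) auto
    then show "exp (- real (L i) * t) \<le> exp (- (t - a)) * exp (- real (L i) * a)"
      by (simp add: algebra_simps flip: exp_add)
  qed (use assms in auto)
  also have "\<dots> = exp (- (t - a)) * seq_theta L a"
    unfolding seq_theta_def by (rule suminf_mult) (use L_summable assms in auto)
  finally show ?thesis .
qed

lemma continuous_theta: "continuous_on {0<..} (seq_theta L)"
proof (rule continuous_at_imp_continuous_on, intro ballI)
  fix x :: real assume x: "x \<in> {0<..}"
  have "uniform_limit {x/2<..} (\<lambda>n t. \<Sum>i<n. exp (- real (L i) * t)) (\<lambda>t. \<Sum>i. exp (- real (L i) * t)) sequentially"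
  proof (rule Weierstrass_m_test)
    show "summable (\<lambda>i. exp (- real (L i) * (x/2)))" using x by (intro L_summable) auto
    fix i t assume "t \<in> {x/2<..}"
    then have "real (L i) * (x/2) \<le> real (L i) * t" by (intro mult_left_mono) auto
    then show "norm (exp (- real (L i) * t)) \<le> exp (- real (L i) * (x/2))" by simp
  qed
  then have "continuous_on {x/2<..} (\<lambda>t. \<Sum>i. exp (- real (L i) * t))"
    by (rule uniform_limit_theorem[rotated]) (auto intro!: always_eventually continuous_intros)
  then have "continuous_on {x/2<..} (seq_theta L)"
    by (simp only: seq_theta_def[abs_def])
  then show "isCont (seq_theta L) x"
    using x by (subst (asm) continuous_on_eq_continuous_at) auto
qed

lemma theta_powr_integrable_atLeast:
  "(\<lambda>t. seq_theta L t * t powr (\<sigma> - 1)) absolutely_integrable_on {1..}"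
proof (rule absolutely_integrable_continuous_bound)
  \<comment> \<open>On \<open>{1..}\<close> raising the exponent only enlarges the power, and with a
    positive \<open>p\<close> the Gamma integral converges at 0 as well.\<close>
  define p where "p = max \<sigma> 1"
  show "continuous_on {1..} (\<lambda>t. seq_theta L t * t powr (\<sigma> - 1))"
    by (intro continuous_intros continuous_on_subset[OF continuous_theta]) auto
  have "(\<lambda>t. t powr (p - 1) / exp t) integrable_on {0..}"
    by (rule has_integral_integrable[OF Gamma_integral_real]) (simp add: p_def)
  then have "(\<lambda>t. t powr (p - 1) / exp t) absolutely_integrable_on {0..}"
    by (rule nonnegative_absolutely_integrable_1) auto
  then have "(\<lambda>t. t powr (p - 1) / exp t) absolutely_integrable_on {1..}"
    by (rule set_integrable_subset) auto
  then have "(\<lambda>t. t powr (p - 1) / exp t) integrable_on {1..}"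
    by (rule set_lebesgue_integral_eq_integral(1))
  then show "(\<lambda>t. exp 1 * seq_theta L 1 * (t powr (p - 1) / exp t)) integrable_on {1..}"
    by (rule integrable_on_mult_right)
  fix t :: real assume t: "t \<in> {1..}"
  have "seq_theta L t * t powr (\<sigma> - 1) \<le> (exp (- (t - 1)) * seq_theta L 1) * t powr (p - 1)"
    using t theta_nonneg[of 1] by (intro mult_mono theta_le powr_mono) (auto simp: p_def)
  also have "\<dots> = exp 1 * seq_theta L 1 * (t powr (p - 1) / exp t)"
    by (simp add: exp_diff)
  finally show "norm (seq_theta L t * t powr (\<sigma> - 1)) \<le> exp 1 * seq_theta L 1 * (t powr (p - 1) / exp t)"
    using t theta_nonneg[of t] by simp
qed auto

text \<open>\<Theta> is integrated term by term against \<open>t^(s - 1)\<close>. The moduli of the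
  terms sum to an integrable function, which justifies the exchange. The entire function
  \<open>rGamma\<close> takes the place of a division by Gamma, so that the same prefactor serves
  for the continuation.\<close>

lemma mellin_theta_sums:
  assumes s: "Re s > 0" and int: "(\<lambda>t. seq_theta L t * t powr (Re s - 1)) absolutely_integrable_on {0<..}"
  shows "(\<lambda>i. of_nat (L i) powr (- s)) sums (rGamma s * integral {0<..} (\<lambda>t. of_real (seq_theta L t) * mker s t))"
proof -
  define f where "f = (\<lambda>i t. indicator {0<..} t *\<^sub>R (complex_of_real (exp (- real (L i) * t)) * mker s t))"
  have f: "has_bochner_integral lborel (f i) (Gamma s * of_nat (L i) powr (- s))" for i
    unfolding f_def using has_bochner_integral_Gamma_scaled[OF _ s, of "real (L i)"] L_pos[of i] by simp
  have nf: "norm (f i t) = indicator {0<..} t * (exp (- real (L i) * t) * t powr (Re s - 1))" for i t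
    by (simp add: f_def norm_mult norm_mker indicator_def)
  define g where "g = (\<lambda>t. indicator {0<..} t *\<^sub>R (seq_theta L t * t powr (Re s - 1)))"
  have gm: "g \<in> borel_measurable lborel"
    unfolding g_def measurable_lborel2
    by (intro borel_measurable_continuous_on_indicator continuous_intros continuous_theta) auto
  then have g: "integrable lborel g"
    using int unfolding set_integrable_def g_def[symmetric] by (simp add: integrable_completion)
  have "(\<lambda>i. integral\<^sup>L lborel (f i)) sums (\<integral>t. (\<Sum>i. f i t) \<partial>lborel)"
  proof (rule sums_integral)
    show "integrable lborel (f i)" for i using f has_bochner_integral_iff by blast
    have sm: "summable (\<lambda>i. norm (f i t))" and sl: "(\<Sum>i. norm (f i t)) = g t" for t
    proof -
      have "(\<lambda>i. norm (f i t)) sums g t"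
      proof (cases "t > 0")
        case True
        have "(\<lambda>i. exp (- real (L i) * t) * t powr (Re s - 1)) sums (seq_theta L t * t powr (Re s - 1))"
          by (intro sums_mult2 theta_sums True)
        then show ?thesis unfolding nf g_def using True by simp
      qed (simp add: nf g_def)
      then show "summable (\<lambda>i. norm (f i t))" "(\<Sum>i. norm (f i t)) = g t" by (auto simp: sums_iff)
    qed
    show "AE t in lborel. summable (\<lambda>i. norm (f i t))" using sm by simp
    show "summable (\<lambda>i. \<integral>t. norm (f i t) \<partial>lborel)"
    proof (rule summableI_nonneg_bounded)
      fix n
      have inf: "integrable lborel (\<lambda>t. norm (f i t))" for i
        using f has_bochner_integral_iff by (intro integrable_norm) blast
      have "(\<Sum>i<n. \<integral>t. norm (f i t) \<partial>lborel) = (\<integral>t. (\<Sum>i<n. norm (f i t)) \<partial>lborel)"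
        by (rule Bochner_Integration.integral_sum[symmetric]) (rule inf)
      also have "\<dots> \<le> integral\<^sup>L lborel g"
      proof (rule integral_mono[OF Bochner_Integration.integrable_sum[OF inf] g])
        show "(\<Sum>i<n. norm (f i t)) \<le> g t" for t
          unfolding sl[symmetric] by (intro sum_le_suminf sm) auto
      qed
      finally show "(\<Sum>i<n. \<integral>t. norm (f i t) \<partial>lborel) \<le> integral\<^sup>L lborel g" .
    qed (simp add: Bochner_Integration.integral_nonneg)
  qed
  also have "(\<lambda>i. integral\<^sup>L lborel (f i)) = (\<lambda>i. Gamma s * of_nat (L i) powr (- s))"
    using f has_bochner_integral_integral_eq by blast
  also have "(\<lambda>t. \<Sum>i. f i t) = (\<lambda>t. indicator {0<..} t *\<^sub>R (of_real (seq_theta L t) * mker s t))"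
  proof
    fix t
    show "(\<Sum>i. f i t) = indicator {0<..} t *\<^sub>R (of_real (seq_theta L t) * mker s t)"
    proof (cases "t > 0")
      case True
      have "(\<lambda>i. complex_of_real (exp (- real (L i) * t)) * mker s t) sums (of_real (seq_theta L t) * mker s t)"
        by (intro sums_mult2 sums_of_real theta_sums True)
      then show ?thesis using True by (simp add: f_def sums_iff)
    qed (simp add: f_def)
  qed
  also have "(\<integral>t. indicator {0<..} t *\<^sub>R (of_real (seq_theta L t) * mker s t) \<partial>lborel)
    = (\<integral>t. indicator {0<..} t *\<^sub>R (of_real (seq_theta L t) * mker s t) \<partial>lebesgue)"
    by (rule integral_completion[symmetric], unfold measurable_lborel2)
       (intro borel_measurable_continuous_on_indicator continuous_intros continuous_theta continuous_on_mker, auto)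
  also have "\<dots> = integral {0<..} (\<lambda>t. of_real (seq_theta L t) * mker s t)"
    unfolding set_lebesgue_integral_def[symmetric]
    by (intro set_lebesgue_integral_eq_integral(2) mellin_integrable continuous_theta int) auto
  finally have *: "(\<lambda>i. Gamma s * of_nat (L i) powr (- s)) sums integral {0<..} (\<lambda>t. of_real (seq_theta L t) * mker s t)" .
  have "Gamma s \<noteq> 0" using s by (auto simp: Gamma_eq_zero_iff elim!: nonpos_Ints_cases)
  then have c: "rGamma s * (Gamma s * z) = z" for z by (simp add: rGamma_inverse_Gamma)
  show ?thesis using sums_mult[OF *, of "rGamma s"] by (simp only: c)
qed

end

text \<open>The identity theorem, applied to the difference after its removable singularities are
  filled in, gives equality in a punctured neighbourhood of every point. This determines a nicely
  meromorphic function at the point itself: it is 0 at a pole and equals its limit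
  otherwise.\<close>

lemma nicely_meromorphic_eqI:
  assumes f: "f nicely_meromorphic_on UNIV" and g: "g nicely_meromorphic_on UNIV"
    and S: "open S" "S \<noteq> {}" "\<And>z. z \<in> S \<Longrightarrow> f z = g z"
  shows "f = g"
proof
  fix z
  have fm: "f meromorphic_on UNIV" and gm: "g meromorphic_on UNIV"
    using f g by (auto simp: nicely_meromorphic_on_def)
  define D where "D = remove_sings (\<lambda>w. f w - g w)"
  have dm: "(\<lambda>w. f w - g w) meromorphic_on UNIV" by (intro meromorphic_intros fm gm)
  have D: "D nicely_meromorphic_on UNIV"
    unfolding D_def by (rule remove_sings_nicely_meromorphic[OF dm])
  obtain w where w: "w \<in> S" using S by blast
  have D0: "D v = 0" if "v \<in> S" for v
  proof -
    have "remove_sings (\<lambda>w. f w - g w) v = remove_sings (\<lambda>_. 0) v"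
    proof (rule remove_sings_cong)
      have "eventually (\<lambda>x. x \<in> S) (at v)" using S that by (intro eventually_at_in_open') auto
      then show "eventually (\<lambda>x. f x - g x = 0) (at v)" by (rule eventually_mono) (use S in auto)
    qed simp
    then show ?thesis by (simp add: D_def)
  qed
  have "eventually (\<lambda>x. x \<in> S) (at w)" using S w by (intro eventually_at_in_open') auto
  then have "eventually (\<lambda>x. D x = 0) (at w)" by (rule eventually_mono) (use D0 in auto)
  then have "frequently (\<lambda>x. D x = 0) (at w)" by (intro eventually_frequently) auto
  then have Dz: "D v = 0" for v
    by (rule frequently_eq_meromorphic_imp_constant[OF _ D]) auto
  have "isolated_singularity_at (\<lambda>w. f w - g w) z"
    by (rule meromorphic_on_isolated_singularity[OF meromorphic_on_subset[OF dm]]) simp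
  then have "eventually (\<lambda>x. D x = f x - g x) (at z)"
    unfolding D_def by (rule eventually_remove_sings_eq_at)
  then have ev: "eventually (\<lambda>x. f x = g x) (at z)"
    by (rule eventually_mono) (simp add: Dz)
  have pole: "is_pole f z \<longleftrightarrow> is_pole g z" by (intro is_pole_cong ev refl)
  have lim: "f \<midarrow>z\<rightarrow> c \<longleftrightarrow> g \<midarrow>z\<rightarrow> c" for c
    by (intro filterlim_cong refl ev)
  have F: "is_pole f z \<and> f z = 0 \<or> f \<midarrow>z\<rightarrow> f z" using f by (auto simp: nicely_meromorphic_on_def)
  have G: "is_pole g z \<and> g z = 0 \<or> g \<midarrow>z\<rightarrow> g z" using g by (auto simp: nicely_meromorphic_on_def)
  have np: "\<not> (is_pole f z \<and> f \<midarrow>z\<rightarrow> c)" for c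
    using not_tendsto_and_filterlim_at_infinity[of "at z" f c] by (auto simp: is_pole_def)
  show "f z = g z"
  proof (cases "is_pole f z")
    case True
    then have "f z = 0" using F np by blast
    moreover have "g z = 0" using G np pole lim True by blast
    ultimately show ?thesis by simp
  next
    case False
    then have "f \<midarrow>z\<rightarrow> f z" "f \<midarrow>z\<rightarrow> g z" using F G pole lim by auto
    then show ?thesis by (rule LIM_unique)
  qed
qed

lemma seq_zeta_eqI:
  assumes "Z nicely_meromorphic_on UNIV"
    and "\<And>s. Re s > \<sigma> \<Longrightarrow> Z s = (\<Sum>i. of_nat (L i) powr (- s))"
  shows "seq_zeta L \<sigma> = Z"
  unfolding seq_zeta_def
proof (rule the_equality)
  fix Z' assume Z': "Z' nicely_meromorphic_on UNIV \<and> (\<forall>s. Re s > \<sigma> \<longrightarrow> Z' s = (\<Sum>i. of_nat (L i) powr (- s)))"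
  have "{s. Re s > \<sigma>} \<noteq> {}" using exI[of "\<lambda>s. Re s > \<sigma>" "of_real (\<sigma> + 1)"] by auto
  then show "Z' = Z"
    using Z' assms by (intro nicely_meromorphic_eqI[where S = "{s. Re s > \<sigma>}"]) (auto simp: open_halfspace_Re_gt)
qed (use assms in auto)

section \<open>Continuation by means of the expansion of \<Theta>\<close>

locale theta_expansion_seq = theta_seq +
  fixes k :: "nat \<Rightarrow> real" and A :: "real \<Rightarrow> real"
  assumes expansion: "theta_expansion L k A"
begin

lemma k_mono: "strict_mono k" and k_at_top: "filterlim k at_top sequentially"
  and k0_neg: "k 0 < 0" and A_k0: "A (k 0) \<noteq> 0" and A_eq_0: "x \<notin> range k \<Longrightarrow> A x = 0"
  using expansion by (auto simp: theta_expansion_def)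

definition remainder :: "nat \<Rightarrow> real \<Rightarrow> real" where
  "remainder N t = seq_theta L t - (\<Sum>i\<le>N. A (k i) * t powr k i)"

lemma remainder_smallo: "remainder N \<in> o[at_right 0](\<lambda>t. t powr k N)"
  using expansion unfolding theta_expansion_def remainder_def[abs_def] by blast

lemma remainder_Suc: "remainder N t = remainder (Suc N) t + A (k (Suc N)) * t powr k (Suc N)"
  by (simp add: remainder_def)

lemma continuous_remainder: "continuous_on {0<..} (remainder N)"
  unfolding remainder_def by (intro continuous_intros continuous_theta) auto

text \<open>The little-o statement gives the constant 1 near 0; on the rest of the interval the
  quotient is continuous on a compact set.\<close>

lemma remainder_bound:
  obtains C where "C > 0" "\<And>t. t \<in> {0<..1} \<Longrightarrow> \<bar>remainder N t\<bar> \<le> C * t powr k N"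
proof -
  have "eventually (\<lambda>t. norm (remainder N t) \<le> 1 * norm (t powr k N)) (at_right 0)"
    using landau_o.smallD[OF remainder_smallo, of 1] by simp
  then obtain d where d: "d > 0" "\<And>t. t > 0 \<Longrightarrow> t < d \<Longrightarrow> \<bar>remainder N t\<bar> \<le> t powr k N"
    unfolding eventually_at_right_field by auto
  define e where "e = min (d / 2) 1"
  have e: "e > 0" using d by (simp add: e_def)
  have "continuous_on {e..1} (\<lambda>t. remainder N t / t powr k N)"
    using e by (intro continuous_intros continuous_on_subset[OF continuous_remainder]) auto
  then have "compact ((\<lambda>t. remainder N t / t powr k N) ` {e..1})"
    by (rule compact_continuous_image) simp
  then obtain B where B: "\<And>t. t \<in> {e..1} \<Longrightarrow> \<bar>remainder N t / t powr k N\<bar> \<le> B"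
    using compact_imp_bounded bounded_iff by (metis (no_types, lifting) image_eqI real_norm_def)
  show ?thesis
  proof (rule that[of "max B 1"])
    fix t :: real assume t: "t \<in> {0<..1}"
    have "\<bar>remainder N t\<bar> \<le> B * t powr k N \<or> \<bar>remainder N t\<bar> \<le> 1 * t powr k N"
    proof (cases "t < d")
      case False
      then have "t \<in> {e..1}" using t d by (auto simp: e_def)
      from B[OF this] show ?thesis using t by (simp add: abs_divide pos_divide_le_eq)
    qed (use d t in auto)
    moreover have "B * t powr k N \<le> max B 1 * t powr k N" "1 * t powr k N \<le> max B 1 * t powr k N"
      by (intro mult_right_mono; simp)+
    ultimately show "\<bar>remainder N t\<bar> \<le> max B 1 * t powr k N" by linarith
  qed simp
qed

lemma powr_integrable_unit: "p > -1 \<Longrightarrow> (\<lambda>t::real. t powr p) integrable_on {0<..1}"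
proof -
  assume "p > -1"
  then have "(\<lambda>t::real. t powr p) integrable_on {0..1}" by (intro integrable_on_powr_from_0) auto
  then show ?thesis
    by (rule integrable_spike_set) (auto intro: negligible_subset[of "{0}"])
qed

lemma remainder_integrable:
  assumes "\<sigma> > - k N"
  shows "(\<lambda>t. remainder N t * t powr (\<sigma> - 1)) absolutely_integrable_on {0<..1}"
proof -
  obtain C where C: "C > 0" "\<And>t. t \<in> {0<..1} \<Longrightarrow> \<bar>remainder N t\<bar> \<le> C * t powr k N"
    using remainder_bound by blast
  show ?thesis
  proof (rule absolutely_integrable_continuous_bound)
    show "continuous_on {0<..1} (\<lambda>t. remainder N t * t powr (\<sigma> - 1))"
      by (intro continuous_intros continuous_on_subset[OF continuous_remainder]) auto
    show "(\<lambda>t. C * t powr (k N + \<sigma> - 1)) integrable_on {0<..1}"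
      using assms by (intro integrable_on_mult_right powr_integrable_unit) auto
    fix t :: real assume t: "t \<in> {0<..1}"
    have "\<bar>remainder N t\<bar> * t powr (\<sigma> - 1) \<le> C * t powr k N * t powr (\<sigma> - 1)"
      by (intro mult_right_mono C t) auto
    then show "norm (remainder N t * t powr (\<sigma> - 1)) \<le> C * t powr (k N + \<sigma> - 1)"
      by (simp add: abs_mult mult.assoc add_diff_eq flip: powr_add)
  qed auto
qed

lemma theta_powr_integrable:
  assumes "\<sigma> > - k 0"
  shows "(\<lambda>t. seq_theta L t * t powr (\<sigma> - 1)) absolutely_integrable_on {0<..}"
proof -
  have "(\<lambda>t. A (k 0) * t powr (k 0 + \<sigma> - 1)) absolutely_integrable_on {0<..1}"
    using assms
    by (intro set_integrable_mult_right nonnegative_absolutely_integrable_1 powr_integrable_unit) auto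
  from set_integral_add(1)[OF remainder_integrable[OF assms] this]
  have *: "(\<lambda>t. seq_theta L t * t powr (\<sigma> - 1)) absolutely_integrable_on {0<..1}"
    by (rule set_integrable_cong[THEN iffD1, rotated -1]) (auto simp: remainder_def algebra_simps simp flip: powr_add)
  have "{0<..1} \<union> {1..} = {0::real<..}" by auto
  then show ?thesis
    using absolutely_integrable_Un[OF * theta_powr_integrable_atLeast] by simp
qed

definition mellin_inf :: "complex \<Rightarrow> complex" where
  "mellin_inf s = integral {1..} (\<lambda>t. of_real (seq_theta L t) * mker s t)"

definition mellin_unit :: "nat \<Rightarrow> complex \<Rightarrow> complex" where
  "mellin_unit N s = integral {0<..1} (\<lambda>t. of_real (remainder N t) * mker s t)"

lemma holomorphic_mellin_inf: "mellin_inf holomorphic_on UNIV"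
  unfolding mellin_inf_def
proof (rule mellin_holomorphic[where a = "\<lambda>_. 1" and b = real])
  show "continuous_on {1..} (seq_theta L)" by (rule continuous_on_subset[OF continuous_theta]) auto
  show "eventually (\<lambda>n. t \<in> {1..real n}) sequentially" if "t \<in> {1..}" for t
    using eventually_ge_at_top[of "nat \<lceil>t\<rceil>"] by (rule eventually_mono) (use that in \<open>auto simp: nat_le_iff ceiling_le_iff\<close>)
qed (auto intro: theta_powr_integrable_atLeast)

lemma holomorphic_mellin_unit: "mellin_unit N holomorphic_on {s. Re s > - k N}"
  unfolding mellin_unit_def
proof (rule mellin_holomorphic[where a = "\<lambda>n. 1 / real (Suc n)" and b = "\<lambda>_. 1"])
  show "continuous_on {0<..1} (remainder N)" by (rule continuous_on_subset[OF continuous_remainder]) auto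
  show "eventually (\<lambda>n. t \<in> {1 / real (Suc n)..1}) sequentially" if "t \<in> {0<..1}" for t
    using eventually_ge_at_top[of "nat \<lceil>1 / t\<rceil>"]
  proof (rule eventually_mono)
    fix n assume "nat \<lceil>1 / t\<rceil> \<le> n"
    then have "1 / t \<le> real n" by (simp add: nat_le_iff ceiling_le_iff)
    then have "1 / t \<le> real (Suc n)" by simp
    then show "t \<in> {1 / real (Suc n)..1}" using that by (auto simp: field_simps)
  qed
  show "{1 / real (Suc n)..1} \<subseteq> {0<..1}" for n
  proof
    fix t assume t: "t \<in> {1 / real (Suc n)..1}"
    have "0 < 1 / real (Suc n)" by simp
    moreover have "1 / real (Suc n) \<le> t" "t \<le> 1" using t by auto
    ultimately have "0 < t" by linarith
    then show "t \<in> {0<..1}" using \<open>t \<le> 1\<close> by simp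
  qed
qed (auto intro: remainder_integrable convex_halfspace_Re_gt open_halfspace_Re_gt)

text \<open>The Mellin integral of \<open>\<Theta>\<close> is split at \<open>1\<close>, and the terms of the expansion up to the \<open>N\<close>-th one are
  integrated over \<open>(0, 1]\<close> explicitly. The result represents the zeta function for \<open>Re s > - k N\<close>.\<close>

definition zeta_part :: "nat \<Rightarrow> complex \<Rightarrow> complex" where
  "zeta_part N s = rGamma s * (mellin_inf s + mellin_unit N s + (\<Sum>i\<le>N. of_real (A (k i)) / (s + of_real (k i))))"

lemma mker_add_of_real:
  assumes "t > 0"
  shows "mker (s + of_real \<kappa>) t = of_real (t powr \<kappa>) * mker s t"
proof -
  have "complex_of_real (t powr \<kappa>) = exp (of_real \<kappa> * of_real (ln t))"
    using assms by (simp add: powr_def flip: exp_of_real)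
  then show ?thesis
    unfolding mker_def by (simp only: exp_add[symmetric]) (simp add: algebra_simps)
qed

lemma has_integral_powr_mker:
  assumes "Re s > - \<kappa>"
  shows "((\<lambda>t. of_real (c * t powr \<kappa>) * mker s t) has_integral of_real c / (s + of_real \<kappa>)) {0<..1}"
proof -
  have "((\<lambda>t. of_real c * mker (s + of_real \<kappa>) t) has_integral of_real c * (1 / (s + of_real \<kappa>))) {0<..1}"
    using assms by (intro has_integral_mult_right has_integral_mker_unit) auto
  then have "((\<lambda>t. of_real (c * t powr \<kappa>) * mker s t) has_integral of_real c * (1 / (s + of_real \<kappa>))) {0<..1}"
    by (rule has_integral_eq[rotated])
       (simp add: mker_add_of_real)
  then show ?thesis by simp
qed

lemma remainder_mker_integrable:
  assumes "Re s > - k N"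
  shows "(\<lambda>t. of_real (remainder N t) * mker s t) integrable_on {0<..1}"
  by (intro set_lebesgue_integral_eq_integral(1) mellin_integrable remainder_integrable assms
        continuous_on_subset[OF continuous_remainder]) auto

text \<open>One term of the expansion passes from the remainder to the explicit sum.
  \<open>has_integral_powr_mker\<close> shows that its integral over \<open>{0<..1}\<close> is the
  added fraction.\<close>

lemma zeta_part_Suc:
  assumes s: "Re s > - k N"
  shows "zeta_part N s = zeta_part (Suc N) s"
proof -
  have s': "Re s > - k (Suc N)" using s strict_monoD[OF k_mono, of N "Suc N"] by simp
  have "((\<lambda>t. of_real (remainder (Suc N) t) * mker s t + of_real (A (k (Suc N)) * t powr k (Suc N)) * mker s t)
     has_integral mellin_unit (Suc N) s + of_real (A (k (Suc N))) / (s + of_real (k (Suc N)))) {0<..1}"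
    unfolding mellin_unit_def
    by (intro has_integral_add integrable_integral remainder_mker_integrable has_integral_powr_mker s')
  then have "((\<lambda>t. of_real (remainder N t) * mker s t)
     has_integral mellin_unit (Suc N) s + of_real (A (k (Suc N))) / (s + of_real (k (Suc N)))) {0<..1}"
    by (rule has_integral_eq[rotated]) (simp add: remainder_Suc[of N] algebra_simps)
  then have "mellin_unit N s = mellin_unit (Suc N) s + of_real (A (k (Suc N))) / (s + of_real (k (Suc N)))"
    unfolding mellin_unit_def by (rule integral_unique)
  then show ?thesis by (simp add: zeta_part_def)
qed

lemma zeta_part_eq:
  assumes "Re s > - k N" "N \<le> M"
  shows "zeta_part N s = zeta_part M s"
  using assms(2)
proof (induction M rule: dec_induct)
  case (step m)
  have "k N \<le> k m" using step(1) k_mono by (simp add: strict_mono_less_eq)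
  then show ?case using step zeta_part_Suc[of m s] assms(1) by simp
qed simp

lemma zeta_part_dirichlet:
  assumes s: "Re s > - k 0"
  shows "zeta_part N s = (\<Sum>i. of_nat (L i) powr (- s))"
proof -
  have "((\<lambda>t. of_real (remainder 0 t) * mker s t + of_real (A (k 0) * t powr k 0) * mker s t)
     has_integral mellin_unit 0 s + of_real (A (k 0)) / (s + of_real (k 0))) {0<..1}"
    unfolding mellin_unit_def
    by (intro has_integral_add integrable_integral remainder_mker_integrable has_integral_powr_mker s)
  then have 1: "((\<lambda>t. of_real (seq_theta L t) * mker s t)
     has_integral mellin_unit 0 s + of_real (A (k 0)) / (s + of_real (k 0))) {0<..1}"
    by (rule has_integral_eq[rotated]) (simp add: remainder_def algebra_simps)
  have 2: "((\<lambda>t. of_real (seq_theta L t) * mker s t) has_integral mellin_inf s) {1..}"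
    unfolding mellin_inf_def
    by (intro integrable_integral set_lebesgue_integral_eq_integral(1) mellin_integrable
        theta_powr_integrable_atLeast continuous_on_subset[OF continuous_theta]) auto
  have "{0<..1} \<inter> {1..} = {1::real}" "{0<..1} \<union> {1..} = {0::real<..}" by auto
  with has_integral_Un[OF 1 2]
  have "integral {0<..} (\<lambda>t. of_real (seq_theta L t) * mker s t)
      = mellin_unit 0 s + of_real (A (k 0)) / (s + of_real (k 0)) + mellin_inf s"
    by (intro integral_unique) simp
  then have "zeta_part 0 s = rGamma s * integral {0<..} (\<lambda>t. of_real (seq_theta L t) * mker s t)"
    by (simp add: zeta_part_def algebra_simps)
  also have "\<dots> = (\<Sum>i. of_nat (L i) powr (- s))"
    using mellin_theta_sums[OF _ theta_powr_integrable[OF s]] s k0_neg by (simp add: sums_iff)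
  finally show ?thesis using zeta_part_eq[OF s, of N] by simp
qed

text \<open>The half-planes exhaust the plane since \<open>k\<close> tends to infinity, and the
  pieces agree by \<open>zeta_part_eq\<close>, so the least index is just a way to choose one. At a
  pole the value comes from a division by zero; \<open>remove_sings\<close> corrects it
  later.\<close>

definition zeta_ext :: "complex \<Rightarrow> complex" where
  "zeta_ext s = zeta_part (LEAST N. Re s > - k N) s"

lemma zeta_ext_eq:
  assumes "Re s > - k N"
  shows "zeta_ext s = zeta_part N s"
  unfolding zeta_ext_def
  using assms by (intro zeta_part_eq LeastI[of "\<lambda>N. Re s > - k N"] Least_le)

lemma zeta_ext_meromorphic: "zeta_ext meromorphic_on UNIV"
proof (subst meromorphic_on_meromorphic_at, intro ballI)
  fix z :: complex
  have "eventually (\<lambda>N. k N > - Re z) sequentially"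
    using k_at_top by (simp add: filterlim_at_top_dense)
  then obtain N where N: "Re z > - k N"
    by (metis eventually_happens' minus_less_iff sequentially_bot)
  let ?H = "{s. Re s > - k N}"
  have oH: "open ?H" by (rule open_halfspace_Re_gt)
  have "zeta_part N meromorphic_on ?H"
    unfolding zeta_part_def
  proof (intro meromorphic_intros)
    show "mellin_inf meromorphic_on ?H"
      using holomorphic_on_subset[OF holomorphic_mellin_inf, of ?H] oH
      by (intro analytic_on_imp_meromorphic_on) (simp add: analytic_on_open)
    show "mellin_unit N meromorphic_on ?H"
      using holomorphic_mellin_unit oH by (intro analytic_on_imp_meromorphic_on) (simp add: analytic_on_open)
    show "rGamma meromorphic_on ?H"
      by (intro analytic_on_imp_meromorphic_on analytic_rGamma)
  qed
  then have "zeta_part N meromorphic_on {z}" by (rule meromorphic_on_subset) (use N in auto)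
  moreover have "eventually (\<lambda>s. zeta_ext s = zeta_part N s) (at z)"
    using eventually_at_in_open'[OF oH, of z] N by (auto elim!: eventually_mono intro: zeta_ext_eq)
  ultimately show "zeta_ext meromorphic_on {z}"
    by (subst meromorphic_on_cong[where g = "zeta_part N" and B = "{z}"]) auto
qed

text \<open>On the half-plane of convergence \<open>zeta_part 0\<close> is analytic, so removing
  singularities leaves the Dirichlet series there unchanged.\<close>

lemma seq_zeta_eq: "seq_zeta L (- k 0) = remove_sings zeta_ext"
proof (rule seq_zeta_eqI)
  show "remove_sings zeta_ext nicely_meromorphic_on UNIV"
    by (rule remove_sings_nicely_meromorphic[OF zeta_ext_meromorphic])
  fix s assume s: "Re s > - k 0"
  let ?H = "{s. Re s > - k 0}"
  have oH: "open ?H" by (rule open_halfspace_Re_gt)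
  have "zeta_part 0 holomorphic_on ?H"
    unfolding zeta_part_def
    by (intro holomorphic_intros holomorphic_mellin_unit holomorphic_on_subset[OF holomorphic_mellin_inf])
       (auto simp: complex_eq_iff)
  then have an: "zeta_part 0 analytic_on {s}"
    using s oH analytic_on_open analytic_on_subset by (metis (no_types, lifting) mem_Collect_eq singletonD subsetI)
  have "eventually (\<lambda>x. zeta_ext x = zeta_part 0 x) (at s)"
    using eventually_at_in_open'[OF oH, of s] s by (auto elim!: eventually_mono intro: zeta_ext_eq)
  then have "remove_sings zeta_ext s = remove_sings (zeta_part 0) s" by (rule remove_sings_cong) simp
  also have "\<dots> = zeta_part 0 s" using an by (rule remove_sings_at_analytic)
  also have "\<dots> = (\<Sum>i. of_nat (L i) powr (- s))" by (rule zeta_part_dirichlet[OF s])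
  finally show "remove_sings zeta_ext s = (\<Sum>i. of_nat (L i) powr (- s))" .
qed

end

section \<open>One negative exponent: the derivative of the zeta function at 0\<close>

locale meinardus = theta_expansion_seq +
  assumes k_nonneg: "i > 0 \<Longrightarrow> k i \<ge> 0"
begin

lemma k1_nonneg: "k 1 \<ge> 0" and k2_pos: "k 2 > 0"
  using k_nonneg[of 1] strict_monoD[OF k_mono, of 1 2] by auto

text \<open>Exponents increase strictly and only \<open>k 0\<close> is negative, so the exponent 0
  can only be \<open>k 1\<close>. The case distinction on \<open>k 1 = 0\<close> recurs wherever the
  constant term is separated from the others.\<close>

lemma A_0: "A 0 = (if k 1 = 0 then A (k 1) else 0)"
proof (cases "k 1 = 0")
  case False
  have "k i \<noteq> 0" for i
  proof (cases "i \<le> 1")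
    case True
    then have "i = 0 \<or> i = 1" by auto
    then show ?thesis using False k0_neg by auto
  next
    case i: False
    then show ?thesis using strict_monoD[OF k_mono, of 1 i] k1_nonneg by auto
  qed
  then have "0 \<notin> range k" by (metis rangeE)
  then show ?thesis using False A_eq_0[of 0] by simp
qed simp

text \<open>The singular part is removed from \<open>\<Theta> t / t\<close> so that the rest is integrable over \<open>(0, \<infinity>)\<close>. Summing it over
  the multiples of \<open>y\<close> gives the logarithm of the generating function up to explicit terms.\<close>

definition kernel :: "real \<Rightarrow> real" where
  "kernel t = (seq_theta L t - A (k 0) * t powr k 0 - (if t \<le> 1 then A 0 else 0)) / t"

definition kernel_int :: real where
  "kernel_int = integral {0<..} kernel"

text \<open>Index 2 is the first at which the exponent is certainly positive, so that
  \<open>remainder 2 t / t\<close> is integrable at 0 whether or not \<open>k 1 = 0\<close>.\<close>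

lemma remainder_2: "t > 0 \<Longrightarrow> seq_theta L t = remainder 2 t + A (k 0) * t powr k 0 + A (k 1) * t powr k 1 + A (k 2) * t powr k 2"
  by (simp add: remainder_def eval_nat_numeral)

lemma theta_div_integrable: "(\<lambda>t. seq_theta L t / t) integrable_on {1..}"
proof (rule integrable_eq)
  show "(\<lambda>t. seq_theta L t * t powr (0 - 1)) integrable_on {1..}"
    by (rule set_lebesgue_integral_eq_integral(1)[OF theta_powr_integrable_atLeast])
qed (simp add: powr_minus divide_inverse)

lemma remainder_div_integrable: "(\<lambda>t. remainder 2 t / t) integrable_on {0<..1}"
proof (rule integrable_eq)
  show "(\<lambda>t. remainder 2 t * t powr (0 - 1)) integrable_on {0<..1}"
    by (rule set_lebesgue_integral_eq_integral(1)[OF remainder_integrable]) (use k2_pos in simp)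
qed (simp add: powr_minus divide_inverse)

lemma has_integral_powr_unit:
  assumes "p > (0::real)"
  shows "((\<lambda>t. t powr p / t) has_integral 1 / p) {0<..1}"
proof -
  have "((\<lambda>t. t powr (p - 1)) has_integral 1 / p) {0..1}"
    using has_integral_powr_from_0[of "p - 1" 1] assms by simp
  then have "((\<lambda>t. if t \<in> {0<..1} then t powr (p - 1) else 0) has_integral 1 / p) {0..1}"
    by (rule has_integral_eq[rotated]) auto
  then have "((\<lambda>t. t powr (p - 1)) has_integral 1 / p) {0<..1}"
    by (subst (asm) has_integral_restrict) auto
  then show ?thesis by (rule has_integral_eq[rotated]) (simp add: powr_diff)
qed

text \<open>The explicit terms are the values at \<open>s = 0\<close> of the fractions in
  \<open>zeta_part 2\<close>, without the pole that arises if \<open>k 1 = 0\<close>. For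
  \<open>k 0\<close> the integral runs over \<open>{1..}\<close> instead of \<open>{0<..1}\<close>
  and carries the opposite sign, which again produces \<open>A (k 0) / k 0\<close>.\<close>

lemma has_integral_kernel:
  "(kernel has_integral (integral {1..} (\<lambda>t. seq_theta L t / t) + integral {0<..1} (\<lambda>t. remainder 2 t / t)
      + A (k 0) / k 0 + (if k 1 = 0 then 0 else A (k 1) / k 1) + A (k 2) / k 2)) {0<..}"
proof -
  have 1: "(\<lambda>t. remainder 2 t / t) integrable_on {0<..1}"
    by (rule remainder_div_integrable)
  have 2: "((\<lambda>t. if k 1 = 0 then 0 else A (k 1) * (t powr k 1 / t)) has_integral (if k 1 = 0 then 0 else A (k 1) * (1 / k 1))) {0<..1}"
    using has_integral_mult_right[OF has_integral_powr_unit[of "k 1"], of "A (k 1)"] k1_nonneg by auto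
  have 3: "((\<lambda>t. A (k 2) * (t powr k 2 / t)) has_integral (A (k 2) * (1 / k 2))) {0<..1}"
    by (intro has_integral_mult_right has_integral_powr_unit k2_pos)
  have "((\<lambda>t. remainder 2 t / t + (if k 1 = 0 then 0 else A (k 1) * (t powr k 1 / t)) + A (k 2) * (t powr k 2 / t)) has_integral
     (integral {0<..1} (\<lambda>t. remainder 2 t / t) + (if k 1 = 0 then 0 else A (k 1) * (1 / k 1)) + A (k 2) * (1 / k 2))) {0<..1}"
    by (intro has_integral_add integrable_integral 1 2 3)
  then have u: "(kernel has_integral (integral {0<..1} (\<lambda>t. remainder 2 t / t) + (if k 1 = 0 then 0 else A (k 1) * (1 / k 1)) + A (k 2) * (1 / k 2))) {0<..1}"
  proof (rule has_integral_eq[rotated])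
    fix t :: real assume t: "t \<in> {0<..1}"
    show "remainder 2 t / t + (if k 1 = 0 then 0 else A (k 1) * (t powr k 1 / t)) + A (k 2) * (t powr k 2 / t) = kernel t"
    proof (cases "k 1 = 0")
      case True
      then show ?thesis using t by (simp add: kernel_def remainder_2 add_divide_distrib)
    next
      case False
      then have "A 0 = 0" by (simp add: A_0)
      then show ?thesis using t False by (simp add: kernel_def remainder_2 add_divide_distrib)
    qed
  qed
  have "(\<lambda>t. seq_theta L t / t) integrable_on {1..}"
    by (rule theta_div_integrable)
  moreover have "((\<lambda>t. t powr (k 0 - 1)) has_integral - 1 / k 0) {1..}"
    using has_integral_powr_to_inf[of "k 0 - 1" 1] k0_neg by simp
  then have "((\<lambda>t. A (k 0) * t powr (k 0 - 1)) has_integral A (k 0) * (- 1 / k 0)) {1..}"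
    by (rule has_integral_mult_right)
  ultimately have "((\<lambda>t. seq_theta L t / t - A (k 0) * t powr (k 0 - 1)) has_integral
      (integral {1..} (\<lambda>t. seq_theta L t / t) - A (k 0) * (- 1 / k 0))) {1..}"
    by (intro has_integral_diff integrable_integral)
  then have v: "(kernel has_integral (integral {1..} (\<lambda>t. seq_theta L t / t) - A (k 0) * (- 1 / k 0))) {1..}"
    by (rule has_integral_spike_finite[of "{1}", rotated 2]) (auto simp: kernel_def powr_diff diff_divide_distrib)
  have "{0<..1} \<inter> {1..} = {1::real}" "{0<..1} \<union> {1..} = {0::real<..}" by auto
  with has_integral_Un[OF u v] show ?thesis
    by (cases "k 1 = 0") (simp_all add: algebra_simps)
qed

lemma kernel_int_eq: "kernel_int = integral {1..} (\<lambda>t. seq_theta L t / t) + integral {0<..1} (\<lambda>t. remainder 2 t / t)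
      + A (k 0) / k 0 + (if k 1 = 0 then 0 else A (k 1) / k 1) + A (k 2) / k 2"
  unfolding kernel_int_def by (rule integral_unique[OF has_integral_kernel])

lemma mellin_inf_0: "mellin_inf 0 = of_real (integral {1..} (\<lambda>t. seq_theta L t / t))"
proof -
  have "(\<lambda>t. seq_theta L t / t) integrable_on {1..}"
    by (rule theta_div_integrable)
  then have "((\<lambda>t. complex_of_real (seq_theta L t / t)) has_integral of_real (integral {1..} (\<lambda>t. seq_theta L t / t))) {1..}"
    by (intro has_integral_of_real integrable_integral)
  then have "((\<lambda>t. complex_of_real (seq_theta L t) * mker 0 t) has_integral of_real (integral {1..} (\<lambda>t. seq_theta L t / t))) {1..}"
    by (rule has_integral_eq[rotated])
       (use mker_of_real[of _ 0] in \<open>auto simp: powr_minus divide_inverse\<close>)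
  then show ?thesis unfolding mellin_inf_def by (rule integral_unique)
qed

lemma mellin_unit_0: "mellin_unit 2 0 = of_real (integral {0<..1} (\<lambda>t. remainder 2 t / t))"
proof -
  have "(\<lambda>t. remainder 2 t / t) integrable_on {0<..1}"
    by (rule remainder_div_integrable)
  then have "((\<lambda>t. complex_of_real (remainder 2 t / t)) has_integral of_real (integral {0<..1} (\<lambda>t. remainder 2 t / t))) {0<..1}"
    by (intro has_integral_of_real integrable_integral)
  then have "((\<lambda>t. complex_of_real (remainder 2 t) * mker 0 t) has_integral of_real (integral {0<..1} (\<lambda>t. remainder 2 t / t))) {0<..1}"
    by (rule has_integral_eq[rotated])
       (use mker_of_real[of _ 0] in \<open>auto simp: powr_minus divide_inverse\<close>)
  then show ?thesis unfolding mellin_unit_def by (rule integral_unique)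
qed

text \<open>By \<open>rGamma s = s * rGamma (s + 1)\<close> the possible pole \<open>A 0 / s\<close>
  is cancelled, and near 0 the zeta function equals \<open>E\<close>. Since \<open>rGamma\<close>
  has value 1 and derivative \<open>euler_mascheroni\<close> at 1, differentiating \<open>E\<close>
  at 0 leaves \<open>H 0\<close> and the multiple of \<open>A 0\<close>.\<close>

lemma deriv_seq_zeta_0:
  "deriv (seq_zeta L (- k 0)) 0 = of_real (euler_mascheroni * A 0 + kernel_int)"
proof -
  define r where "r = min (- k 0) (k 2)"
  have r: "r > 0" using k0_neg k2_pos by (simp add: r_def)
  \<comment> \<open>Within this radius none of the fractions in \<open>H\<close> has a pole;
    \<open>k 1\<close> counts only when it is positive.\<close>
  define r' where "r' = (if k 1 = 0 then r else min r (k 1))"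
  have r': "r' > 0" "r' \<le> - k 0" "r' \<le> k 2" "k 1 \<noteq> 0 \<Longrightarrow> r' \<le> k 1"
    using r k1_nonneg by (auto simp: r'_def r_def)
  define H where "H = (\<lambda>s. mellin_inf s + mellin_unit 2 s + of_real (A (k 0)) / (s + of_real (k 0))
    + (if k 1 = 0 then 0 else of_real (A (k 1)) / (s + of_real (k 1))) + of_real (A (k 2)) / (s + of_real (k 2)))"
  define E where "E = (\<lambda>s. s * rGamma (s + 1) * H s + of_real (A 0) * rGamma (s + 1))"
  let ?B = "ball (0::complex) r'"
  have nz: "s + of_real x \<noteq> 0" if "s \<in> ?B" "\<bar>x\<bar> \<ge> r'" for s x
  proof
    assume "s + of_real x = 0"
    then have "s = - of_real x" by (simp add: eq_neg_iff_add_eq_0)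
    then have "norm s = \<bar>x\<bar>" by simp
    then show False using that by simp
  qed
  have sub: "?B \<subseteq> {s. Re s > - k 2}"
  proof
    fix s assume "s \<in> ?B"
    then have "norm s < k 2" using r' by simp
    then show "s \<in> {s. Re s > - k 2}" using abs_Re_le_cmod[of s] by simp
  qed
  have n0: "s + of_real (k 0) \<noteq> 0" and n2: "s + of_real (k 2) \<noteq> 0"
    and n1: "k 1 \<noteq> 0 \<Longrightarrow> s + of_real (k 1) \<noteq> 0" if "s \<in> ?B" for s
  proof -
    have "r' \<le> \<bar>k 0\<bar>" "r' \<le> \<bar>k 2\<bar>" "k 1 \<noteq> 0 \<Longrightarrow> r' \<le> \<bar>k 1\<bar>"
      using r' k0_neg k2_pos k1_nonneg by linarith+
    then show "s + of_real (k 0) \<noteq> 0" "s + of_real (k 2) \<noteq> 0" "k 1 \<noteq> 0 \<Longrightarrow> s + of_real (k 1) \<noteq> 0"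
      using nz[OF that] by blast+
  qed
  have holH: "H holomorphic_on ?B"
  proof -
    have 1: "mellin_inf holomorphic_on ?B" "mellin_unit 2 holomorphic_on ?B"
      by (rule holomorphic_on_subset[OF holomorphic_mellin_inf], simp)
         (rule holomorphic_on_subset[OF holomorphic_mellin_unit sub])
    have 2: "(\<lambda>s. if k 1 = 0 then 0 else of_real (A (k 1)) / (s + of_real (k 1))) holomorphic_on ?B"
      by (cases "k 1 = 0") (auto intro!: holomorphic_intros dest: n1)
    show ?thesis
      unfolding H_def by (intro holomorphic_intros 1 2 n0 n2)
  qed
  have holE: "E holomorphic_on ?B"
    unfolding E_def by (intro holomorphic_intros holH)
  have eq: "zeta_ext s = E s" if s: "s \<in> ?B" "s \<noteq> 0" for s
  proof -
    have "zeta_ext s = zeta_part 2 s" using sub s by (intro zeta_ext_eq) auto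
    also have "\<dots> = rGamma s * (H s + of_real (A 0) / s)"
    proof (cases "k 1 = 0")
      case True
      then show ?thesis by (simp add: zeta_part_def H_def eval_nat_numeral)
    next
      case False
      then have "A 0 = 0" by (simp add: A_0)
      then show ?thesis using False by (simp add: zeta_part_def H_def eval_nat_numeral)
    qed
    also have "rGamma s = s * rGamma (s + 1)" by (rule rGamma_plus1[symmetric])
    finally have "zeta_ext s = s * rGamma (s + 1) * H s + s * rGamma (s + 1) * (of_real (A 0) / s)"
      by (simp only: distrib_left)
    also have "s * rGamma (s + 1) * (of_real (A 0) / s) = of_real (A 0) * rGamma (s + 1)"
      using s by simp
    finally show ?thesis by (simp only: E_def)
  qed
  have "remove_sings zeta_ext w = E w" if w: "w \<in> ?B" for w
  proof -
    have "eventually (\<lambda>x. x \<in> ?B - {0}) (at w)"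
    proof (cases "w = 0")
      case True
      show ?thesis unfolding True by (intro eventually_at_in_open) (use r' in auto)
    next
      case False
      then show ?thesis using w by (intro eventually_at_in_open') auto
    qed
    then have "eventually (\<lambda>x. zeta_ext x = E x) (at w)"
      by (rule eventually_mono) (auto intro: eq)
    then have "remove_sings zeta_ext w = remove_sings E w" by (rule remove_sings_cong) simp
    also have "\<dots> = E w"
    proof (rule remove_sings_at_analytic)
      have "E analytic_on ?B" using holE by (simp add: analytic_on_open)
      then show "E analytic_on {w}" by (rule analytic_on_subset) (use w in simp)
    qed
    finally show ?thesis .
  qed
  then have "eventually (\<lambda>w. remove_sings zeta_ext w = E w) (nhds 0)"
    using eventually_nhds_in_open[of ?B 0] r' by (auto elim!: eventually_mono)
  then have "deriv (seq_zeta L (- k 0)) 0 = deriv E 0"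
    unfolding seq_zeta_eq by (rule deriv_cong_ev) simp
  moreover have "(H has_field_derivative deriv H 0) (at 0)"
    using holH r' by (simp add: DERIV_deriv_iff_field_differentiable holomorphic_on_imp_differentiable_at)
  note dH = this
  have "(1::complex) \<notin> \<int>\<^sub>\<le>\<^sub>0" by (auto elim!: nonpos_Ints_cases)
  from has_field_derivative_rGamma_no_nonpos_int[OF this]
  have "(rGamma has_field_derivative euler_mascheroni) (at (0 + 1 :: complex))" by simp
  then have dG: "((\<lambda>s. rGamma (s + 1)) has_field_derivative euler_mascheroni) (at (0::complex))"
    by (simp only: DERIV_shift)
  have "((\<lambda>s. s * rGamma (s + 1) * H s + of_real (A 0) * rGamma (s + 1)) has_field_derivative (H 0 + of_real (A 0) * euler_mascheroni)) (at 0)"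
    by (rule derivative_eq_intros dH dG refl)+ simp
  then have "(E has_field_derivative (H 0 + of_real (A 0) * euler_mascheroni)) (at 0)"
    by (simp only: E_def)
  then have "deriv E 0 = H 0 + of_real (A 0) * euler_mascheroni" by (rule DERIV_imp_deriv)
  moreover have "H 0 = of_real kernel_int"
    by (simp add: H_def kernel_int_eq mellin_inf_0 mellin_unit_0)
  ultimately show ?thesis by (simp add: mult.commute)
qed

end

section \<open>Asymptotics of the logarithm of the generating function\<close>

context theta_seq
begin

text \<open>Up to the sign \<open>(-1)^j\<close>, the \<open>j\<close>-th derivative of
  \<open>P (exp (- y))\<close> with respect to \<open>y\<close>. With this sign all terms are
  nonnegative.\<close>

definition mom :: "nat \<Rightarrow> real \<Rightarrow> real" where
  "mom j y = (\<Sum>m. real m ^ j * acoef m * exp (- (real m * y)))"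

lemma mom_summable:
  assumes "y > 0"
  shows "summable (\<lambda>m. real m ^ j * acoef m * exp (- (real m * y)))"
proof -
  have gen: "\<forall>r. 0 \<le> r \<longrightarrow> r < 1 \<longrightarrow> summable (\<lambda>m. real m ^ j * acoef m * r ^ m)"
  proof (induction j)
    case 0
    then show ?case using acoef_summable_real by simp
  next
    case (Suc j)
    show ?case
    proof (intro allI impI)
      fix r :: real assume r: "0 \<le> r" "r < 1"
      \<comment> \<open>Termwise differentiation loses a little of the radius, so convergence is
        taken from a point strictly between \<open>r\<close> and 1.\<close>
      define r' where "r' = (1 + r) / 2"
      have r': "r < r'" "r' < 1" "0 \<le> r'" using r by (auto simp: r'_def)
      have "summable (\<lambda>m. diffs (\<lambda>m. real m ^ j * acoef m) m * r ^ m)"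
      proof (rule termdiff_converges[of r r'])
        show "norm r < r'" using r r' by simp
        fix x :: real assume "norm x < r'"
        then have "summable (\<lambda>m. real m ^ j * acoef m * \<bar>x\<bar> ^ m)" using Suc r' by auto
        then show "summable (\<lambda>m. real m ^ j * acoef m * x ^ m)"
          by (rule summable_rabs_cancel[OF summable_cong[THEN iffD1, rotated]])
             (auto simp: abs_mult power_abs acoef_nonneg)
      qed
      then have "summable (\<lambda>m. diffs (\<lambda>m. real m ^ j * acoef m) m * r ^ m * r)"
        by (rule summable_mult2)
      then have "summable (\<lambda>m. real (Suc m) ^ Suc j * acoef (Suc m) * r ^ Suc m)"
        by (simp add: diffs_def mult_ac)
      then show "summable (\<lambda>m. real m ^ Suc j * acoef m * r ^ m)"
        by (subst summable_Suc_iff[symmetric])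
    qed
  qed
  have "exp (- (real m * y)) = exp (- y) ^ m" for m
    by (simp flip: exp_of_nat_mult)
  then show ?thesis using gen assms by simp
qed

lemma mom_sums: "y > 0 \<Longrightarrow> (\<lambda>m. real m ^ j * acoef m * exp (- (real m * y))) sums mom j y"
  unfolding mom_def by (intro summable_sums mom_summable)

text \<open>Both series sum \<open>exp (- (m * y)) * L i / m\<close> over the pairs with
  \<open>L i dvd m\<close>. Writing \<open>m = Suc n * L i\<close> and summing over \<open>i\<close>
  first gives \<Theta>; nonnegativity of the terms permits the rearrangement.\<close>

lemma mom_0_eq_theta:
  assumes y: "y > 0"
  shows "(\<lambda>n. seq_theta L (real (Suc n) * y) / real (Suc n)) sums mom 0 y"
proof -
  define f where "f = (\<lambda>(m, i). exp (- (real m * y)) * (real (L i) / real m))"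
  have inner: "((\<lambda>i. f (m, i)) has_sum (acoef m * exp (- (real m * y)))) {i. L i dvd m}" if "m \<in> {0<..}" for m
    using finite_L_dvd[of m] that
    by (simp add: has_sum_finite_iff f_def acoef_def lsum_def sum_divide_distrib sum_distrib_left mult.commute)
  have "((\<lambda>m. acoef m * exp (- (real m * y))) has_sum mom 0 y) UNIV"
    using mom_sums[OF y, of 0] by (intro sums_nonneg_imp_has_sum) (auto simp: acoef_nonneg)
  then have outer: "((\<lambda>m. acoef m * exp (- (real m * y))) has_sum mom 0 y) {0<..}"
    by (rule has_sum_cong_neutral[THEN iffD1, rotated -1]) (auto simp: acoef_def)
  have "f summable_on Sigma {0<..} (\<lambda>m. {i. L i dvd m})"
    by (rule summable_on_SigmaI[OF inner has_sum_imp_summable[OF outer]]) (auto simp: f_def)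
  then have S: "(f has_sum mom 0 y) (Sigma {0<..} (\<lambda>m. {i. L i dvd m}))"
    by (intro has_sum_SigmaI[OF inner outer])
  define h where "h = (\<lambda>(n, i). (Suc n * L i, i))"
  have "bij_betw h (UNIV \<times> UNIV) (Sigma {0<..} (\<lambda>m. {i. L i dvd m}))"
  proof (rule bij_betwI[where g = "\<lambda>(m, i). (m div L i - 1, i)"])
    show "h \<in> UNIV \<times> UNIV \<rightarrow> (SIGMA m:{0<..}. {i. L i dvd m})"
      using L_pos by (auto simp: h_def)
    show "(case h x of (m, i) \<Rightarrow> (m div L i - 1, i)) = x" for x
      using L_pos by (auto simp: h_def split: prod.splits)
    fix z assume "z \<in> (SIGMA m:{0<..}. {i. L i dvd m})"
    then obtain m i where z: "z = (m, i)" "m > 0" "L i dvd m" by auto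
    then have "m div L i > 0" using dvd_div_eq_0_iff[of "L i" m] by auto
    then obtain q where "m div L i = Suc q" using gr0_implies_Suc by blast
    moreover from this have "Suc q * L i = m" using z(3) dvd_div_mult_self by metis
    ultimately show "h (case z of (m, i) \<Rightarrow> (m div L i - 1, i)) = z"
      using z by (simp add: h_def)
  qed auto
  then have "((\<lambda>x. f (h x)) has_sum mom 0 y) (UNIV \<times> UNIV)"
    using S by (simp only: has_sum_reindex_bij_betw)
  then have "((\<lambda>n. seq_theta L (real (Suc n) * y) / real (Suc n)) has_sum mom 0 y) UNIV"
  proof (rule has_sum_SigmaD)
    fix n :: nat
    have "(\<lambda>i. exp (- real (L i) * (real (Suc n) * y)) / real (Suc n)) sums (seq_theta L (real (Suc n) * y) / real (Suc n))"
      using y by (intro sums_divide theta_sums) simp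
    then have "((\<lambda>i. exp (- real (L i) * (real (Suc n) * y)) / real (Suc n)) has_sum (seq_theta L (real (Suc n) * y) / real (Suc n))) UNIV"
      by (rule sums_nonneg_imp_has_sum) simp
    moreover have "f (h (n, i)) = exp (- real (L i) * (real (Suc n) * y)) / real (Suc n)" for i
    proof -
      have "real (L i) / real (Suc n * L i) = 1 / real (Suc n)"
        unfolding of_nat_mult using L_pos[of i] by (simp del: of_nat_Suc)
      moreover have "- (real (Suc n * L i) * y) = - real (L i) * (real (Suc n) * y)"
        by (simp add: algebra_simps)
      ultimately show ?thesis by (simp only: f_def h_def prod.case) (simp only: mult_1_right times_divide_eq_right)
    qed
    ultimately show "((\<lambda>i. f (h (n, i))) has_sum (seq_theta L (real (Suc n) * y) / real (Suc n))) UNIV"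
      by simp
  qed
  then show ?thesis by (rule has_sum_imp_sums)
qed

end

section \<open>Riemann sums of the kernel\<close>

context meinardus
begin

lemma kernel_continuous: "t > 0 \<Longrightarrow> t \<noteq> 1 \<Longrightarrow> isCont kernel t"
proof -
  assume t: "t > 0" "t \<noteq> 1"
  have th: "isCont (seq_theta L) t"
    using continuous_theta t by (simp add: continuous_on_eq_continuous_at)
  have "isCont (\<lambda>u. (seq_theta L u - A (k 0) * u powr k 0 - (if t \<le> 1 then A 0 else 0)) / u) t"
    using t by (intro continuous_intros th) auto
  moreover have E: "eventually (\<lambda>u. (seq_theta L u - A (k 0) * u powr k 0 - (if t \<le> 1 then A 0 else 0)) / u = kernel u) (nhds t)"
  proof (cases "t < 1")
    case True
    then show ?thesis
      by (intro eventually_mono[OF eventually_nhds_in_open[of "{..<1}" t]]) (auto simp: kernel_def)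
  next
    case False
    then show ?thesis using t
      by (intro eventually_mono[OF eventually_nhds_in_open[of "{1<..}" t]]) (auto simp: kernel_def)
  qed
  ultimately show ?thesis using isCont_cong[OF E] by simp
qed

text \<open>The Riemann sums sample the kernel at right end points. A decreasing majorant bounds
  such a sample by its value at the point being rounded, so one integrable function dominates the
  step functions of all mesh sizes.\<close>

lemma kernel_majorant:
  obtains h :: "real \<Rightarrow> real" where "h integrable_on {0<..}" "\<And>t. t > 0 \<Longrightarrow> \<bar>kernel t\<bar> \<le> h t"
    "\<And>s t. 0 < s \<Longrightarrow> s \<le> t \<Longrightarrow> h t \<le> h s"
proof -
  obtain C where C: "C > 0" "\<And>t. t \<in> {0<..1} \<Longrightarrow> \<bar>remainder 2 t\<bar> \<le> C * t powr k 2"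
    using remainder_bound by blast
  \<comment> \<open>The smallest positive exponent among \<open>k 1\<close> and \<open>k 2\<close>,
    cut off at 1 to keep \<open>t powr (\<epsilon> - 1)\<close> from increasing.\<close>
  define \<epsilon> where "\<epsilon> = (if k 1 = 0 then min 1 (k 2) else min 1 (min (k 1) (k 2)))"
  have e: "\<epsilon> > 0" "\<epsilon> \<le> 1" "\<epsilon> \<le> k 2" "k 1 \<noteq> 0 \<Longrightarrow> \<epsilon> \<le> k 1"
    using k1_nonneg k2_pos by (auto simp: \<epsilon>_def)
  \<comment> \<open>The last two summands prevent \<open>h\<close> from jumping upwards at
    1.\<close>
  define B where "B = C + \<bar>A (k 1)\<bar> + \<bar>A (k 2)\<bar> + \<bar>A (k 0)\<bar> + seq_theta L 1"
  have B0: "B \<ge> 0" using C theta_nonneg[of 1] by (simp add: B_def)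
  define h where "h = (\<lambda>t. if t \<le> 1 then B * t powr (\<epsilon> - 1) else exp (1 - t) * seq_theta L 1 + \<bar>A (k 0)\<bar> * t powr (k 0 - 1))"
  show ?thesis
  proof (rule that[of h])
    fix t :: real assume t: "t > 0"
    show "\<bar>kernel t\<bar> \<le> h t"
    proof (cases "t \<le> 1")
      case True
      have "\<bar>t * kernel t\<bar> \<le> B * t powr \<epsilon>"
      proof -
        have "t * kernel t = remainder 2 t + (if k 1 = 0 then 0 else A (k 1) * t powr k 1) + A (k 2) * t powr k 2"
        proof (cases "k 1 = 0")
          case k: True
          then show ?thesis using t True by (simp add: kernel_def remainder_2)
        next
          case False
          then have "A 0 = 0" by (simp add: A_0)
          then show ?thesis using t True False by (simp add: kernel_def remainder_2)
        qed
        then have "\<bar>t * kernel t\<bar> \<le> \<bar>remainder 2 t\<bar> + \<bar>if k 1 = 0 then 0 else A (k 1) * t powr k 1\<bar> + \<bar>A (k 2) * t powr k 2\<bar>"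
          by linarith
        also have "\<dots> \<le> C * t powr \<epsilon> + \<bar>A (k 1)\<bar> * t powr \<epsilon> + \<bar>A (k 2)\<bar> * t powr \<epsilon>"
        proof (intro add_mono)
          have p2: "t powr k 2 \<le> t powr \<epsilon>" using t True e by (intro powr_mono') auto
          have p1: "k 1 \<noteq> 0 \<Longrightarrow> t powr k 1 \<le> t powr \<epsilon>" using t True e by (intro powr_mono') auto
          show "\<bar>remainder 2 t\<bar> \<le> C * t powr \<epsilon>"
            using order_trans[OF C(2) mult_left_mono[OF p2]] t True C(1) by simp
          show "\<bar>if k 1 = 0 then 0 else A (k 1) * t powr k 1\<bar> \<le> \<bar>A (k 1)\<bar> * t powr \<epsilon>"
            using p1 by (auto simp: abs_mult intro: mult_left_mono)
          show "\<bar>A (k 2) * t powr k 2\<bar> \<le> \<bar>A (k 2)\<bar> * t powr \<epsilon>"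
            using p2 by (auto simp: abs_mult intro: mult_left_mono)
        qed
        also have "\<dots> = (C + \<bar>A (k 1)\<bar> + \<bar>A (k 2)\<bar>) * t powr \<epsilon>" by (simp add: algebra_simps)
        also have "\<dots> \<le> B * t powr \<epsilon>"
          using theta_nonneg[of 1] by (intro mult_right_mono) (auto simp: B_def)
        finally show ?thesis .
      qed
      then have "t * \<bar>kernel t\<bar> \<le> t * (B * t powr (\<epsilon> - 1))"
        using t by (simp add: abs_mult powr_diff)
      then show ?thesis using t True by (simp add: h_def)
    next
      case False
      have "kernel t = seq_theta L t / t - A (k 0) * t powr (k 0 - 1)"
        using False by (simp add: kernel_def powr_diff diff_divide_distrib)
      then have "\<bar>kernel t\<bar> \<le> \<bar>seq_theta L t / t\<bar> + \<bar>A (k 0) * t powr (k 0 - 1)\<bar>" by linarith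
      also have "\<bar>seq_theta L t / t\<bar> \<le> seq_theta L t"
        using False theta_nonneg[of t] by (simp add: abs_div_pos pos_divide_le_eq mult_le_cancel_left1)
      also have "seq_theta L t \<le> exp (1 - t) * seq_theta L 1"
        using theta_le[of 1 t] False by simp
      finally show ?thesis using False by (simp add: h_def abs_mult)
    qed
  next
    fix s t :: real assume st: "0 < s" "s \<le> t"
    have 1: "B * b powr (\<epsilon> - 1) \<le> B * a powr (\<epsilon> - 1)" if "0 < a" "a \<le> b" for a b :: real
      using that e B0 by (intro mult_left_mono powr_mono2') auto
    have 2: "exp (1 - b) * seq_theta L 1 + \<bar>A (k 0)\<bar> * b powr (k 0 - 1) \<le> exp (1 - a) * seq_theta L 1 + \<bar>A (k 0)\<bar> * a powr (k 0 - 1)"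
      if "0 < a" "a \<le> b" for a b :: real
      using that k0_neg theta_nonneg[of 1] by (intro add_mono mult_left_mono mult_right_mono powr_mono2') auto
    have 3: "exp (1 - 1) * seq_theta L 1 + \<bar>A (k 0)\<bar> * 1 powr (k 0 - 1) \<le> B * 1 powr (\<epsilon> - 1)"
      using C by (simp add: B_def)
    show "h t \<le> h s"
    proof (cases "t \<le> 1 \<or> s > 1")
      case True
      then show ?thesis using st 1[of s t] 2[of s t] by (auto simp: h_def)
    next
      case False
      then show ?thesis using st 1[of s 1] 2[of 1 t] 3 by (simp add: h_def)
    qed
  next
    have a: "((\<lambda>t. B * t powr (\<epsilon> - 1)) integrable_on {0<..1})"
      using e by (intro integrable_on_mult_right powr_integrable_unit) auto
    have "(\<lambda>t. t powr (1 - 1) / exp t) integrable_on {0::real..}"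
      by (rule has_integral_integrable[OF Gamma_integral_real]) simp
    then have "(\<lambda>t. t powr (1 - 1) / exp t) absolutely_integrable_on {0::real..}"
      by (rule nonnegative_absolutely_integrable_1) auto
    then have "(\<lambda>t. t powr (1 - 1) / exp t) absolutely_integrable_on {1::real..}"
      by (rule set_integrable_subset) auto
    then have "(\<lambda>t. t powr (1 - 1) / exp t) integrable_on {1::real..}"
      by (rule set_lebesgue_integral_eq_integral(1))
    then have "(\<lambda>t. (exp 1 * seq_theta L 1) * (t powr (1 - 1) / exp t)) integrable_on {1::real..}"
      by (rule integrable_on_mult_right)
    then have b1: "(\<lambda>t. exp (1 - t) * seq_theta L 1) integrable_on {1::real..}"
      by (rule integrable_eq) (auto simp: exp_diff)
    have "(\<lambda>t. \<bar>A (k 0)\<bar> * t powr (k 0 - 1)) integrable_on {1..}"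
      using has_integral_powr_to_inf[of "k 0 - 1" 1] k0_neg by (intro integrable_on_mult_right) (auto simp: integrable_on_def)
    from integrable_add[OF b1 this]
    have b: "(\<lambda>t. exp (1 - t) * seq_theta L 1 + \<bar>A (k 0)\<bar> * t powr (k 0 - 1)) integrable_on {1..}" .
    have ha: "h integrable_on {0<..1}" by (rule integrable_eq[OF a]) (simp add: h_def)
    have hb: "h integrable_on {1..}"
      by (rule integrable_spike_finite[OF _ _ b, of "{1}"]) (auto simp: h_def)
    have "{0<..1} \<inter> {1..} = {1::real}" "{0<..1} \<union> {1..} = {0::real<..}" by auto
    then show "h integrable_on {0<..}"
      using integrable_Un[OF _ ha hb] by simp
  qed
qed

abbreviation "zconst \<equiv> A (k 0) * riemann_zeta (1 - k 0)"

lemma riemann_zeta_sums: "s > 1 \<Longrightarrow> (\<lambda>n. real (Suc n) powr (- s)) sums riemann_zeta s"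
proof -
  assume "s > 1"
  then have "summable (\<lambda>n. real n powr (- s))" by (simp add: summable_real_powr_iff)
  then have "summable (\<lambda>n. real (Suc n) powr (- s))" by (subst summable_Suc_iff)
  then show ?thesis unfolding riemann_zeta_def by (rule summable_sums)
qed

text \<open>The three parts of the kernel give the three terms: \<Theta> by
  \<open>mom_0_eq_theta\<close>, the power by the series of the Riemann zeta-function, and the
  cut-off constant by a harmonic number, since it affects exactly the multiples of \<open>y\<close>
  up to 1.\<close>

lemma kernel_sums:
  assumes y: "y > 0"
  shows "(\<lambda>n. y * kernel (real (Suc n) * y)) sums
    (mom 0 y - zconst * y powr k 0 - A 0 * harm (nat \<lfloor>1 / y\<rfloor>))"
proof -
  define N where "N = nat \<lfloor>1 / y\<rfloor>"
  have N: "real (Suc n) * y \<le> 1 \<longleftrightarrow> n < N" for n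
  proof -
    have "real (Suc n) * y \<le> 1 \<longleftrightarrow> real (Suc n) \<le> 1 / y" using y by (simp add: pos_le_divide_eq)
    also have "\<dots> \<longleftrightarrow> int (Suc n) \<le> \<lfloor>1 / y\<rfloor>" by (simp add: le_floor_iff)
    also have "\<dots> \<longleftrightarrow> n < N" by (auto simp: N_def)
    finally show ?thesis .
  qed
  have 1: "(\<lambda>n. A (k 0) * y powr k 0 * real (Suc n) powr (- (1 - k 0))) sums (A (k 0) * y powr k 0 * riemann_zeta (1 - k 0))"
    using k0_neg by (intro sums_mult riemann_zeta_sums) simp
  have 2: "(\<lambda>n. if n < N then A 0 / real (Suc n) else 0) sums (A 0 * harm N)"
  proof -
    have "(\<lambda>n. if n < N then A 0 / real (Suc n) else 0) sums (\<Sum>n<N. if n < N then A 0 / real (Suc n) else 0)"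
      by (rule sums_finite) auto
    also have "(\<Sum>n<N. if n < N then A 0 / real (Suc n) else 0) = (\<Sum>n<N. A 0 * inverse (real (Suc n)))"
      by (intro sum.cong) (auto simp: divide_inverse)
    also have "\<dots> = A 0 * harm N"
      unfolding harm_def One_nat_def[symmetric] image_Suc_lessThan[symmetric]
      by (subst sum.reindex) (simp_all add: sum_distrib_left del: of_nat_Suc)
    finally show ?thesis .
  qed
  have "(\<lambda>n. seq_theta L (real (Suc n) * y) / real (Suc n) - A (k 0) * y powr k 0 * real (Suc n) powr (- (1 - k 0))
      - (if n < N then A 0 / real (Suc n) else 0)) sums
      (mom 0 y - A (k 0) * y powr k 0 * riemann_zeta (1 - k 0) - A 0 * harm N)"
    by (intro sums_diff mom_0_eq_theta y 1 2)
  moreover have "seq_theta L (real (Suc n) * y) / real (Suc n) - A (k 0) * y powr k 0 * real (Suc n) powr (- (1 - k 0))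
      - (if n < N then A 0 / real (Suc n) else 0) = y * kernel (real (Suc n) * y)" for n
  proof -
    have p: "(real (Suc n) * y) powr k 0 = real (Suc n) powr k 0 * y powr k 0"
      using y by (simp add: powr_mult del: of_nat_Suc)
    have q: "real (Suc n) powr (- (1 - k 0)) = real (Suc n) powr k 0 / real (Suc n)"
      by (simp add: powr_diff del: of_nat_Suc)
    have c: "y * (z / (real (Suc n) * y)) = z / real (Suc n)" for z
      using y by simp
    show ?thesis unfolding kernel_def c N p q
      by (simp add: diff_divide_distrib mult_ac del: of_nat_Suc)
  qed
  ultimately show ?thesis by (simp add: N_def mult_ac)
qed

text \<open>The Riemann sum is written as the integral of a step function, so that its limit can be
  taken by dominated convergence. Rounding up keeps the samples away from the singularity at
  0.\<close>

lemma step_kernel_integral: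
  assumes y: "y > 0"
  shows "(\<lambda>t. kernel (of_int \<lceil>t / y\<rceil> * y)) integrable_on {0<..}"
    and "integral {0<..} (\<lambda>t. kernel (of_int \<lceil>t / y\<rceil> * y))
      = mom 0 y - zconst * y powr k 0 - A 0 * harm (nat \<lfloor>1 / y\<rfloor>)"
proof -
  let ?u = "\<lambda>t. kernel (of_int \<lceil>t / y\<rceil> * y)"
  obtain h where h: "h integrable_on {0<..}" "\<And>t. t > 0 \<Longrightarrow> \<bar>kernel t\<bar> \<le> h t"
    "\<And>s t. 0 < s \<Longrightarrow> s \<le> t \<Longrightarrow> h t \<le> h s" using kernel_majorant by blast
  have ai: "?u absolutely_integrable_on {0<..}"
  proof (rule measurable_bounded_by_integrable_imp_absolutely_integrable[OF _ _ h(1)])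
    have "(\<lambda>t. (\<lambda>i. kernel (of_int i * y)) \<lceil>t / y\<rceil>) \<in> borel_measurable borel"
      by measurable
    then show "?u \<in> borel_measurable (lebesgue_on {0<..})"
      by (intro measurable_restrict_space1 measurable_completion) simp
    fix t :: real assume "t \<in> {0<..}"
    then have "t \<le> of_int \<lceil>t / y\<rceil> * y" "0 < t" using y by (auto simp: le_of_int_ceiling simp flip: pos_divide_le_eq)
    then show "norm (?u t) \<le> h t"
      using h(2)[of "of_int \<lceil>t / y\<rceil> * y"] h(3)[of t "of_int \<lceil>t / y\<rceil> * y"] by simp
  qed simp
  show "?u integrable_on {0<..}" using ai by (rule set_lebesgue_integral_eq_integral(1))
  define I where "I = (\<lambda>n::nat. {real n * y<..real (Suc n) * y})"
  have ceil: "t \<in> I n \<longleftrightarrow> \<lceil>t / y\<rceil> = int (Suc n)" for t n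
    using y by (auto simp: I_def ceiling_eq_iff pos_less_divide_eq pos_divide_le_eq algebra_simps)
  have U: "(\<Union>n. I n) = {0<..}"
  proof (intro equalityI subsetI)
    fix t assume "t \<in> (\<Union>n. I n)"
    then obtain n where "real n * y < t" by (auto simp: I_def)
    moreover have "0 \<le> real n * y" using y by simp
    ultimately show "t \<in> {0<..}" by simp
  next
    fix t :: real assume "t \<in> {0<..}"
    then have "\<lceil>t / y\<rceil> > 0" using y by simp
    then have "t \<in> I (nat \<lceil>t / y\<rceil> - 1)" unfolding ceil by simp
    then show "t \<in> (\<Union>n. I n)" by blast
  qed
  have "integral {0<..} ?u = (LINT t:(\<Union>n. I n)|lebesgue. ?u t)"
    unfolding U using ai by (rule set_lebesgue_integral_eq_integral(2)[symmetric])
  also have "\<dots> = (\<Sum>n. (LINT t:I n|lebesgue. ?u t))"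
  proof (rule lebesgue_integral_countable_add)
    show "set_integrable lebesgue (\<Union>n. I n) ?u" unfolding U by (rule ai)
    show "I i \<inter> I j = {}" if "i \<noteq> j" for i j using that by (auto simp: ceil)
  qed (simp add: I_def)
  also have "(\<lambda>n. LINT t:I n|lebesgue. ?u t) = (\<lambda>n. y * kernel (real (Suc n) * y))"
  proof
    fix n
    have "(LINT t:I n|lebesgue. ?u t) = (LINT t:I n|lebesgue. kernel (real (Suc n) * y))"
      by (rule set_lebesgue_integral_cong) (auto simp: ceil, simp add: I_def)
    also have "\<dots> = measure lebesgue (I n) * kernel (real (Suc n) * y)"
      by (simp add: set_lebesgue_integral_def I_def)
    also have "measure lebesgue (I n) = y"
      using y by (simp add: I_def algebra_simps)
    finally show "(LINT t:I n|lebesgue. ?u t) = y * kernel (real (Suc n) * y)" .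
  qed
  also have "suminf \<dots> = mom 0 y - zconst * y powr k 0 - A 0 * harm (nat \<lfloor>1 / y\<rfloor>)"
    using kernel_sums[OF y] by (simp add: sums_iff)
  finally show "integral {0<..} ?u = mom 0 y - zconst * y powr k 0 - A 0 * harm (nat \<lfloor>1 / y\<rfloor>)" .
qed

lemma step_kernel_limit:
  assumes y: "\<And>n. y n > 0" "y \<longlonglongrightarrow> 0"
  shows "(\<lambda>n. integral {0<..} (\<lambda>t. kernel (of_int \<lceil>t / y n\<rceil> * y n))) \<longlonglongrightarrow> kernel_int"
proof -
  obtain h where h: "h integrable_on {0<..}" "\<And>t. t > 0 \<Longrightarrow> \<bar>kernel t\<bar> \<le> h t"
    "\<And>s t. 0 < s \<Longrightarrow> s \<le> t \<Longrightarrow> h t \<le> h s" using kernel_majorant by blast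
  let ?u = "\<lambda>n t. kernel (of_int \<lceil>t / y n\<rceil> * y n)"
  \<comment> \<open>The cut-off makes the kernel jump at 1 when \<open>A 0\<close> is not 0. The
    value at this one point is replaced by 0, which leaves the integrals unchanged.\<close>
  let ?v = "\<lambda>n t. if t = 1 then 0 else ?u n t"
  have b: "t \<le> of_int \<lceil>t / y n\<rceil> * y n" "of_int \<lceil>t / y n\<rceil> * y n \<le> t + y n" for t n
  proof -
    have "t / y n \<le> of_int \<lceil>t / y n\<rceil>" and c: "of_int \<lceil>t / y n\<rceil> \<le> t / y n + 1" by linarith+
    then show "t \<le> of_int \<lceil>t / y n\<rceil> * y n"
      using y(1)[of n] by (simp only: pos_divide_le_eq)
    have "of_int \<lceil>t / y n\<rceil> * y n \<le> (t / y n + 1) * y n"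
      using c y(1)[of n] by (intro mult_right_mono) auto
    also have "\<dots> = t + y n" using y(1)[of n] by (simp add: distrib_right)
    finally show "of_int \<lceil>t / y n\<rceil> * y n \<le> t + y n" .
  qed
  have "(\<lambda>n. integral {0<..} (?v n)) \<longlonglongrightarrow> integral {0<..} (\<lambda>t. if t = 1 then 0 else kernel t)"
  proof (rule dominated_convergence(2)[OF _ h(1)])
    show "?v n integrable_on {0<..}" for n
      by (rule integrable_spike_finite[OF _ _ step_kernel_integral(1)[OF y(1)[of n]], of "{1}"]) auto
    show "norm (?v n t) \<le> h t" if t: "t \<in> {0<..}" for n t
    proof -
      have "0 < of_int \<lceil>t / y n\<rceil> * y n" using b(1)[of t n] t by auto
      from h(2)[OF this] h(3)[of t, OF _ b(1)[of t n]] h(2)[of t] t show ?thesis by auto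
    qed
    show "(\<lambda>n. ?v n t) \<longlonglongrightarrow> (if t = 1 then 0 else kernel t)" if t: "t \<in> {0<..}" for t
    proof (cases "t = 1")
      case False
      have "(\<lambda>n. of_int \<lceil>t / y n\<rceil> * y n) \<longlonglongrightarrow> t"
      proof (rule tendsto_sandwich[of "\<lambda>_. t" _ _ "\<lambda>n. t + y n"])
        show "(\<lambda>n. t + y n) \<longlonglongrightarrow> t" using tendsto_add[OF tendsto_const y(2), of t] by simp
      qed (use b in \<open>auto intro!: always_eventually tendsto_const\<close>)
      then have "(\<lambda>n. ?u n t) \<longlonglongrightarrow> kernel t"
        by (rule isCont_tendsto_compose[OF kernel_continuous, rotated -1]) (use t False in auto)
      then show ?thesis using False by simp
    qed simp
  qed
  moreover have "integral {0<..} (?v n) = integral {0<..} (?u n)" for n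
    by (rule integral_spike[of "{1}"]) auto
  moreover have "integral {0<..} (\<lambda>t. if t = 1 then 0 else kernel t) = kernel_int"
    unfolding kernel_int_def by (rule integral_spike[of "{1}"]) auto
  ultimately show ?thesis by simp
qed

lemma harm_floor_limit: "((\<lambda>y. harm (nat \<lfloor>1 / y\<rfloor>) + ln y) \<longlongrightarrow> euler_mascheroni) (at_right (0::real))"
proof -
  have N: "filterlim (\<lambda>y::real. nat \<lfloor>1 / y\<rfloor>) at_top (at_right 0)"
    by (rule filterlim_compose[OF filterlim_nat_sequentially filterlim_compose[OF filterlim_floor_sequentially]])
       real_asymp
  have 1: "((\<lambda>y::real. harm (nat \<lfloor>1 / y\<rfloor>) - ln (real (nat \<lfloor>1 / y\<rfloor>))) \<longlongrightarrow> euler_mascheroni) (at_right 0)"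
    by (rule filterlim_compose[OF euler_mascheroni_LIMSEQ N])
  have 2: "((\<lambda>y::real. ln (of_int \<lfloor>1 / y\<rfloor>) + ln y) \<longlongrightarrow> 0) (at_right 0)"
    by real_asymp
  have ev: "eventually (\<lambda>y::real. real (nat \<lfloor>1 / y\<rfloor>) = of_int \<lfloor>1 / y\<rfloor>) (at_right 0)"
    using eventually_at_right_less[of "0::real"] by eventually_elim simp
  have "((\<lambda>y::real. (harm (nat \<lfloor>1 / y\<rfloor>) - ln (real (nat \<lfloor>1 / y\<rfloor>))) + (ln (of_int \<lfloor>1 / y\<rfloor>) + ln y)) \<longlongrightarrow> euler_mascheroni + 0) (at_right 0)"
    by (rule tendsto_add[OF 1 2])
  moreover have "eventually (\<lambda>y::real. (harm (nat \<lfloor>1 / y\<rfloor>) - ln (real (nat \<lfloor>1 / y\<rfloor>))) + (ln (of_int \<lfloor>1 / y\<rfloor>) + ln y) = harm (nat \<lfloor>1 / y\<rfloor>) + ln y) (at_right 0)"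
    using ev by eventually_elim simp
  ultimately show ?thesis by (simp add: tendsto_cong)
qed

text \<open>The harmonic number in \<open>kernel_sums\<close> turns into \<open>- ln y\<close> and
  the Euler constant. The limit is the number found in \<open>deriv_seq_zeta_0\<close>, and this is
  how the derivative of the zeta function enters.\<close>

lemma mom_0_asymp:
  "((\<lambda>y. mom 0 y - zconst * y powr k 0 + A 0 * ln y) \<longlongrightarrow> euler_mascheroni * A 0 + kernel_int) (at_right 0)"
proof -
  have "((\<lambda>y. integral {0<..} (\<lambda>t. kernel (of_int \<lceil>t / y\<rceil> * y))) \<longlongrightarrow> kernel_int) (at_right 0)"
    by (rule tendsto_at_right_sequentially[of 0 1]) (auto intro: step_kernel_limit)
  from tendsto_add[OF this tendsto_mult[OF tendsto_const harm_floor_limit, of "A 0"]]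
  have "((\<lambda>y. integral {0<..} (\<lambda>t. kernel (of_int \<lceil>t / y\<rceil> * y)) + A 0 * (harm (nat \<lfloor>1 / y\<rfloor>) + ln y))
    \<longlongrightarrow> kernel_int + A 0 * euler_mascheroni) (at_right 0)" .
  moreover have "eventually (\<lambda>y. integral {0<..} (\<lambda>t. kernel (of_int \<lceil>t / y\<rceil> * y)) + A 0 * (harm (nat \<lfloor>1 / y\<rfloor>) + ln y)
      = mom 0 y - zconst * y powr k 0 + A 0 * ln y) (at_right 0)"
    using eventually_at_right_less[of "0::real"]
  proof eventually_elim
    case (elim y)
    show ?case by (subst step_kernel_integral(2)[OF elim]) (simp add: algebra_simps)
  qed
  ultimately show ?thesis by (simp add: tendsto_cong add.commute mult.commute)
qed

end

text \<open>By the mean value theorem and monotonicity, \<open>g y\<close> lies between the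
  difference quotients of \<open>G\<close> over \<open>{y..(1 + h) * y}\<close> and
  \<open>{(1 - h) * y..y}\<close>. For fixed \<open>h\<close> these have limits, after scaling, as
  \<open>y\<close> tends to 0, and both limits tend to \<open>\<alpha> * C\<close> as
  \<open>h\<close> tends to 0.\<close>

lemma deriv_asymp:
  fixes G g :: "real \<Rightarrow> real"
  assumes der: "\<And>y. y > 0 \<Longrightarrow> (G has_real_derivative - g y) (at y)"
    and mono: "\<And>x y. 0 < x \<Longrightarrow> x \<le> y \<Longrightarrow> g y \<le> g x"
    and lim: "((\<lambda>y. G y * y powr \<alpha>) \<longlongrightarrow> C) (at_right 0)"
  shows "((\<lambda>y. g y * y powr (\<alpha> + 1)) \<longlongrightarrow> \<alpha> * C) (at_right 0)"
proof -
  have scaled: "((\<lambda>y. G (c * y) * y powr \<alpha>) \<longlongrightarrow> C * c powr (- \<alpha>)) (at_right 0)" if c: "c > 0" for c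
  proof -
    have "filterlim (\<lambda>y. c * y) (at_right 0) (at_right 0)" using c by real_asymp
    from tendsto_mult_right[OF filterlim_compose[OF lim this], of "c powr (- \<alpha>)"]
    have "((\<lambda>y. G (c * y) * (c * y) powr \<alpha> * c powr - \<alpha>) \<longlongrightarrow> C * c powr - \<alpha>) (at_right 0)" .
    moreover have "eventually (\<lambda>y. G (c * y) * (c * y) powr \<alpha> * c powr - \<alpha> = G (c * y) * y powr \<alpha>) (at_right 0)"
      using eventually_at_right_less[of "0::real"] by eventually_elim (use c in \<open>simp add: powr_mult powr_minus\<close>)
    ultimately show ?thesis by (simp add: tendsto_cong)
  qed
  have mvt: "\<exists>z. x < z \<and> z < y \<and> G x - G y = (y - x) * g z" if "0 < x" "x < y" for x y
  proof -
    have "\<exists>z>x. z < y \<and> G y - G x = (y - x) * (- g z)"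
      by (rule MVT2[OF that(2)]) (use that der in auto)
    then show ?thesis by (force simp: algebra_simps)
  qed
  have diffs: "((\<lambda>y. (G (c * y) * y powr \<alpha> - G (d * y) * y powr \<alpha>) / h) \<longlongrightarrow> (C * c powr (- \<alpha>) - C * d powr (- \<alpha>)) / h) (at_right 0)"
    if "c > 0" "d > 0" "h \<noteq> 0" for c d h
    by (intro tendsto_intros scaled that)
  have bound: "(G y * y powr \<alpha> - G ((1 + h) * y) * y powr \<alpha>) / h \<le> g y * y powr (\<alpha> + 1)"
    "h < 1 \<Longrightarrow> g y * y powr (\<alpha> + 1) \<le> (G ((1 - h) * y) * y powr \<alpha> - G y * y powr \<alpha>) / h"
    if "h > 0" "y > 0" for h y
  proof -
    have "y < (1 + h) * y" using that by simp
    from mvt[OF that(2) this] obtain z where z: "y < z" "G y - G ((1 + h) * y) = h * y * g z"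
      by (auto simp: algebra_simps)
    have "h * y * g z \<le> h * y * g y" using z that by (intro mult_left_mono mono) auto
    then have "(G y - G ((1 + h) * y)) * y powr \<alpha> \<le> h * y * g y * y powr \<alpha>"
      unfolding z(2) by (intro mult_right_mono) auto
    also have "\<dots> = h * (g y * y powr (\<alpha> + 1))" using that by (simp add: powr_add)
    finally show "(G y * y powr \<alpha> - G ((1 + h) * y) * y powr \<alpha>) / h \<le> g y * y powr (\<alpha> + 1)"
      using that by (simp add: pos_divide_le_eq algebra_simps)
    assume h: "h < 1"
    then have "0 < (1 - h) * y" "(1 - h) * y < y" using that by auto
    from mvt[OF this] obtain z where z: "(1 - h) * y < z" "z < y" "G ((1 - h) * y) - G y = h * y * g z"
      by (auto simp: algebra_simps)
    have "0 < z" using z(1) \<open>0 < (1 - h) * y\<close> by simp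
    then have "h * y * g y \<le> h * y * g z" using z that by (intro mult_left_mono mono) auto
    then have "h * y * g y * y powr \<alpha> \<le> (G ((1 - h) * y) - G y) * y powr \<alpha>"
      unfolding z(3) by (intro mult_right_mono) auto
    moreover have "h * y * g y * y powr \<alpha> = g y * y powr (\<alpha> + 1) * h" using that by (simp add: powr_add)
    ultimately have "g y * y powr (\<alpha> + 1) * h \<le> (G ((1 - h) * y) - G y) * y powr \<alpha>" by (simp only:)
    then show "g y * y powr (\<alpha> + 1) \<le> (G ((1 - h) * y) * y powr \<alpha> - G y * y powr \<alpha>) / h"
      using that by (simp only: pos_le_divide_eq left_diff_distrib)
  qed
  show ?thesis
  proof (rule order_tendstoI)
    fix a assume a: "a < \<alpha> * C"
    have "((\<lambda>h. (C * 1 powr (- \<alpha>) - C * (1 + h) powr (- \<alpha>)) / h) \<longlongrightarrow> \<alpha> * C) (at_right 0)"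
      by real_asymp
    from eventually_happens'[OF _ eventually_conj[OF order_tendstoD(1)[OF this a] eventually_at_right_less[of "0::real"]]]
    obtain h where h: "h > 0" "a < (C * 1 powr (- \<alpha>) - C * (1 + h) powr (- \<alpha>)) / h"
      by auto
    have "eventually (\<lambda>y. a < (G (1 * y) * y powr \<alpha> - G ((1 + h) * y) * y powr \<alpha>) / h) (at_right 0)"
      by (rule order_tendstoD(1)[OF diffs h(2)]) (use h in auto)
    then show "eventually (\<lambda>y. a < g y * y powr (\<alpha> + 1)) (at_right 0)"
      using eventually_at_right_less[of "0::real"]
    proof eventually_elim
      case (elim y)
      then show ?case using bound(1)[OF h(1) elim(2)] by simp
    qed
  next
    fix a assume a: "a > \<alpha> * C"
    have "((\<lambda>h. (C * (1 - h) powr (- \<alpha>) - C * 1 powr (- \<alpha>)) / h) \<longlongrightarrow> \<alpha> * C) (at_right 0)"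
      by real_asymp
    from eventually_happens'[OF _ eventually_conj[OF order_tendstoD(2)[OF this a] eventually_at_right_real[of 0 1]]]
    obtain h where h: "h > 0" "h < 1" "a > (C * (1 - h) powr (- \<alpha>) - C * 1 powr (- \<alpha>)) / h"
      by auto
    have "eventually (\<lambda>y. a > (G ((1 - h) * y) * y powr \<alpha> - G (1 * y) * y powr \<alpha>) / h) (at_right 0)"
      by (rule order_tendstoD(2)[OF diffs h(3)]) (use h in auto)
    then show "eventually (\<lambda>y. a > g y * y powr (\<alpha> + 1)) (at_right 0)"
      using eventually_at_right_less[of "0::real"]
    proof eventually_elim
      case (elim y)
      then show ?case using bound(2)[OF h(1) elim(2) h(2)] by simp
    qed
  qed
qed

section \<open>Derivatives, monotonicity and convexity of the moments\<close>

context theta_seq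
begin

lemma mom_deriv:
  assumes y: "y > 0"
  shows "(mom j has_real_derivative - mom (Suc j) y) (at y)"
proof -
  define c where "c = (\<lambda>m. real m ^ j * acoef m)"
  have e: "exp (- (real m * y)) = exp (- y) ^ m" for m y
    by (simp flip: exp_of_nat_mult)
  have momc: "mom j = (\<lambda>y. \<Sum>m. c m * exp (- y) ^ m)"
    by (simp add: mom_def c_def e fun_eq_iff)
  have sm: "summable (\<lambda>m. c m * exp (- (y / 2)) ^ m)"
    using mom_summable[of "y / 2" j] y by (simp only: c_def e)
  have D: "((\<lambda>x. \<Sum>m. c m * x ^ m) has_real_derivative (\<Sum>m. diffs c m * exp (- y) ^ m)) (at (exp (- y)))"
    by (rule termdiffs_strong[OF sm]) (use y in simp)
  have "((\<lambda>y. exp (- y)) has_real_derivative - exp (- y)) (at y)"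
    by (auto intro!: derivative_eq_intros)
  from DERIV_chain2[OF D this]
  have 1: "(mom j has_real_derivative (\<Sum>m. diffs c m * exp (- y) ^ m) * - exp (- y)) (at y)"
    unfolding momc .
  have "(\<lambda>m. real (Suc m) ^ Suc j * acoef (Suc m) * exp (- (real (Suc m) * y))) sums mom (Suc j) y"
    using mom_sums[OF y, of "Suc j"] by (subst sums_Suc_iff) simp
  then have "(\<lambda>m. diffs c m * exp (- y) ^ m * exp (- y)) sums mom (Suc j) y"
    unfolding e by (simp add: diffs_def c_def mult_ac)
  moreover have "summable (\<lambda>m. diffs c m * exp (- y) ^ m)"
    by (rule termdiff_converges[of _ "exp (- (y / 2))"])
       (use y sm in \<open>auto intro: powser_inside[OF sm]\<close>)
  ultimately have "(\<Sum>m. diffs c m * exp (- y) ^ m) * exp (- y) = mom (Suc j) y"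
    by (subst suminf_mult2) (auto simp: sums_iff)
  then show ?thesis using 1 by simp
qed

lemma mom_antimono:
  assumes "0 < x" "x \<le> y"
  shows "mom j y \<le> mom j x"
  unfolding mom_def using assms
  by (intro suminf_le mom_summable mult_left_mono) (auto simp: acoef_nonneg mult_left_mono)

lemma mom_Suc_asymp:
  assumes "((\<lambda>y. mom j y * y powr \<alpha>) \<longlongrightarrow> C) (at_right 0)"
  shows "((\<lambda>y. mom (Suc j) y * y powr (\<alpha> + 1)) \<longlongrightarrow> \<alpha> * C) (at_right 0)"
  by (rule deriv_asymp[OF mom_deriv mom_antimono assms])

text \<open>The tangent inequality \<open>1 - x <= exp (- x)\<close>, applied to each term with its
  nonnegative weight.\<close>

lemma mom_0_convex:
  assumes "x > 0" "y > 0"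
  shows "mom 0 x \<ge> mom 0 y - mom 1 y * (x - y)"
proof -
  have "(\<lambda>m. real m ^ 0 * acoef m * exp (- (real m * y)) - real m ^ 1 * acoef m * exp (- (real m * y)) * (x - y))
    sums (mom 0 y - mom 1 y * (x - y))"
    by (intro sums_diff sums_mult2 mom_sums assms)
  moreover have "(\<lambda>m. real m ^ 0 * acoef m * exp (- (real m * x))) sums mom 0 x"
    by (intro mom_sums assms)
  ultimately show ?thesis
  proof (rule sums_le[rotated])
    fix m
    have "1 - real m * (x - y) \<le> exp (- (real m * (x - y)))"
      using exp_ge_add_one_self[of "- (real m * (x - y))"] by simp
    then have "acoef m * exp (- (real m * y)) * (1 - real m * (x - y)) \<le> acoef m * exp (- (real m * y)) * exp (- (real m * (x - y)))"
      by (intro mult_left_mono) (auto simp: acoef_nonneg)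
    also have "\<dots> = acoef m * exp (- (real m * x))"
      by (simp add: algebra_simps flip: exp_add)
    finally show "real m ^ 0 * acoef m * exp (- (real m * y)) - real m ^ 1 * acoef m * exp (- (real m * y)) * (x - y)
      \<le> real m ^ 0 * acoef m * exp (- (real m * x))"
      by (simp add: algebra_simps)
  qed
qed

end

context meinardus
begin

abbreviation "\<mu> \<equiv> - k 0"

lemma theta_asymp: "((\<lambda>t. seq_theta L t * t powr \<mu>) \<longlongrightarrow> A (k 0)) (at_right 0)"
proof -
  have "((\<lambda>t. remainder 0 t / t powr k 0) \<longlongrightarrow> 0) (at_right 0)"
    by (rule smalloD_tendsto[OF remainder_smallo])
  from tendsto_add[OF this tendsto_const[of "A (k 0)"]]
  have "((\<lambda>t. remainder 0 t / t powr k 0 + A (k 0)) \<longlongrightarrow> A (k 0)) (at_right 0)" by simp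
  moreover have "eventually (\<lambda>t. remainder 0 t / t powr k 0 + A (k 0) = seq_theta L t * t powr \<mu>) (at_right 0)"
    using eventually_at_right_less[of "0::real"]
    by eventually_elim (simp add: remainder_def powr_minus field_simps)
  ultimately show ?thesis by (simp add: tendsto_cong)
qed

lemma A_k0_pos: "A (k 0) > 0"
proof -
  have "A (k 0) \<ge> 0"
  proof (rule tendsto_lowerbound[OF theta_asymp])
    show "eventually (\<lambda>t. 0 \<le> seq_theta L t * t powr \<mu>) (at_right 0)"
      using eventually_at_right_less[of "0::real"] by eventually_elim (simp add: theta_nonneg)
  qed simp
  then show ?thesis using A_k0 by simp
qed

lemma zconst_pos: "zconst > 0"
proof -
  have "riemann_zeta (1 - k 0) > 0"
    unfolding riemann_zeta_def
    using riemann_zeta_sums[of "1 - k 0"] k0_neg by (intro suminf_pos) (auto simp: sums_iff)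
  then show ?thesis using A_k0_pos by simp
qed

text \<open>Only the leading term of \<open>mom_0_asymp\<close> survives the multiplication by
  \<open>y powr \<mu>\<close>. This crude form is the one that \<open>mom_Suc_asymp\<close> can
  differentiate, as nothing is known about the derivatives of the error.\<close>

lemma mom_0_lim: "((\<lambda>y. mom 0 y * y powr \<mu>) \<longlongrightarrow> zconst) (at_right 0)"
proof -
  have m: "\<mu> > 0" using k0_neg by simp
  have p: "((\<lambda>y. y powr \<mu>) \<longlongrightarrow> 0) (at_right (0::real))" using m by real_asymp
  have l: "((\<lambda>y. ln y * y powr \<mu>) \<longlongrightarrow> 0) (at_right (0::real))" using m by real_asymp
  have "((\<lambda>y. (mom 0 y - zconst * y powr k 0 + A 0 * ln y) * y powr \<mu> + zconst - A 0 * (ln y * y powr \<mu>))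
     \<longlongrightarrow> (euler_mascheroni * A 0 + kernel_int) * 0 + zconst - A 0 * 0) (at_right 0)"
    by (intro tendsto_intros mom_0_asymp p l)
  moreover have "eventually (\<lambda>y. (mom 0 y - zconst * y powr k 0 + A 0 * ln y) * y powr \<mu> + zconst - A 0 * (ln y * y powr \<mu>)
     = mom 0 y * y powr \<mu>) (at_right 0)"
    using eventually_at_right_less[of "0::real"]
  proof eventually_elim
    case (elim y)
    then have "y powr k 0 * y powr \<mu> = 1" by (simp flip: powr_add)
    then have "zconst * y powr k 0 * y powr \<mu> = zconst" by (simp add: mult.assoc)
    then show ?case by (simp add: algebra_simps)
  qed
  ultimately show ?thesis by (simp add: tendsto_cong)
qed

lemma mom_1_lim: "((\<lambda>y. mom 1 y * y powr (\<mu> + 1)) \<longlongrightarrow> \<mu> * zconst) (at_right 0)"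
  using mom_Suc_asymp[OF mom_0_lim] by simp

lemma mom_2_lim: "((\<lambda>y. mom 2 y * y powr (\<mu> + 2)) \<longlongrightarrow> (\<mu> + 1) * (\<mu> * zconst)) (at_right 0)"
  using mom_Suc_asymp[OF mom_1_lim] by (simp add: eval_nat_numeral add.assoc)

lemma mom_3_lim: "((\<lambda>y. mom 3 y * y powr (\<mu> + 3)) \<longlongrightarrow> (\<mu> + 2) * ((\<mu> + 1) * (\<mu> * zconst))) (at_right 0)"
  using mom_Suc_asymp[OF mom_2_lim] by (simp add: eval_nat_numeral add.assoc)

end

section \<open>Decay along the circle of integration\<close>

text \<open>This is \<open>ln (\<bar>1 - \<rho> e\<^sup>i\<^sup>\<alpha>\<bar> / (1 - \<rho>))\<close>, the contribution of a single element to the decay.\<close>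

definition lfac :: "real \<Rightarrow> real \<Rightarrow> real" where
  "lfac \<rho> \<alpha> = ln (1 + 2 * \<rho> * (1 - cos \<alpha>) / (1 - \<rho>)\<^sup>2) / 2"

text \<open>With \<open>z = \<rho> * cis \<alpha>\<close>, this is the real part of the difference
  of the series for \<open>- ln (1 - \<rho>)\<close> and \<open>- ln (1 - z)\<close>. The closed
  form comes from |1 - z|^2 = (1 - \<rho>)^2 + 2 \<rho> (1 - cos \<alpha>).\<close>

lemma lfac_sums:
  assumes r: "0 \<le> \<rho>" "\<rho> < 1"
  shows "(\<lambda>n. \<rho> ^ n * (1 - cos (real n * \<alpha>)) / real n) sums lfac \<rho> \<alpha>"
proof -
  have L: "(\<lambda>n. z ^ n / of_nat n) sums (- ln (1 - z))" if "norm z < 1" for z :: complex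
  proof -
    have "(\<lambda>n. - ((-1) ^ Suc n / of_nat n * (- z) ^ n)) sums (- ln (1 + (- z)))"
      by (intro sums_minus Ln_series) (use that in simp)
    moreover have e: "- ((-1) ^ Suc n / of_nat n * (- z) ^ n) = z ^ n / of_nat n" for n
    proof -
      have "(-1) ^ n * (- z) ^ n = z ^ n" by (simp flip: power_mult_distrib)
      then show ?thesis by simp
    qed
    ultimately show ?thesis by (simp only: diff_conv_add_uminus)
  qed
  define z where "z = of_real \<rho> * cis \<alpha>"
  have z: "norm z < 1" using r by (simp add: z_def norm_mult)
  have "(\<lambda>n. Re (of_real \<rho> ^ n / of_nat n) - Re (z ^ n / of_nat n)) sums (Re (- ln (1 - of_real \<rho>)) - Re (- ln (1 - z)))"
    by (intro sums_diff sums_Re L z) (use r in simp)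
  moreover have "Re (of_real \<rho> ^ n / of_nat n) - Re (z ^ n / of_nat n) = \<rho> ^ n * (1 - cos (real n * \<alpha>)) / real n" for n
  proof -
    have "z ^ n = of_real (\<rho> ^ n) * cis (real n * \<alpha>)" by (simp add: z_def power_mult_distrib Complex.DeMoivre)
    then have "Re (z ^ n) = \<rho> ^ n * cos (real n * \<alpha>)" by simp
    moreover have "Re (w / of_nat n) = Re w / real n" for w
      by (metis Re_divide_of_real of_real_of_nat_eq)
    moreover have "Re (of_real \<rho> ^ n) = \<rho> ^ n" by (simp flip: of_real_power)
    ultimately show ?thesis by (simp add: right_diff_distrib diff_divide_distrib)
  qed
  moreover have "Re (- ln (1 - of_real \<rho>)) - Re (- ln (1 - z)) = lfac \<rho> \<alpha>"
  proof -
    have n1: "norm (1 - complex_of_real \<rho>) = 1 - \<rho>"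
      using r by (metis abs_of_pos diff_gt_0_iff_gt norm_of_real of_real_1 of_real_diff)
    have "(norm (1 - z))\<^sup>2 = (1 - \<rho> * cos \<alpha>)\<^sup>2 + (\<rho> * sin \<alpha>)\<^sup>2"
      by (simp add: z_def cmod_power2)
    also have "\<dots> = (1 - \<rho>)\<^sup>2 + 2 * \<rho> * (1 - cos \<alpha>)"
    proof -
      have "(\<rho> * sin \<alpha>)\<^sup>2 = \<rho>\<^sup>2 - (\<rho> * cos \<alpha>)\<^sup>2"
        by (simp add: power_mult_distrib sin_squared_eq algebra_simps)
      then show ?thesis by (simp add: power2_eq_square algebra_simps)
    qed
    finally have n2: "(norm (1 - z))\<^sup>2 = (1 - \<rho>)\<^sup>2 + 2 * \<rho> * (1 - cos \<alpha>)" .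
    have nz: "1 - z \<noteq> 0" "1 - complex_of_real \<rho> \<noteq> 0" using z r by auto
    have pos: "norm (1 - z) > 0" "1 - \<rho> > 0" using nz r by auto
    have "2 * lfac \<rho> \<alpha> = ln ((norm (1 - z))\<^sup>2 / (1 - \<rho>)\<^sup>2)"
      unfolding n2 lfac_def using pos by (simp add: add_divide_distrib)
    also have "\<dots> = 2 * ln (norm (1 - z)) - 2 * ln (1 - \<rho>)"
      using pos by (simp add: ln_div ln_realpow)
    finally show ?thesis using nz n1 by (simp add: Re_Ln)
  qed
  ultimately show ?thesis by simp
qed

lemma one_minus_cos_ge:
  assumes "\<bar>x\<bar> \<le> (1::real)"
  shows "1 - cos x \<ge> x\<^sup>2 / 4"
proof -
  define u where "u = \<bar>x\<bar> / 2"
  have u: "0 \<le> u" "u \<le> 1 / 2" using assms by (auto simp: u_def)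
  have "\<bar>sin u - (\<Sum>m<3. sin_coeff m * u ^ m)\<bar> \<le> inverse (fact 3) * \<bar>u\<bar> ^ 3"
    by (rule Maclaurin_sin_bound)
  then have "\<bar>sin u - u\<bar> \<le> u ^ 3 / 6"
    using u by (simp add: eval_nat_numeral sin_coeff_def)
  then have "sin u \<ge> u - u ^ 3 / 6" by linarith
  then have s: "sin u \<ge> u - u * u\<^sup>2 / 6" by (simp add: power2_eq_square power3_eq_cube mult.assoc)
  have "u\<^sup>2 \<le> (1 / 2)\<^sup>2" using u by (intro power_mono) auto
  then have "u * u\<^sup>2 \<le> u * (1 / 4)" using u by (intro mult_left_mono) (auto simp: power2_eq_square)
  \<comment> \<open>As \<open>u <= 1/2\<close>, the cubic term takes away at most
    \<open>u / 24\<close>. The conclusion then rests on \<open>2 * (23/24)^2 >= 1\<close>.\<close>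
  then have "u * (23 / 24) \<le> sin u" using s by linarith
  then have "(u * (23 / 24))\<^sup>2 \<le> (sin u)\<^sup>2" using u by (intro power_mono) auto
  moreover have "1 - cos x = 2 * (sin u)\<^sup>2"
    using cos_double_sin[of u] by (simp add: u_def)
  moreover have "x\<^sup>2 = 4 * u\<^sup>2" by (simp add: u_def power2_eq_square)
  moreover have "(u * (23 / 24))\<^sup>2 = u\<^sup>2 * (529 / 576)" by (simp add: power_mult_distrib power2_eq_square)
  moreover have "0 \<le> (sin u)\<^sup>2" by simp
  ultimately show ?thesis by linarith
qed

section \<open>Lower bounds for the decay from finitely many elements\<close>

context theta_seq
begin

text \<open>So \<open>exp (- dev y \<theta>)\<close> is the modulus of the generating function at angle \<open>\<theta>\<close> on the circle of radius
  \<open>exp (- y)\<close>, relative to its value at angle \<open>0\<close>.\<close>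

definition dev :: "real \<Rightarrow> real \<Rightarrow> real" where
  "dev y \<theta> = mom 0 y - Re (P (of_real (exp (- y)) * cis \<theta>))"

lemma dev_sums:
  assumes y: "y > 0"
  shows "(\<lambda>m. acoef m * exp (- (real m * y)) * (1 - cos (real m * \<theta>))) sums dev y \<theta>"
proof -
  have e: "exp (- (real m * y)) = exp (- y) ^ m" for m
    by (simp flip: exp_of_nat_mult)
  have "(\<lambda>m. Re (of_real (acoef m) * (of_real (exp (- y)) * cis \<theta>) ^ m)) sums Re (P (of_real (exp (- y)) * cis \<theta>))"
    by (intro sums_Re P_sums) (use y in \<open>simp add: norm_mult\<close>)
  moreover have e2: "Re (of_real (acoef m) * (of_real (exp (- y)) * cis \<theta>) ^ m) = acoef m * exp (- (real m * y)) * cos (real m * \<theta>)" for m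
  proof -
    have "of_real (acoef m) * (of_real (exp (- y)) * cis \<theta>) ^ m = of_real (acoef m * exp (- y) ^ m) * cis (real m * \<theta>)"
      by (simp add: power_mult_distrib Complex.DeMoivre)
    also have "Re \<dots> = acoef m * exp (- y) ^ m * cos (real m * \<theta>)"
      by (simp del: of_real_mult of_real_power)
    finally show ?thesis by (simp only: e)
  qed
  ultimately have "(\<lambda>m. acoef m * exp (- (real m * y)) * cos (real m * \<theta>)) sums Re (P (of_real (exp (- y)) * cis \<theta>))"
    by (simp only: e2)
  from sums_diff[OF mom_sums[OF y, of 0] this] show ?thesis
    by (simp add: dev_def algebra_simps)
qed

text \<open>The \<open>m\<close>-th term of \<open>dev\<close> is a sum of nonnegative contributions
  \<open>b i m\<close> of the positions with \<open>L i dvd m\<close>, and keeping only those in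
  \<open>T\<close> decreases it. For one position the multiples of \<open>L i\<close> form the
  series of \<open>lfac_sums\<close>.\<close>

lemma dev_ge:
  assumes y: "y > 0" and T: "finite T"
  shows "(\<Sum>i\<in>T. lfac (exp (- (real (L i) * y))) (real (L i) * \<theta>)) \<le> dev y \<theta>"
proof -
  define b where "b = (\<lambda>i m. (if L i dvd m then real (L i) / real m else 0) * exp (- (real m * y)) * (1 - cos (real m * \<theta>)))"
  have b: "b i sums lfac (exp (- (real (L i) * y))) (real (L i) * \<theta>)" for i
  proof -
    have "(\<lambda>n. b i (L i * n)) sums lfac (exp (- (real (L i) * y))) (real (L i) * \<theta>)"
    proof -
      have "b i (L i * n) = exp (- (real (L i) * y)) ^ n * (1 - cos (real n * (real (L i) * \<theta>))) / real n" for n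
        using L_pos[of i] by (simp add: b_def mult_ac flip: exp_of_nat_mult)
      then show ?thesis
        using lfac_sums[of "exp (- (real (L i) * y))" "real (L i) * \<theta>"] L_pos[of i] y by simp
    qed
    moreover have "strict_mono (\<lambda>n. L i * n)" using L_pos[of i] by (auto simp: strict_mono_def)
    moreover have "b i m = 0" if "m \<notin> range (\<lambda>n. L i * n)" for m
      using that by (auto simp: b_def dvd_def)
    ultimately show ?thesis using sums_mono_reindex[of "\<lambda>n. L i * n" "b i"] by simp
  qed
  have "(\<lambda>m. \<Sum>i\<in>T. b i m) sums (\<Sum>i\<in>T. lfac (exp (- (real (L i) * y))) (real (L i) * \<theta>))"
    by (intro sums_sum b)
  then show ?thesis
  proof (rule sums_le[rotated, OF _ dev_sums[OF y]])
    fix m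
    have "(\<Sum>i\<in>T. if L i dvd m then real (L i) / real m else 0) \<le> acoef m"
    proof (cases "m = 0")
      case False
      have "(\<Sum>i\<in>T. if L i dvd m then real (L i) / real m else 0) = (\<Sum>i\<in>{i\<in>T. L i dvd m}. real (L i) / real m)"
        using T by (simp flip: sum.inter_filter)
      also have "\<dots> \<le> (\<Sum>i\<in>{i. L i dvd m}. real (L i) / real m)"
        using False by (intro sum_mono2 finite_L_dvd) auto
      also have "\<dots> = acoef m" by (simp add: acoef_def lsum_def sum_divide_distrib)
      finally show ?thesis .
    qed (simp add: acoef_def)
    then have "(\<Sum>i\<in>T. if L i dvd m then real (L i) / real m else 0) * (exp (- (real m * y)) * (1 - cos (real m * \<theta>)))
      \<le> acoef m * (exp (- (real m * y)) * (1 - cos (real m * \<theta>)))"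
      by (intro mult_right_mono) auto
    then show "(\<Sum>i\<in>T. b i m) \<le> acoef m * exp (- (real m * y)) * (1 - cos (real m * \<theta>))"
      by (simp add: b_def sum_distrib_right mult.assoc)
  qed
qed

text \<open>Elements up to \<open>u\<close> are counted with weight 1. For the others, half of the
  exponent provides the small factor and the other half is kept for convergence.\<close>

lemma theta_le_count:
  assumes t: "t > 0" and u: "u > 0"
  shows "seq_theta L t \<le> real (card {i. real (L i) \<le> u}) + exp (- (u * t / 2)) * seq_theta L (t / 2)"
proof -
  have fin: "finite {i. real (L i) \<le> u}"
    by (rule finite_subset[OF _ finite_L_le[of "nat \<lfloor>u\<rfloor>"]]) (auto simp: le_nat_floor)
  have 1: "(\<lambda>i. if i \<in> {i. real (L i) \<le> u} then 1 else 0) sums (\<Sum>i\<in>{i. real (L i) \<le> u}. (1::real))"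
    using fin by (rule sums_If_finite_set)
  have 2: "(\<lambda>i. exp (- (u * t / 2)) * exp (- real (L i) * (t / 2))) sums (exp (- (u * t / 2)) * seq_theta L (t / 2))"
    by (intro sums_mult theta_sums) (use t in simp)
  have "seq_theta L t \<le> (\<Sum>i\<in>{i. real (L i) \<le> u}. 1) + exp (- (u * t / 2)) * seq_theta L (t / 2)"
  proof (rule sums_le[OF _ theta_sums[OF t] sums_add[OF 1 2]])
    fix i
    show "exp (- real (L i) * t) \<le> (if i \<in> {i. real (L i) \<le> u} then 1 else 0) + exp (- (u * t / 2)) * exp (- real (L i) * (t / 2))"
    proof (cases "real (L i) \<le> u")
      case True
      have "exp (- real (L i) * t) \<le> 1" using t by simp
      also have "\<dots> \<le> 1 + exp (- (u * t / 2)) * exp (- real (L i) * (t / 2))" by simp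
      finally show ?thesis using True by simp
    next
      case False
      then have "u * t \<le> real (L i) * t" using t by simp
      then have "exp (- real (L i) * t) \<le> exp (- (u * t / 2)) * exp (- real (L i) * (t / 2))"
        unfolding exp_add[symmetric] exp_le_cancel_iff by (simp add: field_simps)
      then show ?thesis using False by (simp only: mem_Collect_eq if_False add_0)
    qed
  qed
  then show ?thesis by simp
qed

end

section \<open>Density of the elements\<close>

context meinardus
begin

text \<open>A bound of Chebyshev type. With \<open>u = B / t\<close> and \<open>B\<close> large, the
  tail in \<open>theta_le_count\<close> is eventually less than half of the limiting size of
  \<Theta>, so the count must carry the rest, which has order
  \<open>t powr (- \<mu>)\<close>.\<close>

lemma count_lower:
  obtains c where "c > 0" "eventually (\<lambda>u. c * u powr \<mu> \<le> real (card {i. real (L i) \<le> u})) at_top"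
proof -
  have m: "\<mu> > 0" using k0_neg by simp
  \<comment> \<open>Halving \<open>t\<close> multiplies \<Theta> asymptotically by
    \<open>2 powr \<mu>\<close>, so this is the limiting ratio of the tail to \<Theta>.\<close>
  have "((\<lambda>B. exp (- B / 2) * 2 powr \<mu>) \<longlongrightarrow> 0) at_top" by real_asymp
  from eventually_happens'[OF _ eventually_conj[OF order_tendstoD(2)[OF this, of "1/2"] eventually_gt_at_top[of 0]]]
  obtain B where B: "exp (- B / 2) * 2 powr \<mu> < 1 / 2" "B > 0"
    by auto
  define a where "a = A (k 0)"
  have a: "a > 0" using A_k0_pos by (simp add: a_def)
  have h: "filterlim (\<lambda>t. t / 2) (at_right 0) (at_right (0::real))" by real_asymp
  have 1: "((\<lambda>t. seq_theta L t * t powr \<mu> - exp (- B / 2) * 2 powr \<mu> * (seq_theta L (t / 2) * (t / 2) powr \<mu>)) \<longlongrightarrow> a - exp (- B / 2) * 2 powr \<mu> * a) (at_right 0)"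
    unfolding a_def by (intro tendsto_intros theta_asymp filterlim_compose[OF theta_asymp h])
  have "a / 2 < a - exp (- B / 2) * 2 powr \<mu> * a"
    using mult_strict_right_mono[OF B(1) a] by simp
  from order_tendstoD(1)[OF 1 this]
  have "eventually (\<lambda>t. a / 2 * B powr (- \<mu>) * (B / t) powr \<mu> \<le> real (card {i. real (L i) \<le> B / t})) (at_right 0)"
    using eventually_at_right_less[of "0::real"]
  proof eventually_elim
    case (elim t)
    have "seq_theta L t - exp (- B / 2) * seq_theta L (t / 2) \<le> real (card {i. real (L i) \<le> B / t})"
      using theta_le_count[of t "B / t"] elim(2) B(2) by simp
    then have "(seq_theta L t - exp (- B / 2) * seq_theta L (t / 2)) * t powr \<mu> \<le> real (card {i. real (L i) \<le> B / t}) * t powr \<mu>"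
      by (intro mult_right_mono) auto
    moreover have "(seq_theta L t - exp (- B / 2) * seq_theta L (t / 2)) * t powr \<mu> =
       seq_theta L t * t powr \<mu> - exp (- B / 2) * 2 powr \<mu> * (seq_theta L (t / 2) * (t / 2) powr \<mu>)"
      using elim(2) by (simp add: powr_divide algebra_simps)
    ultimately have *: "a / 2 \<le> real (card {i. real (L i) \<le> B / t}) * t powr \<mu>" using elim(1) by linarith
    have "B powr (- \<mu>) * (B / t) powr \<mu> * t powr \<mu> = 1"
      using B(2) elim(2) by (simp add: powr_divide powr_minus)
    then have "a / 2 * (B powr (- \<mu>) * (B / t) powr \<mu> * t powr \<mu>) = a / 2" by (simp only: mult_1_right)
    then have "a / 2 * B powr (- \<mu>) * (B / t) powr \<mu> * t powr \<mu> \<le> real (card {i. real (L i) \<le> B / t}) * t powr \<mu>"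
      using * by (simp only: mult.assoc)
    moreover have "t powr \<mu> > 0" using elim(2) by simp
    ultimately show ?case by (simp only: mult_le_cancel_right_pos)
  qed
  moreover have "filterlim (\<lambda>u. B / u) (at_right 0) at_top" using B(2) by real_asymp
  ultimately have "eventually (\<lambda>u. a / 2 * B powr (- \<mu>) * (B / (B / u)) powr \<mu> \<le> real (card {i. real (L i) \<le> B / (B / u)})) at_top"
    by (rule eventually_compose_filterlim)
  then have "eventually (\<lambda>u. (a / 2 * B powr (- \<mu>)) * u powr \<mu> \<le> real (card {i. real (L i) \<le> u})) at_top"
    using B(2) by simp
  moreover have "a / 2 * B powr (- \<mu>) > 0" using a B(2) by simp
  ultimately show ?thesis using that by blast
qed

end

text \<open>Since \<open>l * y <= 1\<close> and \<open>exp 1 <= 3\<close>, the factor in front of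
  \<open>1 - cos \<alpha>\<close> is at least \<open>2/3\<close>; the root of the denominator is at
  most \<open>l * y\<close>.\<close>

lemma lfac_arg_bound:
  fixes l y \<kappa> \<alpha> :: real
  assumes l: "l > 0" and y: "y > 0" "l * y \<le> 1" and \<kappa>: "\<kappa> \<ge> 0" "1 - cos \<alpha> \<ge> \<kappa>"
  shows "2 * exp (- (l * y)) * (1 - cos \<alpha>) / (1 - exp (- (l * y)))\<^sup>2 \<ge> (2 / 3) * \<kappa> / (l * y)\<^sup>2"
proof -
  have e3: "exp (- (l * y)) \<ge> 1 / 3"
  proof -
    have "exp (l * y) \<le> exp 1" unfolding exp_le_cancel_iff by (rule y)
    also have "\<dots> \<le> (3::real)" by (rule exp_le)
    finally show ?thesis by (simp add: exp_minus field_simps)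
  qed
  have "0 < l * y" using l y by simp
  then have pos: "1 - exp (- (l * y)) > 0" by simp
  have le: "1 - exp (- (l * y)) \<le> l * y" using exp_ge_add_one_self[of "- (l * y)"] by simp
  show ?thesis
  proof (rule frac_le)
    show "(2 / 3) * \<kappa> \<le> 2 * exp (- (l * y)) * (1 - cos \<alpha>)"
      using e3 \<kappa> mult_mono[of "2/3" "2 * exp (- (l * y))" \<kappa> "1 - cos \<alpha>"] by simp
    show "0 < (1 - exp (- (l * y)))\<^sup>2" using pos by (rule zero_less_power)
    show "(1 - exp (- (l * y)))\<^sup>2 \<le> (l * y)\<^sup>2" using pos le by (intro power_mono) auto
  qed (use \<kappa> in auto)
qed

text \<open>The size \<open>l\<close> cancels between \<open>(l * \<psi>)^2\<close> and
  \<open>(l * y)^2\<close>, so all elements up to both \<open>1 / y\<close> and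
  \<open>1 / |\<psi>|\<close> have the same lower bound. The constant is
  \<open>2/3 * 1/4 = 1/6\<close>.\<close>

lemma lfac_ge:
  assumes l: "l > 0" and y: "y > 0" "l * y \<le> 1" and \<psi>: "l * \<bar>\<psi>\<bar> \<le> 1"
  shows "lfac (exp (- (l * y))) (l * \<psi>) \<ge> ln (1 + \<psi>\<^sup>2 / (6 * y\<^sup>2)) / 2"
proof -
  have "\<bar>l * \<psi>\<bar> \<le> 1" using l \<psi> by (simp add: abs_mult)
  from one_minus_cos_ge[OF this] have "1 - cos (l * \<psi>) \<ge> (l * \<psi>)\<^sup>2 / 4" .
  from lfac_arg_bound[OF l y _ this]
  have "2 * exp (- (l * y)) * (1 - cos (l * \<psi>)) / (1 - exp (- (l * y)))\<^sup>2 \<ge> (2 / 3) * ((l * \<psi>)\<^sup>2 / 4) / (l * y)\<^sup>2"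
    by simp
  also have "(2 / 3) * ((l * \<psi>)\<^sup>2 / 4) / (l * y)\<^sup>2 = \<psi>\<^sup>2 / (6 * y\<^sup>2)"
    using l y by (simp add: field_simps power2_eq_square)
  finally have *: "\<psi>\<^sup>2 / (6 * y\<^sup>2) \<le> 2 * exp (- (l * y)) * (1 - cos (l * \<psi>)) / (1 - exp (- (l * y)))\<^sup>2" .
  have "0 \<le> \<psi>\<^sup>2 / (6 * y\<^sup>2)" by simp
  with * have "ln (1 + \<psi>\<^sup>2 / (6 * y\<^sup>2)) \<le> ln (1 + 2 * exp (- (l * y)) * (1 - cos (l * \<psi>)) / (1 - exp (- (l * y)))\<^sup>2)"
    by (intro ln_mono) linarith+
  then show ?thesis by (simp add: lfac_def)
qed

text \<open>At an angle where the cosine stays away from 1, a single element already gives a factor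
  of order \<open>y\<close>. Squaring removes the factor \<open>1/2\<close> in
  \<open>lfac\<close>.\<close>

lemma exp_lfac_le:
  assumes l: "l > 0" and y: "y > 0" "l * y \<le> 1" and \<kappa>: "\<kappa> > 0" "1 - cos \<alpha> \<ge> \<kappa>"
  shows "exp (- lfac (exp (- (l * y))) \<alpha>) \<le> l * sqrt (3 / (2 * \<kappa>)) * y"
proof -
  define X where "X = 2 * exp (- (l * y)) * (1 - cos \<alpha>) / (1 - exp (- (l * y)))\<^sup>2"
  have X: "X \<ge> (2 / 3) * \<kappa> / (l * y)\<^sup>2"
    unfolding X_def by (rule lfac_arg_bound) (use assms in auto)
  have p: "(2 / 3) * \<kappa> / (l * y)\<^sup>2 > 0" using l y \<kappa> by simp
  have sq: "(exp (- (a / 2)))\<^sup>2 = exp (- a)" for a :: real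
    by (simp add: power2_eq_square flip: exp_add)
  have "(exp (- lfac (exp (- (l * y))) \<alpha>))\<^sup>2 = exp (- ln (1 + X))"
    unfolding lfac_def X_def by (rule sq)
  also have "\<dots> = 1 / (1 + X)"
  proof -
    have "1 + X > 0" using X p by linarith
    then show ?thesis by (simp add: exp_minus divide_inverse)
  qed
  also have "\<dots> \<le> 1 / ((2 / 3) * \<kappa> / (l * y)\<^sup>2)"
    by (rule frac_le) (use X p in linarith)+
  also have "\<dots> = (l * sqrt (3 / (2 * \<kappa>)) * y)\<^sup>2"
    using \<kappa> by (simp add: power_mult_distrib real_sqrt_pow2)
  finally show ?thesis
    by (rule power2_le_imp_le) (use l y \<kappa> in auto)
qed

section \<open>Decay near the angle 0\<close>

context meinardus
begin

lemma mu_pos: "\<mu> > 0" using k0_neg by simp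

text \<open>Avoiding a finite set \<open>S\<close> of positions makes the bound applicable also near angles \<open>\<theta>\<^sub>0 \<noteq> 0\<close> at
  which all factors outside \<open>S\<close> have period \<open>\<theta>\<^sub>0\<close>.\<close>

lemma near_bound:
  assumes S: "finite S"
  obtains \<delta> c where "\<delta> > 0" "c > 0"
    "eventually (\<lambda>y. \<forall>\<psi>. \<bar>\<psi>\<bar> \<le> \<delta> \<longrightarrow> (\<exists>T. finite T \<and> T \<inter> S = {} \<and>
       exp (- (\<Sum>i\<in>T. lfac (exp (- (real (L i) * y))) (real (L i) * \<psi>)))
        \<le> (if \<bar>\<psi>\<bar> \<le> y then exp (- c * \<psi>\<^sup>2 * y powr (k 0 - 2)) else y powr (\<mu> + 2)))) (at_right 0)"
proof -
  obtain c0 where c0: "c0 > 0" "eventually (\<lambda>u. c0 * u powr \<mu> \<le> real (card {i. real (L i) \<le> u})) at_top"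
    using count_lower by blast
  \<comment> \<open>The power \<open>y powr K\<close> is the square of the peak width
    \<open>y powr (1 + \<mu> / 2)\<close> and hence small against the main contribution.\<close>
  define K where "K = \<mu> + 2"
  define c2 where "c2 = c0 / 2"
  have c2: "c2 > 0" using c0 by (simp add: c2_def)
  have "eventually (\<lambda>u. real (card S) \<le> c2 * u powr \<mu>) at_top"
    using mu_pos c2 by real_asymp
  then have "eventually (\<lambda>u. c2 * u powr \<mu> \<le> real (card ({i. real (L i) \<le> u} - S))) at_top"
    using c0(2)
  proof eventually_elim
    case (elim u)
    have "card {i. real (L i) \<le> u} - card S \<le> card ({i. real (L i) \<le> u} - S)"
      by (rule diff_card_le_card_Diff[OF S])
    then have "real (card {i. real (L i) \<le> u}) - real (card S) \<le> real (card ({i. real (L i) \<le> u} - S))"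
      by linarith
    then show ?case using elim by (simp add: c2_def)
  qed
  then obtain u1 where u1: "\<And>u. u \<ge> u1 \<Longrightarrow> c2 * u powr \<mu> \<le> real (card ({i. real (L i) \<le> u} - S))"
    unfolding eventually_at_top_linorder by blast
  \<comment> \<open>For \<open>|\<psi>| <= \<delta>\<close> at least \<open>2 * (K + 1)\<close>
    elements are then available. Once \<open>|\<psi>| > sqrt y\<close>, each gains a factor of order
    \<open>sqrt y\<close>; taking \<open>K + 1\<close> instead of \<open>K\<close> absorbs the
    constant 6 in \<open>e2\<close>.\<close>
  have "eventually (\<lambda>d. 1 / d \<ge> u1 \<and> c2 * d powr (- \<mu>) \<ge> 2 * (K + 1) \<and> d > 0) (at_right 0)"
    using mu_pos c2 by (intro eventually_conj) real_asymp+
  from eventually_happens'[OF _ this]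
  obtain \<delta> where \<delta>: "1 / \<delta> \<ge> u1" "c2 * \<delta> powr (- \<mu>) \<ge> 2 * (K + 1)" "\<delta> > 0" by auto
  have K: "K > 0" using mu_pos by (simp add: K_def)
  have e1: "eventually (\<lambda>y. c2 * y powr (- \<mu> / 2) * (ln (7 / 6) / 2) \<ge> - K * ln y) (at_right 0)"
    using mu_pos c2 by real_asymp
  have e2: "eventually (\<lambda>y::real. (K + 1) * ln (1 / (6 * y)) \<ge> - K * ln y) (at_right 0)"
    by real_asymp
  have e3: "eventually (\<lambda>y::real. y > 0 \<and> y < \<delta> \<and> y < 1 / 6) (at_right 0)"
    using \<delta> by (intro eventually_conj eventually_at_right_less eventually_at_rightI[of _ "\<delta>"] eventually_at_rightI[of _ "1/6"]) auto
  show ?thesis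
  proof (rule that[of \<delta> "c2 / 24"])
    show "eventually (\<lambda>y. \<forall>\<psi>. \<bar>\<psi>\<bar> \<le> \<delta> \<longrightarrow> (\<exists>T. finite T \<and> T \<inter> S = {} \<and>
       exp (- (\<Sum>i\<in>T. lfac (exp (- (real (L i) * y))) (real (L i) * \<psi>)))
        \<le> (if \<bar>\<psi>\<bar> \<le> y then exp (- (c2 / 24) * \<psi>\<^sup>2 * y powr (k 0 - 2)) else y powr (\<mu> + 2)))) (at_right 0)"
      using e1 e2 e3
    proof eventually_elim
      case (elim y)
      then have y: "y > 0" "y < \<delta>" "y < 1 / 6" by auto
      show ?case
      proof (intro allI impI)
        fix \<psi> :: real assume \<psi>: "\<bar>\<psi>\<bar> \<le> \<delta>"
        \<comment> \<open>The elements up to \<open>1 / m\<close> are exactly those that meet both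
          size conditions of \<open>lfac_ge\<close>.\<close>
        define m where "m = max y \<bar>\<psi>\<bar>"
        have m: "m > 0" "m \<le> \<delta>" "y \<le> m" "\<bar>\<psi>\<bar> \<le> m" using y \<psi> by (auto simp: m_def)
        define T where "T = {i. real (L i) \<le> 1 / m} - S"
        have fT: "finite T"
          unfolding T_def
          by (rule finite_Diff, rule finite_subset[OF _ finite_L_le[of "nat \<lfloor>1 / m\<rfloor>"]]) (auto simp: le_nat_floor)
        have "1 / \<delta> \<le> 1 / m" using m \<delta> by (intro divide_left_mono) auto
        then have "c2 * (1 / m) powr \<mu> \<le> real (card T)"
          unfolding T_def using \<delta>(1) by (intro u1) linarith
        then have cT: "c2 * m powr (- \<mu>) \<le> real (card T)"
          using m by (simp add: powr_divide powr_minus_divide)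
        define w where "w = ln (1 + \<psi>\<^sup>2 / (6 * y\<^sup>2)) / 2"
        have w0: "w \<ge> 0" unfolding w_def by simp
        have "real (card T) * w \<le> (\<Sum>i\<in>T. lfac (exp (- (real (L i) * y))) (real (L i) * \<psi>))"
        proof (rule sum_bounded_below)
          fix i assume i: "i \<in> T"
          then have Lm: "real (L i) * m \<le> 1" using m by (simp add: T_def pos_le_divide_eq)
          have "real (L i) * y \<le> real (L i) * m" "real (L i) * \<bar>\<psi>\<bar> \<le> real (L i) * m"
            by (rule mult_left_mono; use m in simp)+
          then have "real (L i) * y \<le> 1" "real (L i) * \<bar>\<psi>\<bar> \<le> 1"
            using Lm by linarith+
          then show "w \<le> lfac (exp (- (real (L i) * y))) (real (L i) * \<psi>)"
            unfolding w_def using y(1) L_pos[of i] by (intro lfac_ge) auto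
        qed
        then have main: "exp (- (\<Sum>i\<in>T. lfac (exp (- (real (L i) * y))) (real (L i) * \<psi>))) \<le> exp (- (real (card T) * w))"
          by simp
        have "exp (- (real (card T) * w)) \<le> (if \<bar>\<psi>\<bar> \<le> y then exp (- (c2 / 24) * \<psi>\<^sup>2 * y powr (k 0 - 2)) else y powr (\<mu> + 2))"
        proof (cases "\<bar>\<psi>\<bar> \<le> y")
          case True
          define u where "u = \<psi>\<^sup>2 / (6 * y\<^sup>2)"
          have "\<psi>\<^sup>2 \<le> y\<^sup>2" using power_mono[of "\<bar>\<psi>\<bar>" y 2] True by simp
          then have "\<psi>\<^sup>2 / y\<^sup>2 \<le> 1" using y by simp
          then have u: "0 \<le> u" "u \<le> 1 / 6" by (auto simp: u_def)
          have "u - u\<^sup>2 \<le> ln (1 + u)" using u by (intro ln_one_plus_pos_lower_bound) auto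
          moreover have "u\<^sup>2 \<le> u * (1 / 6)" unfolding power2_eq_square using u by (intro mult_left_mono) auto
          \<comment> \<open>From \<open>ln (1 + u) >= 5/6 * u\<close> and the factor
            \<open>1/2\<close> in \<open>w\<close>. Together with the 6 in \<open>u\<close> this
            gives the rate \<open>c2 / 24\<close>.\<close>
          ultimately have "w \<ge> u / 4" using u by (simp add: w_def u_def[symmetric])
          moreover have "m = y" using True y by (simp add: m_def)
          ultimately have "c2 * y powr (- \<mu>) * (u / 4) \<le> real (card T) * w"
            using cT u c2 by (intro mult_mono) auto
          moreover have "c2 * y powr (- \<mu>) * (u / 4) = (c2 / 24) * \<psi>\<^sup>2 * y powr (k 0 - 2)"
            using y by (simp add: u_def powr_diff)
          ultimately have "(c2 / 24) * \<psi>\<^sup>2 * y powr (k 0 - 2) \<le> real (card T) * w" by (simp only:)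
          then show ?thesis
            using True by (simp only: if_True exp_le_cancel_iff mult_minus_left neg_le_iff_le)
        next
          case False
          then have my: "m = \<bar>\<psi>\<bar>" "y < \<bar>\<psi>\<bar>" by (auto simp: m_def)
          have "- K * ln y \<le> real (card T) * w"
          \<comment> \<open>Up to \<open>sqrt y\<close> each element is only known to gain a
            constant factor, but there are at least a negative power of \<open>y\<close> of them.
            Beyond, their number may stay bounded, but each gains a factor of order
            \<open>sqrt y\<close>.\<close>
          proof (cases "\<bar>\<psi>\<bar> \<le> sqrt y")
            case True
            have "y\<^sup>2 \<le> \<psi>\<^sup>2" using power_mono[of y "\<bar>\<psi>\<bar>" 2] my y by simp
            then have "1 \<le> \<psi>\<^sup>2 / y\<^sup>2" using y by simp
            then have "ln (7 / 6) \<le> ln (1 + \<psi>\<^sup>2 / (6 * y\<^sup>2))" by (intro ln_mono) auto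
            then have w: "ln (7 / 6) / 2 \<le> w" by (simp add: w_def)
            have "\<bar>\<psi>\<bar> powr (- \<mu>) \<ge> sqrt y powr (- \<mu>)"
              using True my y mu_pos by (intro powr_mono2') auto
            also have "sqrt y powr (- \<mu>) = y powr (- \<mu> / 2)"
              using y by (simp add: powr_half_sqrt[symmetric] powr_powr)
            finally have "c2 * y powr (- \<mu> / 2) \<le> real (card T)"
              using cT my c2 by (meson mult_left_mono order_trans less_imp_le)
            then have "c2 * y powr (- \<mu> / 2) * (ln (7 / 6) / 2) \<le> real (card T) * w"
              using w c2 by (intro mult_mono) auto
            then show ?thesis using elim(1) by linarith
          next
            case False
            then have "(sqrt y)\<^sup>2 \<le> \<bar>\<psi>\<bar>\<^sup>2" using y by (intro power_mono) auto
            then have "y \<le> \<psi>\<^sup>2" using y by simp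
            then have "1 / (6 * y) \<le> \<psi>\<^sup>2 / (6 * y\<^sup>2)"
              using y by (simp add: field_simps power2_eq_square)
            then have "ln (1 / (6 * y)) \<le> ln (1 + \<psi>\<^sup>2 / (6 * y\<^sup>2))"
              using y by (intro ln_mono) auto
            then have w: "ln (1 / (6 * y)) / 2 \<le> w" by (simp add: w_def)
            have "\<delta> powr (- \<mu>) \<le> \<bar>\<psi>\<bar> powr (- \<mu>)"
              using \<psi> my y mu_pos by (intro powr_mono2') auto
            then have "2 * (K + 1) \<le> real (card T)"
              using cT my c2 \<delta>(2) by (meson mult_left_mono order_trans less_imp_le)
            then have "2 * (K + 1) * (ln (1 / (6 * y)) / 2) \<le> real (card T) * w"
              using w K y by (intro mult_mono) (auto simp: ln_div)
            moreover have "2 * (K + 1) * (ln (1 / (6 * y)) / 2) = (K + 1) * ln (1 / (6 * y))" by simp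
            ultimately show ?thesis using elim(2) by linarith
          qed
          then have "exp (- (real (card T) * w)) \<le> exp (K * ln y)" by simp
          also have "\<dots> = y powr (\<mu> + 2)" using y by (simp add: powr_def K_def)
          finally show ?thesis using False by simp
        qed
        with main have "exp (- (\<Sum>i\<in>T. lfac (exp (- (real (L i) * y))) (real (L i) * \<psi>)))
           \<le> (if \<bar>\<psi>\<bar> \<le> y then exp (- (c2 / 24) * \<psi>\<^sup>2 * y powr (k 0 - 2)) else y powr (\<mu> + 2))"
          by (rule order_trans)
        moreover have "T \<inter> S = {}" by (auto simp: T_def)
        ultimately show "\<exists>T. finite T \<and> T \<inter> S = {} \<and> exp (- (\<Sum>i\<in>T. lfac (exp (- (real (L i) * y))) (real (L i) * \<psi>)))
           \<le> (if \<bar>\<psi>\<bar> \<le> y then exp (- (c2 / 24) * \<psi>\<^sup>2 * y powr (k 0 - 2)) else y powr (\<mu> + 2))"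
          using fT by blast
      qed
    qed
  qed (use \<delta> c2 in auto)
qed

lemma dev_near:
  obtains \<delta> c where "\<delta> > 0" "c > 0"
    "eventually (\<lambda>y. \<forall>\<theta>. \<bar>\<theta>\<bar> \<le> \<delta> \<longrightarrow> exp (- dev y \<theta>)
       \<le> (if \<bar>\<theta>\<bar> \<le> y then exp (- c * \<theta>\<^sup>2 * y powr (k 0 - 2)) else y powr (\<mu> + 2))) (at_right 0)"
proof -
  obtain \<delta> c where dc: "\<delta> > 0" "c > 0"
    "eventually (\<lambda>y. \<forall>\<psi>. \<bar>\<psi>\<bar> \<le> \<delta> \<longrightarrow> (\<exists>T. finite T \<and> T \<inter> {} = {} \<and>
       exp (- (\<Sum>i\<in>T. lfac (exp (- (real (L i) * y))) (real (L i) * \<psi>)))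
        \<le> (if \<bar>\<psi>\<bar> \<le> y then exp (- c * \<psi>\<^sup>2 * y powr (k 0 - 2)) else y powr (\<mu> + 2)))) (at_right 0)"
    using near_bound[of "{}"] by blast
  have "eventually (\<lambda>y. \<forall>\<theta>. \<bar>\<theta>\<bar> \<le> \<delta> \<longrightarrow> exp (- dev y \<theta>)
       \<le> (if \<bar>\<theta>\<bar> \<le> y then exp (- c * \<theta>\<^sup>2 * y powr (k 0 - 2)) else y powr (\<mu> + 2))) (at_right 0)"
    using dc(3) eventually_at_right_less[of "0::real"]
  proof eventually_elim
    case (elim y)
    show ?case
    proof (intro allI impI)
      fix \<theta> :: real assume "\<bar>\<theta>\<bar> \<le> \<delta>"
      with elim(1) obtain T where T: "finite T" "exp (- (\<Sum>i\<in>T. lfac (exp (- (real (L i) * y))) (real (L i) * \<theta>)))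
        \<le> (if \<bar>\<theta>\<bar> \<le> y then exp (- c * \<theta>\<^sup>2 * y powr (k 0 - 2)) else y powr (\<mu> + 2))" by blast
      have "exp (- dev y \<theta>) \<le> exp (- (\<Sum>i\<in>T. lfac (exp (- (real (L i) * y))) (real (L i) * \<theta>)))"
        using dev_ge[OF elim(2) T(1)] by simp
      then show "exp (- dev y \<theta>) \<le> (if \<bar>\<theta>\<bar> \<le> y then exp (- c * \<theta>\<^sup>2 * y powr (k 0 - 2)) else y powr (\<mu> + 2))"
        using T(2) by (rule order_trans)
    qed
  qed
  then show ?thesis using that dc by blast
qed

end

lemma cos_eq_1_small:
  assumes "cos x = 1" "\<bar>x\<bar> \<le> pi"
  shows "x = 0"
proof -
  obtain n :: int where n: "x = of_int n * 2 * pi" using assms(1) cos_one_2pi_int by auto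
  then have "\<bar>of_int n\<bar> * (2 * pi) \<le> 1 * pi" using assms(2) by (simp add: abs_mult)
  then have "\<bar>of_int n :: real\<bar> \<le> 1 / 2" using pi_gt_zero by (simp add: field_simps)
  then have "n = 0" by linarith
  then show ?thesis using n by simp
qed

section \<open>Decay at angles away from 0\<close>

context meinardus
begin

lemma exp_neg_sum: "finite T \<Longrightarrow> exp (- (\<Sum>i\<in>T. f i :: real)) = (\<Prod>i\<in>T. exp (- f i))"
  by (simp add: exp_sum flip: sum_negf)

text \<open>At least \<open>\<mu> + 2\<close> elements are chosen whose factors are each of order
  \<open>y\<close> by \<open>exp_lfac_le\<close>; by continuity the same finitely many elements
  serve for all nearby angles.\<close>

lemma dev_far_infinite:
  assumes inf: "infinite {i. cos (real (L i) * \<theta>\<^sub>0) \<noteq> 1}"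
  obtains d C where "d > 0" "C \<ge> 0"
    "eventually (\<lambda>y. \<forall>\<theta>. \<bar>\<theta> - \<theta>\<^sub>0\<bar> < d \<longrightarrow> exp (- dev y \<theta>) \<le> C * y powr (\<mu> + 2)) (at_right 0)"
proof -
  define n where "n = nat \<lceil>\<mu> + 2\<rceil>"
  have n: "\<mu> + 2 \<le> real n" using mu_pos by (simp add: n_def)
  obtain T where T: "finite T" "card T = n" "T \<subseteq> {i. cos (real (L i) * \<theta>\<^sub>0) \<noteq> 1}"
    using infinite_arbitrarily_large[OF inf, of n] by blast
  \<comment> \<open>Half the value at \<open>\<theta>\<^sub>0\<close>, so that
    \<open>1 - cos\<close> stays above it in a neighbourhood.\<close>
  define \<kappa> where "\<kappa> = (\<lambda>i. (1 - cos (real (L i) * \<theta>\<^sub>0)) / 2)"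
  have \<kappa>: "\<kappa> i > 0" if "i \<in> T" for i
    using T(3) that by (auto simp: \<kappa>_def less_le)
  have "eventually (\<lambda>\<theta>. \<forall>i\<in>T. \<kappa> i < 1 - cos (real (L i) * \<theta>)) (nhds \<theta>\<^sub>0)"
  proof (intro eventually_ball_finite[OF T(1)] ballI)
    fix i assume i: "i \<in> T"
    have "((\<lambda>\<theta>. 1 - cos (real (L i) * \<theta>)) \<longlongrightarrow> 1 - cos (real (L i) * \<theta>\<^sub>0)) (nhds \<theta>\<^sub>0)"
      by (intro tendsto_intros filterlim_ident)
    then show "eventually (\<lambda>\<theta>. \<kappa> i < 1 - cos (real (L i) * \<theta>)) (nhds \<theta>\<^sub>0)"
      by (rule order_tendstoD(1)) (use \<kappa>[OF i] in \<open>simp add: \<kappa>_def\<close>)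
  qed
  then obtain d where d: "d > 0" "\<And>\<theta>. dist \<theta> \<theta>\<^sub>0 < d \<Longrightarrow> \<forall>i\<in>T. \<kappa> i < 1 - cos (real (L i) * \<theta>)"
    unfolding eventually_nhds_metric by blast
  define C where "C = (\<Prod>i\<in>T. real (L i) * sqrt (3 / (2 * \<kappa> i)))"
  have C: "C \<ge> 0" unfolding C_def by (intro prod_nonneg) (auto intro!: mult_nonneg_nonneg dest: \<kappa> less_imp_le)
  have "eventually (\<lambda>y. \<forall>i\<in>T. real (L i) * y \<le> 1) (at_right 0)"
    by (intro eventually_ball_finite[OF T(1)] ballI) real_asymp
  moreover have "eventually (\<lambda>y::real. y \<in> {0<..<1}) (at_right 0)"
    by (rule eventually_at_right_real) simp
  ultimately have "eventually (\<lambda>y. \<forall>\<theta>. \<bar>\<theta> - \<theta>\<^sub>0\<bar> < d \<longrightarrow> exp (- dev y \<theta>) \<le> C * y powr (\<mu> + 2)) (at_right 0)"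
  proof eventually_elim
    case (elim y)
    then have y: "y > 0" "y < 1" by auto
    show ?case
    proof (intro allI impI)
      fix \<theta> assume "\<bar>\<theta> - \<theta>\<^sub>0\<bar> < d"
      with d(2)[of \<theta>] have k: "\<And>i. i \<in> T \<Longrightarrow> \<kappa> i < 1 - cos (real (L i) * \<theta>)" by (simp add: dist_real_def)
      have "exp (- dev y \<theta>) \<le> exp (- (\<Sum>i\<in>T. lfac (exp (- (real (L i) * y))) (real (L i) * \<theta>)))"
        using dev_ge[OF y(1) T(1)] by simp
      also have "\<dots> = (\<Prod>i\<in>T. exp (- lfac (exp (- (real (L i) * y))) (real (L i) * \<theta>)))"
        by (rule exp_neg_sum[OF T(1)])
      also have "\<dots> \<le> (\<Prod>i\<in>T. real (L i) * sqrt (3 / (2 * \<kappa> i)) * y)"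
      proof (intro prod_mono conjI)
        fix i assume i: "i \<in> T"
        show "exp (- lfac (exp (- (real (L i) * y))) (real (L i) * \<theta>)) \<le> real (L i) * sqrt (3 / (2 * \<kappa> i)) * y"
          by (rule exp_lfac_le) (use i y k[OF i] \<kappa>[OF i] L_pos[of i] elim in auto)
      qed simp
      also have "\<dots> = C * y ^ n" using T(2) by (simp add: C_def prod.distrib)
      also have "y ^ n = y powr real n" using y by (simp add: powr_realpow)
      also have "C * y powr real n \<le> C * y powr (\<mu> + 2)"
        using y n C by (intro mult_left_mono powr_mono') auto
      finally show "exp (- dev y \<theta>) \<le> C * y powr (\<mu> + 2)" .
    qed
  qed
  then show ?thesis using that d C by blast
qed

text \<open>Here \<open>\<theta>\<^sub>0\<close> is a point at which all but finitely many factors are as large as at \<open>0\<close>. The element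
  \<open>1\<close> of the sequence is among the finitely many exceptions and contributes the factor \<open>y\<close>.\<close>

lemma dev_far_finite:
  assumes fin: "finite {i. cos (real (L i) * \<theta>\<^sub>0) \<noteq> 1}" and one: "L i\<^sub>1 = 1"
    and \<theta>\<^sub>0: "\<theta>\<^sub>0 \<noteq> 0" "\<bar>\<theta>\<^sub>0\<bar> \<le> pi"
  obtains d C c where "d > 0" "C \<ge> 0" "c > 0"
    "eventually (\<lambda>y. \<forall>\<theta>. \<bar>\<theta> - \<theta>\<^sub>0\<bar> < d \<longrightarrow>
       exp (- dev y \<theta>) \<le> C * (y powr (\<mu> + 2) + y * exp (- c * (\<theta> - \<theta>\<^sub>0)\<^sup>2 * y powr (k 0 - 2)))) (at_right 0)"
proof -
  let ?S = "{i. cos (real (L i) * \<theta>\<^sub>0) \<noteq> 1}"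
  have i1: "i\<^sub>1 \<in> ?S" using cos_eq_1_small[of \<theta>\<^sub>0] \<theta>\<^sub>0 one by auto
  obtain \<delta> c where dc: "\<delta> > 0" "c > 0"
    "eventually (\<lambda>y. \<forall>\<psi>. \<bar>\<psi>\<bar> \<le> \<delta> \<longrightarrow> (\<exists>T. finite T \<and> T \<inter> ?S = {} \<and>
       exp (- (\<Sum>i\<in>T. lfac (exp (- (real (L i) * y))) (real (L i) * \<psi>)))
        \<le> (if \<bar>\<psi>\<bar> \<le> y then exp (- c * \<psi>\<^sup>2 * y powr (k 0 - 2)) else y powr (\<mu> + 2)))) (at_right 0)"
    using near_bound[OF fin] by blast
  define \<kappa> where "\<kappa> = (1 - cos \<theta>\<^sub>0) / 2"
  have \<kappa>: "\<kappa> > 0" using i1 one by (simp add: \<kappa>_def less_le)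
  have "((\<lambda>\<theta>. 1 - cos \<theta>) \<longlongrightarrow> 1 - cos \<theta>\<^sub>0) (nhds \<theta>\<^sub>0)"
    by (intro tendsto_intros filterlim_ident)
  then have "eventually (\<lambda>\<theta>. \<kappa> < 1 - cos \<theta>) (nhds \<theta>\<^sub>0)"
    by (rule order_tendstoD(1)) (use \<kappa> in \<open>simp add: \<kappa>_def\<close>)
  then obtain e where e: "e > 0" "\<And>\<theta>. dist \<theta> \<theta>\<^sub>0 < e \<Longrightarrow> \<kappa> < 1 - cos \<theta>"
    unfolding eventually_nhds_metric by blast
  define C where "C = sqrt (3 / (2 * \<kappa>))"
  have C: "C \<ge> 0" using \<kappa> by (simp add: C_def)
  have "eventually (\<lambda>y. \<forall>\<theta>. \<bar>\<theta> - \<theta>\<^sub>0\<bar> < min \<delta> e \<longrightarrow>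
       exp (- dev y \<theta>) \<le> C * (y powr (\<mu> + 2) + y * exp (- c * (\<theta> - \<theta>\<^sub>0)\<^sup>2 * y powr (k 0 - 2)))) (at_right 0)"
    using dc(3) eventually_at_right_real[OF zero_less_one]
  proof eventually_elim
    case (elim y)
    then have y: "y > 0" "y < 1" by auto
    show ?case
    proof (intro allI impI)
      fix \<theta> assume \<theta>: "\<bar>\<theta> - \<theta>\<^sub>0\<bar> < min \<delta> e"
      define \<psi> where "\<psi> = \<theta> - \<theta>\<^sub>0"
      define B where "B = (if \<bar>\<psi>\<bar> \<le> y then exp (- c * \<psi>\<^sup>2 * y powr (k 0 - 2)) else y powr (\<mu> + 2))"
      have "\<bar>\<psi>\<bar> \<le> \<delta>" using \<theta> by (simp add: \<psi>_def)
      with elim(1) obtain T where T: "finite T" "T \<inter> ?S = {}"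
        "exp (- (\<Sum>i\<in>T. lfac (exp (- (real (L i) * y))) (real (L i) * \<psi>))) \<le> B"
        unfolding B_def by blast
      \<comment> \<open>For these positions \<open>L i * \<theta>\<^sub>0\<close> is a multiple of
        \<open>2 * pi\<close> and drops out.\<close>
      have per: "lfac \<rho> (real (L i) * \<theta>) = lfac \<rho> (real (L i) * \<psi>)" if "i \<in> T" for i \<rho>
      proof -
        have c1: "cos (real (L i) * \<theta>\<^sub>0) = 1" using T(2) that by auto
        then have "sin (real (L i) * \<theta>\<^sub>0) = 0" using cos_one_sin_zero by blast
        then have "cos (real (L i) * \<theta>) = cos (real (L i) * \<psi>)"
          using c1 cos_add[of "real (L i) * \<psi>" "real (L i) * \<theta>\<^sub>0"] by (simp add: \<psi>_def algebra_simps)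
        then show ?thesis by (simp add: lfac_def)
      qed
      have f1: "exp (- lfac (exp (- (1 * y))) \<theta>) \<le> 1 * C * y"
        unfolding C_def by (rule exp_lfac_le) (use y \<kappa> e(2)[of \<theta>] \<theta> in \<open>auto simp: dist_real_def\<close>)
      have "exp (- dev y \<theta>) \<le> exp (- (\<Sum>i\<in>insert i\<^sub>1 T. lfac (exp (- (real (L i) * y))) (real (L i) * \<theta>)))"
        using dev_ge[OF y(1), of "insert i\<^sub>1 T"] T(1) by simp
      also have "(\<Sum>i\<in>insert i\<^sub>1 T. lfac (exp (- (real (L i) * y))) (real (L i) * \<theta>))
         = lfac (exp (- (1 * y))) \<theta> + (\<Sum>i\<in>T. lfac (exp (- (real (L i) * y))) (real (L i) * \<theta>))"
      proof -
        have "i\<^sub>1 \<notin> T" using T(2) i1 by blast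
        then show ?thesis using T(1) one by simp
      qed
      also have "(\<Sum>i\<in>T. lfac (exp (- (real (L i) * y))) (real (L i) * \<theta>)) = (\<Sum>i\<in>T. lfac (exp (- (real (L i) * y))) (real (L i) * \<psi>))"
        by (intro sum.cong refl per)
      also have "exp (- (lfac (exp (- (1 * y))) \<theta> + (\<Sum>i\<in>T. lfac (exp (- (real (L i) * y))) (real (L i) * \<psi>))))
        = exp (- lfac (exp (- (1 * y))) \<theta>) * exp (- (\<Sum>i\<in>T. lfac (exp (- (real (L i) * y))) (real (L i) * \<psi>)))"
        by (simp only: minus_add_distrib exp_add)
      also have "\<dots> \<le> (1 * C * y) * B"
        by (intro mult_mono f1 T(3)) (use C y in auto)
      also have "\<dots> = C * (y * B)" by simp
      also have "\<dots> \<le> C * (y powr (\<mu> + 2) + y * exp (- c * \<psi>\<^sup>2 * y powr (k 0 - 2)))"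
      proof (rule mult_left_mono[OF _ C])
        have "y * y powr (\<mu> + 2) \<le> 1 * y powr (\<mu> + 2)" using y by (intro mult_right_mono) auto
        then show "y * B \<le> y powr (\<mu> + 2) + y * exp (- c * \<psi>\<^sup>2 * y powr (k 0 - 2))"
          using y by (auto simp: B_def add_increasing add_increasing2)
      qed
      finally show "exp (- dev y \<theta>) \<le> C * (y powr (\<mu> + 2) + y * exp (- c * (\<theta> - \<theta>\<^sub>0)\<^sup>2 * y powr (k 0 - 2)))"
        by (simp only: \<psi>_def)
    qed
  qed
  then show ?thesis using that[of "min \<delta> e" C c] dc e C by simp
qed

text \<open>Compactness reduces the remaining angles to finitely many neighbourhoods. Both kinds of
  local bound are brought to one form, a Gaussian peak with a factor \<open>y\<close> plus a
  negligible power, so that a single sum covers them all.\<close>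

lemma dev_far:
  assumes one: "1 \<in> range L" and \<delta>: "\<delta> > 0"
  obtains X :: "real set" and C c :: "real \<Rightarrow> real" where "finite X" "\<And>x. x \<in> X \<Longrightarrow> C x \<ge> 0" "\<And>x. x \<in> X \<Longrightarrow> c x > 0"
    "eventually (\<lambda>y. \<forall>\<theta>. \<delta> \<le> \<bar>\<theta>\<bar> \<longrightarrow> \<bar>\<theta>\<bar> \<le> pi \<longrightarrow>
       exp (- dev y \<theta>) \<le> (\<Sum>x\<in>X. C x * (y powr (\<mu> + 2) + y * exp (- c x * (\<theta> - x)\<^sup>2 * y powr (k 0 - 2))))) (at_right 0)"
proof -
  obtain i\<^sub>1 where i1: "L i\<^sub>1 = 1" using one by auto
  define Q where "Q = {\<theta>::real. \<delta> \<le> \<bar>\<theta>\<bar> \<and> \<bar>\<theta>\<bar> \<le> pi}"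
  define ok where "ok = (\<lambda>x d C c. d > 0 \<and> C \<ge> 0 \<and> c > 0 \<and> eventually (\<lambda>y. \<forall>\<theta>. \<bar>\<theta> - x\<bar> < d \<longrightarrow>
       exp (- dev y \<theta>) \<le> C * (y powr (\<mu> + 2) + y * exp (- c * (\<theta> - x)\<^sup>2 * y powr (k 0 - 2)))) (at_right 0))"
  have ex: "\<exists>d C c. ok x d C c" if x: "x \<in> Q" for x
  proof (cases "finite {i. cos (real (L i) * x) \<noteq> 1}")
    case True
    have "x \<noteq> 0" "\<bar>x\<bar> \<le> pi" using x \<delta> by (auto simp: Q_def)
    then obtain d C c where "d > 0" "C \<ge> 0" "c > 0"
      "eventually (\<lambda>y. \<forall>\<theta>. \<bar>\<theta> - x\<bar> < d \<longrightarrow>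
       exp (- dev y \<theta>) \<le> C * (y powr (\<mu> + 2) + y * exp (- c * (\<theta> - x)\<^sup>2 * y powr (k 0 - 2)))) (at_right 0)"
      by (rule dev_far_finite[OF True i1])
    then show ?thesis unfolding ok_def by blast
  next
    case False
    obtain d C where d: "d > 0" "C \<ge> 0"
      "eventually (\<lambda>y. \<forall>\<theta>. \<bar>\<theta> - x\<bar> < d \<longrightarrow> exp (- dev y \<theta>) \<le> C * y powr (\<mu> + 2)) (at_right 0)"
      by (rule dev_far_infinite[OF False])
    \<comment> \<open>There is no peak in this case; one with rate 1 is added to reach the common
      form.\<close>
    have "eventually (\<lambda>y. \<forall>\<theta>. \<bar>\<theta> - x\<bar> < d \<longrightarrow>
       exp (- dev y \<theta>) \<le> C * (y powr (\<mu> + 2) + y * exp (- 1 * (\<theta> - x)\<^sup>2 * y powr (k 0 - 2)))) (at_right 0)"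
      using d(3) eventually_at_right_less[of "0::real"]
    proof eventually_elim
      case (elim y)
      show ?case
      proof (intro allI impI)
        fix \<theta> assume "\<bar>\<theta> - x\<bar> < d"
        then have "exp (- dev y \<theta>) \<le> C * y powr (\<mu> + 2)" using elim(1) by blast
        also have "\<dots> \<le> C * (y powr (\<mu> + 2) + y * exp (- 1 * (\<theta> - x)\<^sup>2 * y powr (k 0 - 2)))"
          using elim(2) by (intro mult_left_mono d(2)) simp
        finally show "exp (- dev y \<theta>) \<le> C * (y powr (\<mu> + 2) + y * exp (- 1 * (\<theta> - x)\<^sup>2 * y powr (k 0 - 2)))" .
      qed
    qed
    with d(1,2) have "ok x d C 1" unfolding ok_def by simp
    then show ?thesis by blast
  qed
  have "\<forall>x\<in>Q. \<exists>t. ok x (fst t) (fst (snd t)) (snd (snd t))" using ex by force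
  from bchoice[OF this] obtain f where f: "\<forall>x\<in>Q. ok x (fst (f x)) (fst (snd (f x))) (snd (snd (f x)))" by blast
  define d where "d = (\<lambda>x. fst (f x))"
  define C where "C = (\<lambda>x. fst (snd (f x)))"
  define c where "c = (\<lambda>x. snd (snd (f x)))"
  have f: "ok x (d x) (C x) (c x)" if "x \<in> Q" for x
    unfolding d_def C_def c_def using f that by blast
  have dCc: "\<And>x. x \<in> Q \<Longrightarrow> d x > 0" "\<And>x. x \<in> Q \<Longrightarrow> C x \<ge> 0" "\<And>x. x \<in> Q \<Longrightarrow> c x > 0"
    "\<And>x. x \<in> Q \<Longrightarrow> eventually (\<lambda>y. \<forall>\<theta>. \<bar>\<theta> - x\<bar> < d x \<longrightarrow>
       exp (- dev y \<theta>) \<le> C x * (y powr (\<mu> + 2) + y * exp (- c x * (\<theta> - x)\<^sup>2 * y powr (k 0 - 2)))) (at_right 0)"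
    using f unfolding ok_def by blast+
  have cQ: "compact Q"
  proof -
    have "Q = {- pi..- \<delta>} \<union> {\<delta>..pi}" using \<delta> by (auto simp: Q_def abs_if split: if_splits)
    then show ?thesis by (simp add: compact_Un)
  qed
  have cov: "Q \<subseteq> (\<Union>x\<in>Q. ball x (d x))" using dCc(1) by force
  obtain X where X: "X \<subseteq> Q" "finite X" "Q \<subseteq> (\<Union>x\<in>X. ball x (d x))"
    by (rule compactE_image[OF cQ _ cov]) auto
  have "eventually (\<lambda>y. \<forall>x\<in>X. \<forall>\<theta>. \<bar>\<theta> - x\<bar> < d x \<longrightarrow>
       exp (- dev y \<theta>) \<le> C x * (y powr (\<mu> + 2) + y * exp (- c x * (\<theta> - x)\<^sup>2 * y powr (k 0 - 2)))) (at_right 0)"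
    using X dCc(4) by (intro eventually_ball_finite) auto
  then have "eventually (\<lambda>y. \<forall>\<theta>. \<delta> \<le> \<bar>\<theta>\<bar> \<longrightarrow> \<bar>\<theta>\<bar> \<le> pi \<longrightarrow>
       exp (- dev y \<theta>) \<le> (\<Sum>x\<in>X. C x * (y powr (\<mu> + 2) + y * exp (- c x * (\<theta> - x)\<^sup>2 * y powr (k 0 - 2))))) (at_right 0)"
    using eventually_at_right_less[of "0::real"]
  proof eventually_elim
    case (elim y)
    show ?case
    proof (intro allI impI)
      fix \<theta> assume "\<delta> \<le> \<bar>\<theta>\<bar>" "\<bar>\<theta>\<bar> \<le> pi"
      then have "\<theta> \<in> Q" by (simp add: Q_def)
      then obtain x where x: "x \<in> X" "\<bar>\<theta> - x\<bar> < d x"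
        using X(3) by (force simp: dist_real_def abs_minus_commute)
      then have "exp (- dev y \<theta>) \<le> C x * (y powr (\<mu> + 2) + y * exp (- c x * (\<theta> - x)\<^sup>2 * y powr (k 0 - 2)))"
        using elim(1) by blast
      also have "\<dots> \<le> (\<Sum>x\<in>X. C x * (y powr (\<mu> + 2) + y * exp (- c x * (\<theta> - x)\<^sup>2 * y powr (k 0 - 2))))"
        using x X elim(2) dCc(2) by (intro member_le_sum) (auto intro!: mult_nonneg_nonneg add_nonneg_nonneg)
      finally show "exp (- dev y \<theta>) \<le> \<dots>" .
    qed
  qed
  then show ?thesis using that[of X C c] X dCc by blast
qed

end

section \<open>The saddle point method\<close>

text \<open>A rescaled normal density with mean \<open>a\<close> and variance
  \<open>1 / (2 * c)\<close>.\<close>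

lemma gaussian_integral:
  fixes a c :: real
  assumes "c > 0"
  shows "has_bochner_integral lborel (\<lambda>x. exp (- c * (x - a)\<^sup>2)) (sqrt (pi / c))"
proof -
  define \<sigma> where "\<sigma> = sqrt (1 / (2 * c))"
  have \<sigma>: "\<sigma> > 0" "\<sigma>\<^sup>2 = 1 / (2 * c)" using assms by (auto simp: \<sigma>_def)
  have "has_bochner_integral lborel (\<lambda>x. sqrt (pi / c) * normal_density a \<sigma> x) (sqrt (pi / c) * 1)"
    using integrable_normal_density[OF \<sigma>(1), of a] integral_normal_density[OF \<sigma>(1), of a]
    by (intro has_bochner_integral_mult_right) (simp add: has_bochner_integral_iff)
  moreover have "sqrt (pi / c) * normal_density a \<sigma> x = exp (- c * (x - a)\<^sup>2)" for x
    using assms by (simp add: normal_density_def \<sigma>(2) real_sqrt_divide field_simps)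
  ultimately show ?thesis by simp
qed

context theta_seq
begin

text \<open>At the saddle point \<open>mom 1 y = n\<close>, this is the exponent in Cauchy's integral relative to its value at
  angle \<open>0\<close>; its linear Taylor coefficient vanishes.\<close>

definition circ :: "real \<Rightarrow> real \<Rightarrow> complex" where
  "circ y \<theta> = P (of_real (exp (- y)) * cis \<theta>) - of_real (mom 0 y) - \<i> * of_real (mom 1 y * \<theta>)"

lemma norm_exp_circ: "norm (exp (circ y \<theta>)) = exp (- dev y \<theta>)"
  by (simp add: circ_def dev_def)

text \<open>For each \<open>m\<close> the Taylor remainder of \<open>cis\<close> is at most
  \<open>|m * \<theta>|^3 / 6\<close>. Summation with the nonnegative weights of \<open>P\<close>
  turns the powers of \<open>m\<close> into moments.\<close>

lemma circ_taylor:
  assumes y: "y > 0"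
  shows "norm (circ y \<theta> + of_real (mom 2 y * \<theta>\<^sup>2 / 2)) \<le> mom 3 y * \<bar>\<theta>\<bar> ^ 3 / 6"
proof -
  define w where "w = (\<lambda>m. acoef m * exp (- (real m * y)))"
  define f where "f = (\<lambda>m. of_real (w m) * (cis (real m * \<theta>) - 1 - \<i> * of_real (real m * \<theta>) + of_real ((real m * \<theta>)\<^sup>2 / 2)))"
  have "of_real (acoef m) * (of_real (exp (- y)) * cis \<theta>) ^ m = of_real (w m) * cis (real m * \<theta>)" for m
  proof -
    have "exp (- (real m * y)) = exp (- y) ^ m" by (simp flip: exp_of_nat_mult)
    then show ?thesis by (simp add: w_def power_mult_distrib Complex.DeMoivre)
  qed
  moreover have "(\<lambda>m. of_real (acoef m) * (of_real (exp (- y)) * cis \<theta>) ^ m) sums P (of_real (exp (- y)) * cis \<theta>)"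
    by (rule P_sums) (use y in \<open>simp add: norm_mult\<close>)
  ultimately have "(\<lambda>m. of_real (w m) * cis (real m * \<theta>)) sums P (of_real (exp (- y)) * cis \<theta>)" by simp
  moreover have M: "(\<lambda>m. real m ^ j * w m) sums mom j y" for j
    using mom_sums[OF y, of j] by (simp add: w_def mult.assoc)
  ultimately have "(\<lambda>m. of_real (w m) * cis (real m * \<theta>) - of_real (real m ^ 0 * w m) - \<i> * of_real (real m ^ 1 * w m * \<theta>)
      + of_real (real m ^ 2 * w m * (\<theta>\<^sup>2 / 2))) sums
     (P (of_real (exp (- y)) * cis \<theta>) - of_real (mom 0 y) - \<i> * of_real (mom 1 y * \<theta>) + of_real (mom 2 y * (\<theta>\<^sup>2 / 2)))"
    by (intro sums_add sums_diff sums_mult sums_mult2 sums_of_real)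
  then have f: "f sums (circ y \<theta> + of_real (mom 2 y * \<theta>\<^sup>2 / 2))"
    by (simp add: f_def circ_def algebra_simps power_mult_distrib)
  have b: "norm (f m) \<le> real m ^ 3 * w m * (\<bar>\<theta>\<bar> ^ 3 / 6)" for m
  proof -
    have "norm (cis (real m * \<theta>) - 1 - \<i> * of_real (real m * \<theta>) + of_real ((real m * \<theta>)\<^sup>2 / 2)) \<le> \<bar>real m * \<theta>\<bar> ^ 3 / 6"
      using iexp_approx1[of "real m * \<theta>" 2]
      by (simp add: eval_nat_numeral cis_conv_exp algebra_simps)
    moreover have w0: "w m \<ge> 0" by (simp add: w_def acoef_nonneg)
    ultimately have "w m * norm (cis (real m * \<theta>) - 1 - \<i> * of_real (real m * \<theta>) + of_real ((real m * \<theta>)\<^sup>2 / 2)) \<le> w m * (\<bar>real m * \<theta>\<bar> ^ 3 / 6)"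
      by (rule mult_left_mono)
    moreover have "norm (f m) = w m * norm (cis (real m * \<theta>) - 1 - \<i> * of_real (real m * \<theta>) + of_real ((real m * \<theta>)\<^sup>2 / 2))"
      unfolding f_def norm_mult using w0 by simp
    moreover have "w m * (\<bar>real m * \<theta>\<bar> ^ 3 / 6) = real m ^ 3 * w m * (\<bar>\<theta>\<bar> ^ 3 / 6)"
      by (simp add: abs_mult power_mult_distrib)
    ultimately show ?thesis by linarith
  qed
  have S: "(\<lambda>m. real m ^ 3 * w m * (\<bar>\<theta>\<bar> ^ 3 / 6)) sums (mom 3 y * (\<bar>\<theta>\<bar> ^ 3 / 6))"
    by (intro sums_mult2 M)
  have "norm (suminf f) \<le> (\<Sum>m. real m ^ 3 * w m * (\<bar>\<theta>\<bar> ^ 3 / 6))"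
    using S b by (intro norm_suminf_le) (auto simp: sums_iff)
  then show ?thesis using f S by (simp add: sums_iff)
qed

lemma continuous_on_circ: "y > 0 \<Longrightarrow> continuous_on S (circ y)"
proof -
  assume y: "y > 0"
  have "P holomorphic_on ball 0 1"
    by (rule power_series_holomorphic[where a = "\<lambda>m. of_real (acoef m)"]) (use P_sums in simp)
  then have "continuous_on (ball 0 1) P" by (rule holomorphic_on_imp_continuous_on)
  then have "continuous_on S (\<lambda>\<theta>. P (of_real (exp (- y)) * cis \<theta>))"
    by (rule continuous_on_compose2) (use y in \<open>auto intro!: continuous_intros simp: norm_mult\<close>)
  then show ?thesis unfolding circ_def[abs_def] by (intro continuous_intros)
qed

lemma circ_measurable: "y > 0 \<Longrightarrow> (\<lambda>\<theta>. exp (circ y \<theta>)) \<in> borel_measurable borel"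
  by (intro borel_measurable_continuous_onI continuous_intros continuous_on_circ)

text \<open>By the choice of \<open>y\<close>, the factor \<open>cis (- (real n * \<theta>))\<close>
  of Cauchy's formula is exactly the exponential of the linear term subtracted in
  \<open>circ\<close>.\<close>

lemma total_partitions_circ:
  assumes y: "y > 0" "mom 1 y = real n"
  shows "of_real (2 * pi * real (total_partitions L n)) =
    of_real (exp (mom 0 y + real n * y)) * (LBINT \<theta>:{-pi..pi}. exp (circ y \<theta>))"
proof -
  have "exp (P (of_real (exp (- y)) * cis \<theta>)) * cis (- (real n * \<theta>)) = of_real (exp (mom 0 y)) * exp (circ y \<theta>)" for \<theta>
    using y(2) by (simp add: circ_def cis_conv_exp flip: exp_add exp_of_real)
  then have "of_real (2 * pi * (real (total_partitions L n) * exp (- real n * y))) =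
    (of_real (exp (mom 0 y)) :: complex) * (LBINT \<theta>:{-pi..pi}. exp (circ y \<theta>))"
    unfolding total_partitions_integral[OF y(1)] by (simp only: set_integral_mult_right)
  then have "of_real (exp (real n * y)) * (of_real (2 * pi * (real (total_partitions L n) * exp (- real n * y))) :: complex) =
    of_real (exp (real n * y)) * ((of_real (exp (mom 0 y)) :: complex) * (LBINT \<theta>:{-pi..pi}. exp (circ y \<theta>)))" by simp
  moreover have "exp (real n * y) * (2 * pi * (real (total_partitions L n) * exp (- real n * y))) = 2 * pi * real (total_partitions L n)"
    by (simp add: exp_minus)
  ultimately show ?thesis
    by (metis (no_types, lifting) of_real_mult exp_add mult.assoc mult.commute)
qed

end

section \<open>The integral over the circle\<close>

context meinardus
begin

abbreviation "curv \<equiv> (\<mu> + 1) * (\<mu> * zconst)"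

lemma curv_pos: "curv > 0"
  by (intro mult_pos_pos[OF _ mult_pos_pos[OF mu_pos zconst_pos]]) (use mu_pos in simp)

text \<open>The scale is chosen so that its square times the second moment tends to
  \<open>curv\<close>. The cubic error then has order \<open>y powr (\<mu> / 2)\<close> and
  vanishes.\<close>

lemma circ_lim:
  "((\<lambda>y. circ y (y powr (1 + \<mu> / 2) * x)) \<longlongrightarrow> of_real (- (curv / 2) * x\<^sup>2)) (at_right 0)"
proof -
  define s where "s = (\<lambda>y::real. y powr (1 + \<mu> / 2))"
  have ev: "eventually (\<lambda>y::real. y > 0) (at_right 0)" by (rule eventually_at_right_less)
  have s2: "s y ^ 2 = y powr (\<mu> + 2)" and s3: "s y ^ 3 = y powr (\<mu> + 3) * y powr (\<mu> / 2)" if "y > 0" for y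
    using that by (simp_all add: s_def powr_power algebra_simps flip: powr_add)
  have m: "\<mu> > 0" by (rule mu_pos)
  have "((\<lambda>y. mom 3 y * y powr (\<mu> + 3) * y powr (\<mu> / 2) * (\<bar>x\<bar> ^ 3 / 6)) \<longlongrightarrow> (\<mu> + 2) * curv * 0 * (\<bar>x\<bar> ^ 3 / 6)) (at_right 0)"
    by (intro tendsto_mult mom_3_lim tendsto_const) (use m in real_asymp)
  then have z: "((\<lambda>y. mom 3 y * y powr (\<mu> + 3) * y powr (\<mu> / 2) * (\<bar>x\<bar> ^ 3 / 6)) \<longlongrightarrow> 0) (at_right 0)" by simp
  have "((\<lambda>y. circ y (s y * x) + of_real (mom 2 y * (s y * x)\<^sup>2 / 2)) \<longlongrightarrow> 0) (at_right 0)"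
  proof (rule Lim_null_comparison[OF _ z])
    show "eventually (\<lambda>y. norm (circ y (s y * x) + of_real (mom 2 y * (s y * x)\<^sup>2 / 2))
        \<le> mom 3 y * y powr (\<mu> + 3) * y powr (\<mu> / 2) * (\<bar>x\<bar> ^ 3 / 6)) (at_right 0)"
      using ev
    proof eventually_elim
      case (elim y)
      have "mom 3 y * \<bar>s y * x\<bar> ^ 3 / 6 = mom 3 y * s y ^ 3 * (\<bar>x\<bar> ^ 3 / 6)"
        by (simp add: abs_mult power_mult_distrib s_def)
      then show ?case using circ_taylor[OF elim, of "s y * x"] s3[OF elim] by (simp only: mult.assoc)
    qed
  qed
  moreover have "((\<lambda>y. complex_of_real (mom 2 y * y powr (\<mu> + 2) * (x\<^sup>2 / 2))) \<longlongrightarrow> of_real (curv * (x\<^sup>2 / 2))) (at_right 0)"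
    by (intro tendsto_of_real tendsto_mult mom_2_lim tendsto_const)
  ultimately have "((\<lambda>y. circ y (s y * x) + of_real (mom 2 y * (s y * x)\<^sup>2 / 2) - of_real (mom 2 y * y powr (\<mu> + 2) * (x\<^sup>2 / 2)))
     \<longlongrightarrow> 0 - of_real (curv * (x\<^sup>2 / 2))) (at_right 0)"
    by (rule tendsto_diff)
  moreover have "eventually (\<lambda>y. circ y (s y * x) + of_real (mom 2 y * (s y * x)\<^sup>2 / 2) - of_real (mom 2 y * y powr (\<mu> + 2) * (x\<^sup>2 / 2))
     = circ y (s y * x)) (at_right 0)"
    using ev
  proof eventually_elim
    case (elim y)
    have "mom 2 y * (s y * x)\<^sup>2 / 2 = mom 2 y * y powr (\<mu> + 2) * (x\<^sup>2 / 2)"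
      by (simp add: power_mult_distrib s2[OF elim])
    then show ?case by (simp only: add_diff_cancel)
  qed
  ultimately have "((\<lambda>y. circ y (s y * x)) \<longlongrightarrow> 0 - of_real (curv * (x\<^sup>2 / 2))) (at_right 0)"
    by (rule Lim_transform_eventually)
  moreover have "0 - complex_of_real (curv * (x\<^sup>2 / 2)) = of_real (- (curv / 2) * x\<^sup>2)" by simp
  ultimately show ?thesis unfolding s_def by metis
qed

text \<open>After the substitution from \<open>circ_lim\<close> the integrand converges to a
  Gaussian, and the range \<open>|x| <= y powr (- \<mu> / 2)\<close> exhausts the line. The powers
  of \<open>y\<close> in the bound of \<open>dev_near\<close> cancel, which leaves a Gaussian
  majorant independent of \<open>y\<close>.\<close>

lemma near_integral_lim:
  "((\<lambda>y. (LBINT \<theta>:{-y..y}. exp (circ y \<theta>)) / of_real (y powr (1 + \<mu> / 2))) \<longlongrightarrow> of_real (sqrt (2 * pi / curv))) (at_right 0)"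
proof -
  define s where "s = (\<lambda>y::real. y powr (1 + \<mu> / 2))"
  have m: "\<mu> > 0" by (rule mu_pos)
  obtain \<delta> c where dc: "\<delta> > 0" "c > 0" "eventually (\<lambda>y. \<forall>\<theta>. \<bar>\<theta>\<bar> \<le> \<delta> \<longrightarrow> exp (- dev y \<theta>)
       \<le> (if \<bar>\<theta>\<bar> \<le> y then exp (- c * \<theta>\<^sup>2 * y powr (k 0 - 2)) else y powr (\<mu> + 2))) (at_right 0)"
    by (rule dev_near)
  obtain b where b: "b > 0" "b \<le> \<delta>" and bnd: "\<And>y \<theta>. 0 < y \<Longrightarrow> y < b \<Longrightarrow> \<bar>\<theta>\<bar> \<le> y \<Longrightarrow> exp (- dev y \<theta>) \<le> exp (- c * \<theta>\<^sup>2 * y powr (k 0 - 2))"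
  proof -
    obtain b' where b': "b' > 0" "\<And>y. 0 < y \<Longrightarrow> y < b' \<Longrightarrow> \<forall>\<theta>. \<bar>\<theta>\<bar> \<le> \<delta> \<longrightarrow> exp (- dev y \<theta>)
       \<le> (if \<bar>\<theta>\<bar> \<le> y then exp (- c * \<theta>\<^sup>2 * y powr (k 0 - 2)) else y powr (\<mu> + 2))"
      using dc(3) unfolding eventually_at_right_field by blast
    have "exp (- dev y \<theta>) \<le> exp (- c * \<theta>\<^sup>2 * y powr (k 0 - 2))" if "0 < y" "y < min b' \<delta>" "\<bar>\<theta>\<bar> \<le> y" for y \<theta>
    proof -
      have "y < b'" "\<bar>\<theta>\<bar> \<le> \<delta>" using that by auto
      then have "exp (- dev y \<theta>) \<le> (if \<bar>\<theta>\<bar> \<le> y then exp (- c * \<theta>\<^sup>2 * y powr (k 0 - 2)) else y powr (\<mu> + 2))"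
        using b'(2) that(1) by blast
      then show ?thesis using that(3) by (simp only: if_True)
    qed
    then show ?thesis using that[of "min b' \<delta>"] b'(1) dc(1) by simp
  qed
  define g where "g = (\<lambda>y x. indicator {-y..y} (s y * x) *\<^sub>R exp (circ y (s y * x)))"
  have scale: "(LBINT \<theta>:{-y..y}. exp (circ y \<theta>)) / of_real (s y) = integral\<^sup>L lborel (g y)" if "y > 0" for y
  proof -
    have sy: "s y > 0" using that by (simp add: s_def)
    then have "(LBINT \<theta>:{-y..y}. exp (circ y \<theta>)) = s y *\<^sub>R integral\<^sup>L lborel (g y)"
      unfolding set_lebesgue_integral_def g_def
      using lborel_integral_real_affine[of "s y" "\<lambda>\<theta>. indicator {-y..y} \<theta> *\<^sub>R exp (circ y \<theta>)" 0] by simp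
    then show ?thesis using sy by (simp add: scaleR_conv_of_real)
  qed
  have pw: "((\<lambda>y. g y x) \<longlongrightarrow> exp (of_real (- (curv / 2) * x\<^sup>2))) (at_right 0)" for x
  proof -
    have "((\<lambda>y. exp (circ y (s y * x))) \<longlongrightarrow> exp (of_real (- (curv / 2) * x\<^sup>2))) (at_right 0)"
      unfolding s_def by (intro tendsto_exp circ_lim)
    moreover have "((\<lambda>y. y powr (\<mu> / 2) * \<bar>x\<bar>) \<longlongrightarrow> 0 * \<bar>x\<bar>) (at_right 0)"
      by (intro tendsto_mult tendsto_const) (use m in real_asymp)
    then have "eventually (\<lambda>y. y powr (\<mu> / 2) * \<bar>x\<bar> < 1) (at_right 0)"
      by (rule order_tendstoD) simp
    then have "eventually (\<lambda>y. exp (circ y (s y * x)) = g y x) (at_right 0)"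
      using eventually_at_right_less[of "0::real"]
    proof eventually_elim
      case (elim y)
      have "\<bar>s y * x\<bar> = y * (y powr (\<mu> / 2) * \<bar>x\<bar>)"
        using elim(2) powr_add[of y 1 "\<mu> / 2"] by (simp add: s_def abs_mult)
      also have "\<dots> \<le> y * 1" using elim by (intro mult_left_mono) auto
      finally have "s y * x \<in> {-y..y}" by auto
      then show ?case by (simp add: g_def)
    qed
    ultimately show ?thesis by (rule Lim_transform_eventually)
  qed
  have "((\<lambda>y. integral\<^sup>L lborel (g y)) \<longlongrightarrow> integral\<^sup>L lborel (\<lambda>x. exp (of_real (- (curv / 2) * x\<^sup>2)))) (at_right 0)"
  proof (rule tendsto_at_right_sequentially[OF b(1)])
    fix S :: "nat \<Rightarrow> real"
    assume S: "\<And>n. 0 < S n" "\<And>n. S n < b" "decseq S" "S \<longlonglongrightarrow> 0"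
    have S0: "filterlim S (at_right 0) sequentially"
      by (rule tendsto_imp_filterlim_at_right[OF S(4)]) (use S(1) in simp)
    show "(\<lambda>n. integral\<^sup>L lborel (g (S n))) \<longlonglongrightarrow> integral\<^sup>L lborel (\<lambda>x. exp (of_real (- (curv / 2) * x\<^sup>2)))"
    proof (rule integral_dominated_convergence[where w = "\<lambda>x. exp (- c * x\<^sup>2)"])
      show "integrable lborel (\<lambda>x. exp (- c * x\<^sup>2))"
        using gaussian_integral[OF dc(2), of 0] by (simp add: has_bochner_integral_iff)
      show "g (S n) \<in> borel_measurable lborel" for n
      proof -
        have "(\<lambda>x. exp (circ (S n) (s (S n) * x))) \<in> borel_measurable lborel"
          by (rule measurable_compose[OF _ circ_measurable[OF S(1)]]) simp
        moreover have "(\<lambda>x. indicat_real {- S n..S n} (s (S n) * x)) \<in> borel_measurable lborel"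
          by measurable
        ultimately show ?thesis unfolding g_def by (rule borel_measurable_scaleR[rotated])
      qed
      show "AE x in lborel. (\<lambda>n. g (S n) x) \<longlonglongrightarrow> exp (of_real (- (curv / 2) * x\<^sup>2))"
        by (intro AE_I2 filterlim_compose[OF pw S0])
      show "AE x in lborel. norm (g (S n) x) \<le> exp (- c * x\<^sup>2)" for n
      proof (rule AE_I2)
        fix x
        show "norm (g (S n) x) \<le> exp (- c * x\<^sup>2)"
        proof (cases "s (S n) * x \<in> {- S n..S n}")
          case True
          then have "exp (- dev (S n) (s (S n) * x)) \<le> exp (- c * (s (S n) * x)\<^sup>2 * S n powr (k 0 - 2))"
            by (intro bnd S) auto
          moreover have "s (S n) ^ 2 = S n powr (\<mu> + 2)"
            using S(1)[of n] by (simp add: s_def powr_power algebra_simps)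
          then have "c * (s (S n) * x)\<^sup>2 * S n powr (k 0 - 2) = c * x\<^sup>2 * (S n powr (\<mu> + 2) * S n powr (k 0 - 2))"
            by (simp add: power_mult_distrib)
          moreover have "S n powr (\<mu> + 2) * S n powr (k 0 - 2) = 1"
            using S(1)[of n] by (simp flip: powr_add)
          ultimately show ?thesis using True by (simp add: g_def norm_exp_circ del: norm_exp_eq_Re)
        qed (simp add: g_def)
      qed
    qed auto
  qed
  moreover have "integral\<^sup>L lborel (\<lambda>x. exp (complex_of_real (- (curv / 2) * x\<^sup>2))) = of_real (sqrt (2 * pi / curv))"
  proof -
    have "integral\<^sup>L lborel (\<lambda>x. exp (- (curv / 2) * (x - 0)\<^sup>2)) = sqrt (pi / (curv / 2))"
      using gaussian_integral[of "curv / 2" 0] curv_pos by (simp only: has_bochner_integral_iff half_gt_zero)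
    then have "integral\<^sup>L lborel (\<lambda>x. complex_of_real (exp (- (curv / 2) * x\<^sup>2))) = of_real (sqrt (2 * pi / curv))"
      by (subst integral_complex_of_real) (simp add: mult.commute)
    then show ?thesis by (simp only: exp_of_real)
  qed
  ultimately have "((\<lambda>y. integral\<^sup>L lborel (g y)) \<longlongrightarrow> of_real (sqrt (2 * pi / curv))) (at_right 0)" by simp
  moreover have "eventually (\<lambda>y. integral\<^sup>L lborel (g y) = (LBINT \<theta>:{-y..y}. exp (circ y \<theta>)) / of_real (y powr (1 + \<mu> / 2))) (at_right 0)"
    using eventually_at_right_less[of "0::real"] by eventually_elim (simp only: scale[symmetric] s_def)
  ultimately show ?thesis by (rule Lim_transform_eventually)
qed

text \<open>The bounding peaks at other angles have width of the same order as the central one, and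
  the factor \<open>y\<close> makes their contribution smaller by one order. The bound
  \<open>y powr (\<mu> + 2)\<close>, divided by the scale, still tends to 0.\<close>

lemma far_integral_lim:
  assumes one: "1 \<in> range L"
  shows "((\<lambda>y. (LBINT \<theta>:{-pi..pi} - {-y..y}. exp (circ y \<theta>)) / of_real (y powr (1 + \<mu> / 2))) \<longlongrightarrow> 0) (at_right 0)"
proof -
  obtain \<delta> c\<^sub>0 where dc: "\<delta> > 0" "c\<^sub>0 > 0" "eventually (\<lambda>y. \<forall>\<theta>. \<bar>\<theta>\<bar> \<le> \<delta> \<longrightarrow> exp (- dev y \<theta>)
       \<le> (if \<bar>\<theta>\<bar> \<le> y then exp (- c\<^sub>0 * \<theta>\<^sup>2 * y powr (k 0 - 2)) else y powr (\<mu> + 2))) (at_right 0)"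
    by (rule dev_near)
  obtain X :: "real set" and C c :: "real \<Rightarrow> real" where X: "finite X" "\<And>x. x \<in> X \<Longrightarrow> C x \<ge> 0" "\<And>x. x \<in> X \<Longrightarrow> c x > 0"
    "eventually (\<lambda>y. \<forall>\<theta>. \<delta> \<le> \<bar>\<theta>\<bar> \<longrightarrow> \<bar>\<theta>\<bar> \<le> pi \<longrightarrow>
       exp (- dev y \<theta>) \<le> (\<Sum>x\<in>X. C x * (y powr (\<mu> + 2) + y * exp (- c x * (\<theta> - x)\<^sup>2 * y powr (k 0 - 2))))) (at_right 0)"
    using dev_far[OF one dc(1)] by blast
  have m: "\<mu> > 0" by (rule mu_pos)
  let ?I = "\<lambda>\<theta>::real. indicat_real {-pi..pi} \<theta>"
  \<comment> \<open>The Gaussian peaks are integrated over the whole line; the constant parts carry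
    an indicator to remain integrable.\<close>
  define h where "h = (\<lambda>y \<theta>. ?I \<theta> * y powr (\<mu> + 2)
    + (\<Sum>x\<in>X. C x * (?I \<theta> * y powr (\<mu> + 2) + y * exp (- (c x * y powr (k 0 - 2)) * (\<theta> - x)\<^sup>2))))"
  define r where "r = (\<lambda>y. 2 * pi * y powr (\<mu> + 2)
    + (\<Sum>x\<in>X. C x * (2 * pi * y powr (\<mu> + 2) + y * sqrt (pi / (c x * y powr (k 0 - 2))))))"
  have h: "has_bochner_integral lborel (h y) (r y)" if "y > 0" for y
  proof -
    have "has_bochner_integral lborel ?I (2 * pi)"
      using has_bochner_integral_real_indicator[of "{-pi..pi}" lborel] by simp
    then show ?thesis unfolding h_def r_def
      using that X(3)
      by (intro has_bochner_integral_add has_bochner_integral_sum has_bochner_integral_mult_right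
          has_bochner_integral_mult_left gaussian_integral) auto
  qed
  have "((\<lambda>y. 2 * pi * y powr (\<mu> / 2 + 1) + (\<Sum>x\<in>X. C x * (2 * pi * y powr (\<mu> / 2 + 1) + y * sqrt (pi / c x)))) \<longlongrightarrow>
      2 * pi * 0 + (\<Sum>x\<in>X. C x * (2 * pi * 0 + 0 * sqrt (pi / c x)))) (at_right 0)"
    by (intro tendsto_intros) (use m in real_asymp)+
  then have lim: "((\<lambda>y. 2 * pi * y powr (\<mu> / 2 + 1) + (\<Sum>x\<in>X. C x * (2 * pi * y powr (\<mu> / 2 + 1) + y * sqrt (pi / c x)))) \<longlongrightarrow> 0) (at_right 0)"
    by simp
  show ?thesis
  proof (rule Lim_null_comparison[OF _ lim])
    show "eventually (\<lambda>y. norm ((LBINT \<theta>:{-pi..pi} - {-y..y}. exp (circ y \<theta>)) / of_real (y powr (1 + \<mu> / 2)))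
      \<le> 2 * pi * y powr (\<mu> / 2 + 1) + (\<Sum>x\<in>X. C x * (2 * pi * y powr (\<mu> / 2 + 1) + y * sqrt (pi / c x)))) (at_right 0)"
      using dc(3) X(4) eventually_at_right_less[of "0::real"]
    proof eventually_elim
      case (elim y)
      define S where "S = (\<lambda>\<theta>. \<Sum>x\<in>X. C x * (y powr (\<mu> + 2) + y * exp (- c x * (\<theta> - x)\<^sup>2 * y powr (k 0 - 2))))"
      have S0: "S \<theta> \<ge> 0" for \<theta>
        unfolding S_def using X(2) elim(3) by (intro sum_nonneg mult_nonneg_nonneg add_nonneg_nonneg) auto
      let ?g = "\<lambda>\<theta>. indicator ({-pi..pi} - {-y..y}) \<theta> *\<^sub>R exp (circ y \<theta>)"
      have gh: "norm (?g \<theta>) \<le> h y \<theta>" for \<theta>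
      proof (cases "\<theta> \<in> {-pi..pi} - {-y..y}")
        case True
        then have t: "\<bar>\<theta>\<bar> \<le> pi" "\<not> \<bar>\<theta>\<bar> \<le> y" "\<theta> \<in> {-pi..pi}" by auto
        have "exp (- dev y \<theta>) \<le> y powr (\<mu> + 2) + S \<theta>"
        proof (cases "\<bar>\<theta>\<bar> \<le> \<delta>")
          case True
          with elim(1) have "exp (- dev y \<theta>) \<le> (if \<bar>\<theta>\<bar> \<le> y then exp (- c\<^sub>0 * \<theta>\<^sup>2 * y powr (k 0 - 2)) else y powr (\<mu> + 2))"
            by blast
          then have "exp (- dev y \<theta>) \<le> y powr (\<mu> + 2)" using t(2) by (simp only: if_False)
          then show ?thesis using S0[of \<theta>] by simp
        next
          case False
          then have "exp (- dev y \<theta>) \<le> S \<theta>" using elim(2) t(1) unfolding S_def by simp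
          moreover have "y powr (\<mu> + 2) \<ge> 0" by simp
          ultimately show ?thesis by linarith
        qed
        also have "\<dots> = h y \<theta>" using t(3) by (simp add: h_def S_def mult_ac)
        finally show ?thesis using True by (simp add: norm_exp_circ del: norm_exp_eq_Re)
      next
        case False
        have "h y \<theta> \<ge> 0"
          unfolding h_def using X(2) elim(3) by (intro add_nonneg_nonneg sum_nonneg mult_nonneg_nonneg) auto
        then show ?thesis using False by simp
      qed
      have gi: "integrable lborel ?g"
      proof (rule Bochner_Integration.integrable_bound[of lborel "h y"])
        show "?g \<in> borel_measurable lborel"
          using circ_measurable[OF elim(3)] by (intro borel_measurable_scaleR borel_measurable_indicator) auto
        show "AE \<theta> in lborel. norm (?g \<theta>) \<le> norm (h y \<theta>)"
          by (rule AE_I2, rule order_trans[OF gh]) simp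
      qed (use h[OF elim(3)] in \<open>simp add: has_bochner_integral_iff\<close>)
      have "norm (LBINT \<theta>:{-pi..pi} - {-y..y}. exp (circ y \<theta>)) \<le> r y"
        using Bochner_Integration.integral_norm_bound_integral[OF gi, of "h y"] h[OF elim(3)] gh
        by (simp add: has_bochner_integral_iff set_lebesgue_integral_def)
      then have "norm ((LBINT \<theta>:{-pi..pi} - {-y..y}. exp (circ y \<theta>)) / of_real (y powr (1 + \<mu> / 2))) \<le> r y / y powr (1 + \<mu> / 2)"
        using elim(3) by (simp add: norm_divide divide_right_mono)
      also have "r y = (2 * pi * y powr (\<mu> / 2 + 1) + (\<Sum>x\<in>X. C x * (2 * pi * y powr (\<mu> / 2 + 1) + y * sqrt (pi / c x)))) * y powr (1 + \<mu> / 2)"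
      proof -
        have a: "y powr (\<mu> + 2) = y powr (\<mu> / 2 + 1) * y powr (1 + \<mu> / 2)" by (simp flip: powr_add)
        have "1 / y powr (k 0 - 2) = (y powr (1 + \<mu> / 2))\<^sup>2"
          using elim(3) by (simp add: powr_power powr_minus_divide[symmetric] algebra_simps)
        then have "pi / (c x * y powr (k 0 - 2)) = pi / c x * (y powr (1 + \<mu> / 2))\<^sup>2" for x
          using times_divide_times_eq[of pi "c x" 1 "y powr (k 0 - 2)"] by simp
        then have "sqrt (pi / (c x * y powr (k 0 - 2))) = sqrt (pi / c x) * y powr (1 + \<mu> / 2)" for x
          by (simp only: real_sqrt_mult real_sqrt_abs abs_of_nonneg[OF powr_ge_zero])
        then show ?thesis unfolding r_def a by (simp add: algebra_simps sum_distrib_left)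
      qed
      also have "\<dots> / y powr (1 + \<mu> / 2) = 2 * pi * y powr (\<mu> / 2 + 1) + (\<Sum>x\<in>X. C x * (2 * pi * y powr (\<mu> / 2 + 1) + y * sqrt (pi / c x)))"
        using elim(3) by simp
      finally show ?case .
    qed
  qed
qed

lemma circ_integral_lim:
  assumes "1 \<in> range L"
  shows "((\<lambda>y. (LBINT \<theta>:{-pi..pi}. exp (circ y \<theta>)) / of_real (y powr (1 + \<mu> / 2))) \<longlongrightarrow> of_real (sqrt (2 * pi / curv))) (at_right 0)"
proof -
  have "((\<lambda>y. (LBINT \<theta>:{-y..y}. exp (circ y \<theta>)) / of_real (y powr (1 + \<mu> / 2))
      + (LBINT \<theta>:{-pi..pi} - {-y..y}. exp (circ y \<theta>)) / of_real (y powr (1 + \<mu> / 2))) \<longlongrightarrow> of_real (sqrt (2 * pi / curv)) + 0) (at_right 0)"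
    by (intro tendsto_add near_integral_lim far_integral_lim assms)
  moreover have "eventually (\<lambda>y. (LBINT \<theta>:{-y..y}. exp (circ y \<theta>)) / of_real (y powr (1 + \<mu> / 2))
      + (LBINT \<theta>:{-pi..pi} - {-y..y}. exp (circ y \<theta>)) / of_real (y powr (1 + \<mu> / 2))
      = (LBINT \<theta>:{-pi..pi}. exp (circ y \<theta>)) / of_real (y powr (1 + \<mu> / 2))) (at_right 0)"
    using eventually_at_right_real[OF pi_gt_zero]
  proof eventually_elim
    case (elim y)
    then have y: "y > 0" "y < pi" by auto
    have I: "set_integrable lborel {-pi..pi} (\<lambda>\<theta>. exp (circ y \<theta>))"
      by (intro borel_integrable_atLeastAtMost' continuous_intros continuous_on_circ y)
    have "(LBINT \<theta>:{-y..y} \<union> ({-pi..pi} - {-y..y}). exp (circ y \<theta>)) =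
      (LBINT \<theta>:{-y..y}. exp (circ y \<theta>)) + (LBINT \<theta>:{-pi..pi} - {-y..y}. exp (circ y \<theta>))"
      by (intro set_integral_Un set_integrable_subset[OF I]) (use y in auto)
    moreover have "{-y..y} \<union> ({-pi..pi} - {-y..y}) = {-pi..pi}" using y by auto
    ultimately show ?case by (simp add: add_divide_distrib)
  qed
  ultimately have "((\<lambda>y. (LBINT \<theta>:{-pi..pi}. exp (circ y \<theta>)) / of_real (y powr (1 + \<mu> / 2))) \<longlongrightarrow> of_real (sqrt (2 * pi / curv)) + 0) (at_right 0)"
    by (rule Lim_transform_eventually)
  then show ?thesis by simp
qed

text \<open>\<open>mom 1\<close> is continuous and tends to infinity at 0, so the intermediate value
  theorem gives a solution for all large \<open>n\<close>. Since \<open>mom 1\<close> is monotone,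
  \<open>mom 1 e < n\<close> forces \<open>Y n < e\<close>.\<close>

lemma saddle_points:
  obtains Y :: "nat \<Rightarrow> real" where "eventually (\<lambda>n. Y n > 0 \<and> mom 1 (Y n) = real n) sequentially"
    "filterlim Y (at_right 0) sequentially"
proof -
  have m: "\<mu> > 0" by (rule mu_pos)
  have w: "\<mu> * zconst > 0" by (rule mult_pos_pos[OF m zconst_pos])
  have "filterlim (\<lambda>y::real. y powr (- (\<mu> + 1))) at_top (at_right 0)" using m by real_asymp
  from filterlim_tendsto_pos_mult_at_top[OF mom_1_lim w this]
  have "filterlim (\<lambda>y. mom 1 y * y powr (\<mu> + 1) * y powr (- (\<mu> + 1))) at_top (at_right 0)" .
  moreover have "eventually (\<lambda>y. mom 1 y * y powr (\<mu> + 1) * y powr (- (\<mu> + 1)) = mom 1 y) (at_right 0)"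
    using eventually_at_right_less[of "0::real"] by eventually_elim (simp add: mult.assoc flip: powr_add)
  ultimately have top: "filterlim (mom 1) at_top (at_right 0)"
    by (subst filterlim_cong[OF refl refl, symmetric])
  have ex: "\<exists>y. 0 < y \<and> mom 1 y = real n" if n: "real n \<ge> mom 1 1" for n
  proof -
    have "eventually (\<lambda>y. mom 1 y \<ge> real n) (at_right 0)"
      using top by (simp add: filterlim_at_top)
    moreover have "eventually (\<lambda>y::real. y \<in> {0<..<1}) (at_right 0)"
      by (rule eventually_at_right_real) simp
    ultimately have "eventually (\<lambda>y. mom 1 y \<ge> real n \<and> y \<in> {0<..<1}) (at_right 0)"
      by (rule eventually_conj)
    then obtain x where x: "mom 1 x \<ge> real n" "0 < x" "x < 1"
      using eventually_happens'[OF trivial_limit_at_right_real] by fastforce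
    have "continuous_on {x..1} (mom 1)"
      using x by (intro continuous_at_imp_continuous_on ballI DERIV_isCont[OF mom_deriv]) auto
    then obtain y where "y \<ge> x" "mom 1 y = real n"
      using IVT2'[of "mom 1" 1 "real n" x] x n by auto
    then show ?thesis using x by (intro exI[of _ y]) auto
  qed
  define Y where "Y = (\<lambda>n. SOME y. 0 < y \<and> mom 1 y = real n)"
  have Y: "Y n > 0 \<and> mom 1 (Y n) = real n" if "real n \<ge> mom 1 1" for n
    unfolding Y_def using someI_ex[OF ex[OF that]] .
  have ev: "eventually (\<lambda>n. real n \<ge> mom 1 1) sequentially"
    using filterlim_real_sequentially unfolding filterlim_at_top by blast
  then have Yev: "eventually (\<lambda>n. Y n > 0 \<and> mom 1 (Y n) = real n) sequentially"
    by eventually_elim (rule Y)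
  have "Y \<longlonglongrightarrow> 0"
  proof (rule order_tendstoI)
    fix e :: real assume e: "0 < e"
    have "eventually (\<lambda>n. real n > mom 1 e) sequentially"
      using filterlim_real_sequentially unfolding filterlim_at_top_dense by blast
    then show "eventually (\<lambda>n. Y n < e) sequentially"
      using Yev
    proof eventually_elim
      case (elim n)
      then show ?case using mom_antimono[of e "Y n" 1] e by (cases "Y n < e") auto
    qed
  next
    fix e :: real assume "e < 0"
    then show "eventually (\<lambda>n. e < Y n) sequentially" using Yev by (auto elim!: eventually_mono)
  qed
  then have "filterlim Y (at_right 0) sequentially"
    by (rule tendsto_imp_filterlim_at_right) (use Yev in \<open>auto elim!: eventually_mono\<close>)
  then show ?thesis using that Yev by blast
qed

end

text \<open>Bernoulli's inequality for a negative exponent: the graph lies above its tangent at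
  \<open>t = 1\<close>.\<close>

lemma powr_minus_tangent:
  fixes t p :: real
  assumes "t > 0" "p \<ge> 0"
  shows "1 - p * (t - 1) \<le> t powr (- p)"
proof -
  have "p * ln t \<le> p * (t - 1)" using assms by (intro mult_left_mono ln_le_minus_one)
  moreover have "1 + (- p * ln t) \<le> exp (- p * ln t)" by (rule exp_ge_add_one_self)
  ultimately show ?thesis using assms by (simp add: powr_def)
qed

text \<open>The number \<eta> is the zero of the derivative
  \<open>N - p * c * y powr (- p - 1)\<close>. Measured in units of \<eta>, minimality becomes the
  tangent inequality at 1.\<close>

lemma powr_add_linear_min:
  fixes c p N y \<eta> :: real
  assumes "c > 0" "p > 0" "N > 0" "y > 0" and \<eta>: "\<eta> = (p * c / N) powr (1 / (p + 1))"
  shows "c * \<eta> powr (- p) = N * \<eta> / p" "c * \<eta> powr (- p) + N * \<eta> \<le> c * y powr (- p) + N * y"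
proof -
  have \<eta>0: "\<eta> > 0" using assms by simp
  have "\<eta> powr (p + 1) = p * c / N" unfolding \<eta> using assms by (simp add: powr_powr)
  then have "\<eta> powr (p + 1) * \<eta> powr (- p) = p * c / N * \<eta> powr (- p)" by simp
  then have "\<eta> = p * c / N * \<eta> powr (- p)" using \<eta>0 by (simp flip: powr_add)
  then show eq: "c * \<eta> powr (- p) = N * \<eta> / p" using assms by (simp add: field_simps)
  define t where "t = y / \<eta>"
  have t: "t > 0" "y = t * \<eta>" using assms \<eta>0 by (auto simp: t_def)
  have "c * y powr (- p) = N * \<eta> / p * t powr (- p)"
    unfolding t(2) eq[symmetric] using t(1) \<eta>0 by (simp add: powr_mult)
  moreover have "N * \<eta> / p * (1 - p * (t - 1)) \<le> N * \<eta> / p * t powr (- p)"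
    using assms \<eta>0 t by (intro mult_left_mono powr_minus_tangent) auto
  moreover have "N * \<eta> / p * (1 - p * (t - 1)) + N * y = N * \<eta> / p + N * \<eta>"
    unfolding t(2) using assms by (simp add: field_simps)
  ultimately show "c * \<eta> powr (- p) + N * \<eta> \<le> c * y powr (- p) + N * y"
    unfolding eq by linarith
qed

text \<open>On the left stand the peak width, the Gaussian constant over \<open>2 * pi\<close>, and
  the exponential of the approximate logarithm at \<eta>. Both sides are compared on the logarithmic
  scale, where the prefactors are linear in the logarithms of the parameters.\<close>

lemma saddle_value_closed_form:
  fixes c m a D N \<eta> :: real
  assumes "c > 0" "m > 0" "N > 0" and \<eta>: "\<eta> = (m * c / N) powr (1 / (m + 1))"
  shows "\<eta> powr (1 + m / 2) * sqrt (2 * pi / ((m + 1) * (m * c))) / (2 * pi)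
      * exp (c * \<eta> powr (- m) + N * \<eta> - a * ln \<eta> + D)
    = (2 * pi * (m + 1)) powr (- 1 / 2) * (m * c) powr ((1 - 2 * a) / (2 * (m + 1)))
      * N powr ((2 * a - 2 - m) / (2 * (m + 1))) * exp ((N / m) powr (m / (m + 1)) * (m + 1) * c powr (1 / (m + 1)) + D)"
proof -
  have \<eta>0: "\<eta> > 0" using assms by simp
  have m1: "m + 1 > 0" "m + 1 \<noteq> 0" using assms by auto
  have ln\<eta>: "ln \<eta> = (ln (m * c) - ln N) / (m + 1)"
    unfolding \<eta> using assms by (simp add: ln_powr ln_div)
  have "N * \<eta> / m = exp (ln N + ln \<eta> - ln m)"
    using assms(1-3) \<eta>0 by (simp add: exp_add exp_diff)
  also have "ln N + ln \<eta> - ln m = m / (m + 1) * (ln N - ln m) + 1 / (m + 1) * ln c"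
  proof -
    define i where "i = 1 / (m + 1)"
    have a: "m / (m + 1) = 1 - i" using m1 by (simp add: i_def field_simps)
    have b: "ln \<eta> = (ln m + ln c - ln N) * i" using assms(1,2) by (simp add: ln\<eta> i_def ln_mult)
    show ?thesis unfolding a b i_def[symmetric] by (simp add: algebra_simps)
  qed
  also have "exp \<dots> = (N / m) powr (m / (m + 1)) * c powr (1 / (m + 1))"
    using assms by (simp add: powr_def exp_add ln_div)
  finally have e: "N * \<eta> / m = (N / m) powr (m / (m + 1)) * c powr (1 / (m + 1))" .
  have "c * \<eta> powr (- m) + N * \<eta> = N * \<eta> / m * (m + 1)"
    using powr_add_linear_min(1)[OF assms(1-3) assms(3) \<eta>] assms by (simp add: field_simps)
  then have main: "c * \<eta> powr (- m) + N * \<eta> = (N / m) powr (m / (m + 1)) * (m + 1) * c powr (1 / (m + 1))"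
    unfolding e by (simp add: mult_ac)
  define X where "X = 2 * pi / ((m + 1) * (m * c))"
  have X: "X > 0" "ln X = ln (2 * pi) - (ln (m + 1) + ln (m * c))"
    unfolding X_def using assms(1,2) by (simp, subst ln_div) (auto simp: ln_mult_pos)
  define K where "K = (1 + m / 2) * ln \<eta> + ln X / 2 - ln (2 * pi) - a * ln \<eta>"
  have K: "K = - 1 / 2 * (ln (2 * pi) + ln (m + 1)) + (1 - 2 * a) / (2 * (m + 1)) * ln (m * c) + (2 * a - 2 - m) / (2 * (m + 1)) * ln N"
  proof -
    define i where "i = 1 / (m + 1)"
    define W where "W = ln (m * c)"
    have i: "x / (m + 1) = x * i" "x / (2 * (m + 1)) = x * i / 2" for x by (auto simp: i_def)
    \<comment> \<open>With a name for the reciprocal of \<open>m + 1\<close> the fractions become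
      products, and this relation closes the identity.\<close>
    have "m * i = 1 - i" using m1 by (simp add: i_def field_simps)
    then have z: "m * i * W - (1 - i) * W = 0" by simp
    have "K - (- 1 / 2 * (ln (2 * pi) + ln (m + 1)) + (1 - 2 * a) / (2 * (m + 1)) * W + (2 * a - 2 - m) / (2 * (m + 1)) * ln N)
      = (m * i * W - (1 - i) * W) / 2"
      unfolding K_def X(2) ln\<eta> W_def[symmetric] i by (simp add: field_simps)
    then show ?thesis unfolding W_def[symmetric] by (simp only: z div_0 right_minus_eq)
  qed
  have "sqrt X = exp (ln X / 2)" using X(1) by (simp flip: ln_sqrt)
  moreover have "\<eta> powr (1 + m / 2) = exp ((1 + m / 2) * ln \<eta>)" using \<eta>0 by (simp add: powr_def)
  moreover have "exp (ln (2 * pi)) = 2 * pi" by simp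
  ultimately have L: "\<eta> powr (1 + m / 2) * sqrt X / (2 * pi) = exp ((1 + m / 2) * ln \<eta> + ln X / 2 - ln (2 * pi))"
    by (simp only: exp_add exp_diff)
  have "(2 * pi * (m + 1)) powr (- 1 / 2) = exp (- 1 / 2 * (ln (2 * pi) + ln (m + 1)))"
    using ln_mult_pos[of "2 * pi" "m + 1"] m1 by (simp add: powr_def)
  moreover have "(m * c) powr ((1 - 2 * a) / (2 * (m + 1))) = exp ((1 - 2 * a) / (2 * (m + 1)) * ln (m * c))"
    "N powr ((2 * a - 2 - m) / (2 * (m + 1))) = exp ((2 * a - 2 - m) / (2 * (m + 1)) * ln N)"
    unfolding powr_def using assms(1-3) by simp_all
  ultimately have "(2 * pi * (m + 1)) powr (- 1 / 2) * (m * c) powr ((1 - 2 * a) / (2 * (m + 1)))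
      * N powr ((2 * a - 2 - m) / (2 * (m + 1))) = exp K"
    unfolding K by (simp only: exp_add)
  then show ?thesis unfolding main X_def[symmetric] L K_def by (simp only: exp_add[symmetric]) (simp add: algebra_simps)
qed

section \<open>The asymptotic formula\<close>

context meinardus
begin

text \<open>The count is \<open>exp (V n) / (2 * pi)\<close> times the circle integral, taken at the
  true saddle point \<open>Y n\<close>; the formula refers to the explicit point
  \<open>\<eta> n\<close> and the value \<open>U n\<close>. The limit 1 of
  \<open>Y n / \<eta> n\<close> is enough for the power factor, and \<open>V n - U n\<close> tends
  to 0 by minimality.\<close>

lemma total_partitions_asymp:
  assumes one: "1 \<in> range L"
  shows "(\<lambda>n. complex_of_real (real (total_partitions L n))) \<sim>[at_top]
    (\<lambda>n. complex_of_real
          ((2 * pi * (\<mu> + 1)) powr (- 1 / 2) * (\<mu> * zconst) powr ((1 - 2 * A 0) / (2 * (\<mu> + 1)))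
           * real n powr ((2 * A 0 - 2 - \<mu>) / (2 * (\<mu> + 1)))
           * exp ((real n / \<mu>) powr (\<mu> / (\<mu> + 1)) * (\<mu> + 1) * zconst powr (1 / (\<mu> + 1)) + (euler_mascheroni * A 0 + kernel_int))))"
proof -
  define D where "D = euler_mascheroni * A 0 + kernel_int"
  define w where "w = \<mu> * zconst"
  have m: "\<mu> > 0" by (rule mu_pos)
  have w: "w > 0" unfolding w_def by (rule mult_pos_pos[OF m zconst_pos])
  obtain Y where Y: "eventually (\<lambda>n. Y n > 0 \<and> mom 1 (Y n) = real n) sequentially"
    and Y0: "filterlim Y (at_right 0) sequentially" by (rule saddle_points)
  define \<eta> where "\<eta> = (\<lambda>n. (w / real n) powr (1 / (\<mu> + 1)))"
  define q where "q = (\<lambda>n. Y n / \<eta> n)"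
  define U where "U = (\<lambda>n. zconst * \<eta> n powr k 0 + real n * \<eta> n - A 0 * ln (\<eta> n) + D)"
  define V where "V = (\<lambda>n. mom 0 (Y n) + real n * Y n)"
  define R where "R = (\<lambda>y. mom 0 y - zconst * y powr k 0 + A 0 * ln y - D)"
  have n1: "eventually (\<lambda>n::nat. n > 0) sequentially" by (rule eventually_gt_at_top)
  have \<eta>pos: "\<eta> n > 0" if "n > 0" for n using that w by (simp add: \<eta>_def)
  have \<eta>0: "filterlim \<eta> (at_right 0) sequentially"
    unfolding \<eta>_def using w m by real_asymp
  \<comment> \<open>At the saddle point the leading term of \<open>mom 1\<close> says that
    \<open>n * Y n powr (\<mu> + 1)\<close> tends to \<open>w\<close>, which compares
    \<open>Y n\<close> with \<open>\<eta> n\<close>.\<close>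
  have "((\<lambda>n. mom 1 (Y n) * Y n powr (\<mu> + 1)) \<longlongrightarrow> w) sequentially"
    unfolding w_def by (rule filterlim_compose[OF mom_1_lim Y0])
  then have "((\<lambda>n. (mom 1 (Y n) * Y n powr (\<mu> + 1) / w) powr (1 / (\<mu> + 1))) \<longlongrightarrow> (w / w) powr (1 / (\<mu> + 1))) sequentially"
    by (intro tendsto_intros) (use w in auto)
  moreover have "eventually (\<lambda>n. (mom 1 (Y n) * Y n powr (\<mu> + 1) / w) powr (1 / (\<mu> + 1)) = q n) sequentially"
    using Y n1
  proof eventually_elim
    case (elim n)
    have "mom 1 (Y n) * Y n powr (\<mu> + 1) / w = Y n powr (\<mu> + 1) / (w / real n)" using elim by simp
    also have "\<dots> powr (1 / (\<mu> + 1)) = (Y n powr (\<mu> + 1)) powr (1 / (\<mu> + 1)) / \<eta> n"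
      unfolding \<eta>_def by (rule powr_divide)
    also have "(Y n powr (\<mu> + 1)) powr (1 / (\<mu> + 1)) = Y n" using elim m by (simp add: powr_powr)
    finally show ?case by (simp add: q_def)
  qed
  ultimately have "(q \<longlongrightarrow> (w / w) powr (1 / (\<mu> + 1))) sequentially"
    by (rule Lim_transform_eventually)
  then have q: "q \<longlonglongrightarrow> 1" using w by simp
  have "(R \<longlongrightarrow> D - D) (at_right 0)"
    unfolding R_def D_def by (intro tendsto_diff mom_0_asymp tendsto_const)
  then have R: "(R \<longlongrightarrow> 0) (at_right 0)" by simp
  have V: "(\<lambda>n. V n - U n) \<longlonglongrightarrow> 0"
  \<comment> \<open>Above: \<open>Y n\<close> minimises \<open>mom 0 y + n * y\<close>, whose value
    at \<open>\<eta> n\<close> is \<open>U n + R (\<eta> n)\<close>. Below: \<open>\<eta> n\<close>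
    minimises \<open>zconst * y powr k 0 + n * y\<close>, and the logarithmic terms differ by
    \<open>A 0 * ln (q n)\<close>.\<close>
  proof (rule tendsto_sandwich[where f = "\<lambda>n. R (Y n) - A 0 * ln (q n)" and h = "\<lambda>n. R (\<eta> n)"])
    show "(\<lambda>n. R (\<eta> n)) \<longlonglongrightarrow> 0" by (rule filterlim_compose[OF R \<eta>0])
    have "(\<lambda>n. R (Y n) - A 0 * ln (q n)) \<longlonglongrightarrow> 0 - A 0 * ln 1"
      by (intro tendsto_intros filterlim_compose[OF R Y0] q) auto
    then show "(\<lambda>n. R (Y n) - A 0 * ln (q n)) \<longlonglongrightarrow> 0" by simp
    show "eventually (\<lambda>n. V n - U n \<le> R (\<eta> n)) sequentially"
      using Y n1
    proof eventually_elim
      case (elim n)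
      have "mom 0 (\<eta> n) \<ge> mom 0 (Y n) - mom 1 (Y n) * (\<eta> n - Y n)"
        by (rule mom_0_convex) (use elim \<eta>pos in auto)
      then show ?case using elim by (simp add: V_def U_def R_def algebra_simps)
    qed
    show "eventually (\<lambda>n. R (Y n) - A 0 * ln (q n) \<le> V n - U n) sequentially"
      using Y n1
    proof eventually_elim
      case (elim n)
      have "zconst * \<eta> n powr k 0 + real n * \<eta> n \<le> zconst * Y n powr k 0 + real n * Y n"
        using powr_add_linear_min(2)[OF zconst_pos m, of "real n" "Y n" "\<eta> n"] elim
        by (simp add: \<eta>_def w_def)
      moreover have "A 0 * ln (q n) = A 0 * ln (Y n) - A 0 * ln (\<eta> n)"
        using elim \<eta>pos[of n] by (simp add: q_def ln_div right_diff_distrib)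
      ultimately show ?case unfolding V_def U_def R_def by linarith
    qed
  qed
  define s where "s = sqrt (2 * pi / curv)"
  have s: "s > 0" unfolding s_def real_sqrt_gt_0_iff by (rule divide_pos_pos[OF _ curv_pos]) simp
  define f where "f = (\<lambda>n. \<eta> n powr (1 + \<mu> / 2) * s / (2 * pi) * exp (U n))"
  have "(\<lambda>n. of_real (exp (V n - U n) * q n powr (1 + \<mu> / 2)) * ((LBINT \<theta>:{-pi..pi}. exp (circ (Y n) \<theta>)) / of_real (Y n powr (1 + \<mu> / 2))) / of_real s)
     \<longlonglongrightarrow> of_real (exp 0 * 1 powr (1 + \<mu> / 2)) * of_real s / of_real s"
    unfolding s_def using s
    by (intro tendsto_intros V q filterlim_compose[OF circ_integral_lim[OF one] Y0]) (auto simp: s_def)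
  moreover have "eventually (\<lambda>n. of_real (exp (V n - U n) * q n powr (1 + \<mu> / 2)) * ((LBINT \<theta>:{-pi..pi}. exp (circ (Y n) \<theta>)) / of_real (Y n powr (1 + \<mu> / 2))) / of_real s
     = complex_of_real (real (total_partitions L n)) / of_real (f n)) sequentially"
    using Y n1
  proof eventually_elim
    case (elim n)
    define J where "J = (LBINT \<theta>:{-pi..pi}. exp (circ (Y n) \<theta>))"
    have "complex_of_real (2 * pi * real (total_partitions L n)) = of_real (exp (V n)) * J"
      unfolding J_def V_def using elim by (intro total_partitions_circ) auto
    then have p: "of_real (real (total_partitions L n)) = of_real (exp (V n) / (2 * pi)) * J"
      by (simp add: field_simps)
    define \<alpha> \<beta> where "\<alpha> = Y n powr (1 + \<mu> / 2)" and "\<beta> = \<eta> n powr (1 + \<mu> / 2)"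
    have q\<alpha>: "q n powr (1 + \<mu> / 2) = \<alpha> / \<beta>"
      unfolding q_def \<alpha>_def \<beta>_def by (rule powr_divide)
    have "\<alpha> \<noteq> 0" "\<beta> \<noteq> 0" using elim \<eta>pos[of n] by (auto simp: \<alpha>_def \<beta>_def)
    then show ?case using s
      by (simp only: p q\<alpha> f_def J_def[symmetric] \<alpha>_def[symmetric] \<beta>_def[symmetric] exp_diff) simp
  qed
  ultimately have "(\<lambda>n. complex_of_real (real (total_partitions L n)) / of_real (f n)) \<longlonglongrightarrow> of_real (exp 0 * 1 powr (1 + \<mu> / 2)) * of_real s / of_real s"
    by (rule Lim_transform_eventually)
  then have "(\<lambda>n. complex_of_real (real (total_partitions L n)) / of_real (f n)) \<longlonglongrightarrow> 1" using s by simp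
  then have f: "(\<lambda>n. complex_of_real (real (total_partitions L n))) \<sim>[at_top] (\<lambda>n. of_real (f n))"
    by (rule asymp_equivI')
  have "eventually (\<lambda>n. f n = (2 * pi * (\<mu> + 1)) powr (- 1 / 2) * (\<mu> * zconst) powr ((1 - 2 * A 0) / (2 * (\<mu> + 1)))
           * real n powr ((2 * A 0 - 2 - \<mu>) / (2 * (\<mu> + 1)))
           * exp ((real n / \<mu>) powr (\<mu> / (\<mu> + 1)) * (\<mu> + 1) * zconst powr (1 / (\<mu> + 1)) + D)) sequentially"
    using n1
  proof eventually_elim
    case (elim n)
    then have "real n > 0" by simp
    from saddle_value_closed_form[OF zconst_pos m this refl, of "A 0" D]
    show ?case by (simp only: f_def U_def \<eta>_def w_def s_def minus_minus)
  qed
  then have "eventually (\<lambda>n. complex_of_real (f n) = of_real ((2 * pi * (\<mu> + 1)) powr (- 1 / 2) * (\<mu> * zconst) powr ((1 - 2 * A 0) / (2 * (\<mu> + 1)))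
           * real n powr ((2 * A 0 - 2 - \<mu>) / (2 * (\<mu> + 1)))
           * exp ((real n / \<mu>) powr (\<mu> / (\<mu> + 1)) * (\<mu> + 1) * zconst powr (1 / (\<mu> + 1)) + D))) sequentially"
    by eventually_elim (simp only:)
  from asymp_equiv_trans[OF f asymp_equiv_refl_ev[OF this]] show ?thesis unfolding D_def .
qed

end

theorem corollary6:
  fixes \<Lambda> :: "nat \<Rightarrow> nat" and k :: "nat \<Rightarrow> real" and A :: "real \<Rightarrow> real" and \<mu> :: real
  assumes "admissible_seq \<Lambda>"
    and "theta_expansion \<Lambda> k A"
    and "\<forall>i>0. k i \<ge> 0"
    and "\<mu> = - k 0"
  shows "(\<lambda>n. complex_of_real (real (total_partitions \<Lambda> n))) \<sim>[at_top]
    (\<lambda>n. complex_of_real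
          ((2 * pi * (\<mu> + 1)) powr (- 1 / 2)
           * (\<mu> * riemann_zeta (\<mu> + 1) * A (- \<mu>)) powr ((1 - 2 * A 0) / (2 * (\<mu> + 1)))
           * real n powr ((2 * A 0 - 2 - \<mu>) / (2 * (\<mu> + 1))))
        * exp (complex_of_real
                ((real n / \<mu>) powr (\<mu> / (\<mu> + 1)) * (\<mu> + 1)
                 * (riemann_zeta (\<mu> + 1) * A (- \<mu>)) powr (1 / (\<mu> + 1)))
               + deriv (seq_zeta \<Lambda> \<mu>) 0))"
proof -
  interpret meinardus \<Lambda> k A
    by unfold_locales (use assms in \<open>auto simp: admissible_seq_def\<close>)
  have "1 \<in> range \<Lambda>" using assms(1) by (simp add: admissible_seq_def)
  moreover have "- k 0 * riemann_zeta (- k 0 + 1) * A (- (- k 0)) = - k 0 * zconst"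
    "riemann_zeta (- k 0 + 1) * A (- (- k 0)) = zconst" by simp_all
  \<comment> \<open>By \<open>deriv_seq_zeta_0\<close> the derivative is a real number, so the
    complex exponential in the statement is the image of a real one.\<close>
  ultimately show ?thesis using total_partitions_asymp unfolding assms(4)
    by (simp only: deriv_seq_zeta_0 of_real_mult exp_of_real[symmetric] of_real_add mult.assoc)
qed

end
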